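(* Let three-dimensional (pseudo)Euclidean space, with coordinates $(t,x^1,x^2)$, carry the canonical diagonal metric $g=\mathrm{diag}(\eta,g_{11},g_{22})$, where $\eta=g_{00}\in\{1,-1\}$ and $g_{11},g_{22}\in\{1,-1\}$. Write $\mathsf v\cdot\mathsf w=g_{11}v^1w^1+g_{22}v^2w^2$. The invariant parameter-indifferent third-order Euler–Poisson (variational) equation in this space (invariance under the (pseudo)Euclidean group being understood as defined in the context) is, up to an overall nonzero constant factor, $$-\frac{\ast\mathsf v''}{(1+\mathsf v\cdot\mathsf v)^{3/2}}+3\,\frac{\ast\mathsf v'}{(1+\mathsf v\cdot\mathsf v)^{5/2}}\,(\mathsf v\cdot\mathsf v')+\frac{\mu}{(1+\mathsf v\cdot\mathsf v)^{3/2}}\,\bigl((1+\mathsf v\cdot\mathsf v)\,\mathsf v'-(\mathsf v'\cdot\mathsf v)\,\mathsf v\bigr)=0,$$ where the arbitrary constant $\mu$ parametrizes the set of all such variational equations. Here the left-hand side is a covector with components $i=1,2$: in the last term $\mathsf v,\mathsf v'$ are read with lowered indices $v_i=g_{ij}v^j$, $v'_i=g_{ij}v'^j$, and $(\ast\mathsf w)_i=\varepsilon_{ji}w^j$ with $\varepsilon_{12}=-\varepsilon_{21}=1$, $\varepsilon_{11}=\varepsilon_{22}=0$.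
   Context: Unparametrized curves in three-dimensional space are described locally as graphs $t\mapsto(x^1(t),x^2(t))$, with jet coordinates $t,x^i,v^i,v'^i,v''^i$ ($i=1,2$) on $J^3(\mathbb R,\mathbb R^2)$, where $v^i=dx^i/dt$, $v'^i=dv^i/dt$, $v''^i=dv'^i/dt$. Working with such jets (contact elements of one-dimensional submanifolds) is what makes the equation parameter-indifferent. Third-order Euler–Poisson (variational) equation: $\mathsf E_i(t,x,v,v',v'')=0$, $i=1,2$, such that locally there is a Lagrangian $L(t,x^i,v^i,v'^i,\dots)$ with $\mathsf E_i=\sum_{s\ge0}(-1)^sD_t^s\,\partial L/\partial v^i_{s-1}$, where $v^i_{-1}=x^i$, $v^i_0=v^i$, $v^i_1=v'^i$, etc., and $D_t$ is the total derivative. Such expressions have the form $$\mathsf E=\mathsf A\,\mathsf v''+\mathsf k,\qquad \mathsf k=\bigl(v'^l\partial_{v^l}\mathsf A\bigr)\mathsf v'+\mathsf B\,\mathsf v'+\mathsf c,$$ with $\mathsf A$ a skew-symmetric $2\times2$ matrix, $\mathsf B$ a $2\times2$ matrix and $\mathsf c$ a column, all depending on $t,x^i,v^i$. Being of third order means that the skew-symmetric matrix $\mathsf A$ is invertible. Invariance: $\mathsf A$ and $\mathsf k$ are required not to depend on $t$ and $x^i$, and the following is required for every infinitesimal (pseudo)Euclidean transformation $$X=-(\pi\cdot\mathsf x)\,\partial_t+\eta\,t\,\pi^i\partial_{x^i}+\Omega\cdot(\mathsf x\wedge\partial_{\mathsf x})+\eta\,\pi^i\partial_{v^i}+(\pi\cdot\mathsf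 v)\,v^i\partial_{v^i}+\Omega\cdot(\mathsf v\wedge\partial_{\mathsf v})+2(\pi\cdot\mathsf v)\,v'^i\partial_{v'^i}+(\pi\cdot\mathsf v')\,v^i\partial_{v'^i}+\Omega\cdot(\mathsf v'\wedge\partial_{\mathsf v'}),$$ where $\pi\in\mathbb R^2$ is an arbitrary constant vector, $\Omega$ is an arbitrary constant skew-symmetric $2\times2$ matrix, and the terms with $\Omega$ are the infinitesimal rotations, preserving $(g_{ij})_{i,j=1,2}$, of $\mathsf x$, $\mathsf v$ and $\mathsf v'$ (the centered dot denotes contraction by means of the metric). Consider the vector-valued one-form $\epsilon$ with components $\epsilon_i=\mathsf A_{ij}\,dv'^j+\mathsf k_i\,dt$. Then there must exist matrices $\Phi,\Xi,\Pi$ depending on $\mathsf v$ and $\mathsf v'$ such that the componentwise Lie derivative satisfies $$\mathcal L_X\epsilon=\Phi\,\epsilon+\Xi\,(d\mathsf x-\mathsf v\,dt)+\Pi\,(d\mathsf v-\mathsf v'\,dt).$$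
   Formalization: For η=−1 the displayed formula is not invariant, as X(v·v)=2(π·v)(η+v·v); it is corrected by using η·g in place of g in all dots and lowered indices (so 1+v·v becomes 1+η v·v). Velocities range over open connected sets where this quantity is positive. *)

theory Defs
  imports "HOL-Analysis.Analysis"
begin

section \<open>Jets of unparametrized curves and the Euler--Poisson expression\<close>

text \<open>
  A jet is a pair \<open>(t, u)\<close>, where \<open>u 0 = x\<close>, \<open>u 1 = v\<close>, \<open>u 2 = v'\<close>, \<open>u 3 = v''\<close>, and so on.
  Using infinite sequences of derivatives allows Lagrangians of arbitrary finite order.  The
  topology on jets is the product topology, so every open set contains around each of its points
  an open cylinder over a jet space of finite order.
\<close>

type_synonym jet = "real \<times> (nat \<Rightarrow> real^2)"

datatype coord = Time | Deriv nat 2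

fun shift :: "coord \<Rightarrow> real \<Rightarrow> jet \<Rightarrow> jet" where
  "shift Time h (t, u) = (t + h, u)"
| "shift (Deriv s i) h (t, u) = (t, u(s := u s + h *\<^sub>R axis i 1))"

definition pd :: "coord \<Rightarrow> (jet \<Rightarrow> real) \<Rightarrow> jet \<Rightarrow> real" where
  "pd c F p = deriv (\<lambda>h. F (shift c h p)) 0"

primrec Ck_jet :: "nat \<Rightarrow> jet set \<Rightarrow> (jet \<Rightarrow> real) \<Rightarrow> bool" where
  "Ck_jet 0 W F \<longleftrightarrow> continuous_on W F"
| "Ck_jet (Suc n) W F \<longleftrightarrow> continuous_on W F \<and>
     (\<forall>c. (\<forall>p\<in>W. (\<lambda>h. F (shift c h p)) field_differentiable (at 0)) \<and> Ck_jet n W (pd c F))"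

definition smooth_jet :: "jet set \<Rightarrow> (jet \<Rightarrow> real) \<Rightarrow> bool" where
  "smooth_jet W F \<longleftrightarrow> (\<forall>n. Ck_jet n W F)"

definition order_le :: "nat \<Rightarrow> jet set \<Rightarrow> (jet \<Rightarrow> real) \<Rightarrow> bool" where
  "order_le r W F \<longleftrightarrow>
     (\<forall>t u w. (t, u) \<in> W \<longrightarrow> (t, w) \<in> W \<longrightarrow> (\<forall>s\<le>r. u s = w s) \<longrightarrow> F (t, u) = F (t, w))"

text \<open>
  For functions of finite order all but finitely many terms of the two series below vanish, so
  both are finite sums.
\<close>

definition total_deriv :: "(jet \<Rightarrow> real) \<Rightarrow> jet \<Rightarrow> real" where
  "total_deriv F p =
     pd Time F p + (\<Sum>s. \<Sum>i\<in>UNIV. snd p (Suc s) $ i * pd (Deriv s i) F p)"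

definition euler_expr :: "(jet \<Rightarrow> real) \<Rightarrow> jet \<Rightarrow> real^2" where
  "euler_expr L p = (\<chi> i. \<Sum>s. (-1) ^ s * (total_deriv ^^ s) (pd (Deriv s i) L) p)"

text \<open>
  Third-order expressions are functions of \<open>t\<close>, \<open>x\<close>, \<open>v\<close>, \<open>v'\<close>, \<open>v''\<close>, where \<open>v\<close> ranges over a
  set \<open>U\<close> and the other variables are unrestricted.
\<close>

definition jet_domain :: "(real^2) set \<Rightarrow> jet set" where
  "jet_domain U = {(t, u). u 1 \<in> U}"

definition variational ::
    "(real^2) set \<Rightarrow> (real \<Rightarrow> real^2 \<Rightarrow> real^2 \<Rightarrow> real^2 \<Rightarrow> real^2 \<Rightarrow> real^2) \<Rightarrow> bool" where
  "variational U E \<longleftrightarrow>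
     (\<forall>p \<in> jet_domain U. \<exists>W L r.
        open W \<and> p \<in> W \<and> W \<subseteq> jet_domain U \<and> order_le r W L \<and> smooth_jet W L \<and>
        (\<forall>(t, u) \<in> W. E t (u 0) (u 1) (u 2) (u 3) = euler_expr L (t, u)))"

definition smooth_coeff :: "(real^2) set \<Rightarrow> (real \<Rightarrow> real^2 \<Rightarrow> real^2 \<Rightarrow> real) \<Rightarrow> bool" where
  "smooth_coeff U f \<longleftrightarrow> smooth_jet (jet_domain U) (\<lambda>(t, u). f t (u 0) (u 1))"

definition k_term ::
    "(real \<Rightarrow> real^2 \<Rightarrow> real^2 \<Rightarrow> real^2^2) \<Rightarrow> (real \<Rightarrow> real^2 \<Rightarrow> real^2 \<Rightarrow> real^2^2) \<Rightarrow>
     (real \<Rightarrow> real^2 \<Rightarrow> real^2 \<Rightarrow> real^2) \<Rightarrow> real \<Rightarrow> real^2 \<Rightarrow> real^2 \<Rightarrow> real^2 \<Rightarrow> real^2" where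
  "k_term A B c t x v v' =
     (\<Sum>l\<in>UNIV. v' $ l *\<^sub>R vector_derivative (\<lambda>h. A t x (v + h *\<^sub>R axis l 1)) (at 0)) *v v'
     + B t x v *v v' + c t x v"

definition third_order_form ::
    "(real^2) set \<Rightarrow> (real \<Rightarrow> real^2 \<Rightarrow> real^2 \<Rightarrow> real^2 \<Rightarrow> real^2 \<Rightarrow> real^2) \<Rightarrow>
     (real \<Rightarrow> real^2 \<Rightarrow> real^2 \<Rightarrow> real^2^2) \<Rightarrow> (real \<Rightarrow> real^2 \<Rightarrow> real^2 \<Rightarrow> real^2^2) \<Rightarrow>
     (real \<Rightarrow> real^2 \<Rightarrow> real^2 \<Rightarrow> real^2) \<Rightarrow> bool" where
  "third_order_form U E A B c \<longleftrightarrow>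
     (\<forall>i j. smooth_coeff U (\<lambda>t x v. A t x v $ i $ j)) \<and>
     (\<forall>i j. smooth_coeff U (\<lambda>t x v. B t x v $ i $ j)) \<and>
     (\<forall>i. smooth_coeff U (\<lambda>t x v. c t x v $ i)) \<and>
     (\<forall>t x. \<forall>v\<in>U. transpose (A t x v) = - A t x v \<and> invertible (A t x v)) \<and>
     (\<forall>t x. \<forall>v\<in>U. \<forall>v' v''. E t x v v' v'' = A t x v *v v'' + k_term A B c t x v v')"


section \<open>(Pseudo)Euclidean invariance\<close>

text \<open>
  The metric is \<open>diag(\<eta>, g $ 1, g $ 2)\<close>; the vector \<open>g\<close> lists the diagonal entries of its
  spatial part.
\<close>

definition lower :: "real^2 \<Rightarrow> real^2 \<Rightarrow> real^2" where
  "lower g v = (\<chi> i. g $ i * v $ i)"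

definition mdot :: "real^2 \<Rightarrow> real^2 \<Rightarrow> real^2 \<Rightarrow> real" where
  "mdot g v w = (\<Sum>i\<in>UNIV. g $ i * v $ i * w $ i)"

text \<open>Coefficients of \<open>\<Omega> \<cdot> (w \<and> \<partial>\<^sub>w)\<close>: the \<open>j\<close>-th component is \<open>\<Omega>\<^sup>i\<^sup>j w\<^sub>i\<close> with \<open>w\<^sub>i = g\<^sub>i\<^sub>l w\<^sup>l\<close>.\<close>

definition rot :: "real^2 \<Rightarrow> real^2^2 \<Rightarrow> real^2 \<Rightarrow> real^2" where
  "rot g \<Omega> w = transpose \<Omega> *v lower g w"

type_synonym jet2 = "real \<times> (real^2) \<times> (real^2) \<times> (real^2)"  \<comment> \<open>\<open>(t, x, v, v')\<close>\<close>

fun generator :: "real \<Rightarrow> real^2 \<Rightarrow> real^2 \<Rightarrow> real^2^2 \<Rightarrow> jet2 \<Rightarrow> jet2" where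
  "generator \<eta> g \<pi> \<Omega> (t, x, v, v') =
     (- mdot g \<pi> x,
      (\<eta> * t) *\<^sub>R \<pi> + rot g \<Omega> x,
      \<eta> *\<^sub>R \<pi> + mdot g \<pi> v *\<^sub>R v + rot g \<Omega> v,
      (2 * mdot g \<pi> v) *\<^sub>R v' + mdot g \<pi> v' *\<^sub>R v + rot g \<Omega> v')"

text \<open>
  A vector-valued one-form is given as \<open>\<epsilon> p w\<close>, with base point \<open>p\<close> and linear in the tangent
  vector \<open>w\<close>.  In coordinates, \<open>(L\<^sub>X \<epsilon>)\<^sub>b = X\<^sup>a \<partial>\<^sub>a \<epsilon>\<^sub>b + \<epsilon>\<^sub>a \<partial>\<^sub>b X\<^sup>a\<close>.
\<close>

definition lie_derivative ::
    "(jet2 \<Rightarrow> jet2) \<Rightarrow> (jet2 \<Rightarrow> jet2 \<Rightarrow> real^2) \<Rightarrow> jet2 \<Rightarrow> jet2 \<Rightarrow> real^2" where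
  "lie_derivative X \<epsilon> p w =
     frechet_derivative (\<lambda>q. \<epsilon> q w) (at p) (X p) + \<epsilon> p (frechet_derivative X (at p) w)"

fun eps_form :: "(real \<Rightarrow> real^2 \<Rightarrow> real^2 \<Rightarrow> real^2^2) \<Rightarrow>
    (real \<Rightarrow> real^2 \<Rightarrow> real^2 \<Rightarrow> real^2 \<Rightarrow> real^2) \<Rightarrow> jet2 \<Rightarrow> jet2 \<Rightarrow> real^2" where
  "eps_form A k (t, x, v, v') (dt, dx, dv, dv') = A t x v *v dv' + dt *\<^sub>R k t x v v'"

definition independent_of_position :: "(real^2) set \<Rightarrow> (real \<Rightarrow> real^2 \<Rightarrow> real^2 \<Rightarrow> real^2^2) \<Rightarrow>
    (real \<Rightarrow> real^2 \<Rightarrow> real^2 \<Rightarrow> real^2 \<Rightarrow> real^2) \<Rightarrow> bool" where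
  "independent_of_position U A k \<longleftrightarrow>
     (\<forall>v\<in>U. \<forall>t x s y. A t x v = A s y v \<and> (\<forall>v'. k t x v v' = k s y v v'))"

definition group_invariant :: "real \<Rightarrow> real^2 \<Rightarrow> (real^2) set \<Rightarrow>
    (real \<Rightarrow> real^2 \<Rightarrow> real^2 \<Rightarrow> real^2^2) \<Rightarrow>
    (real \<Rightarrow> real^2 \<Rightarrow> real^2 \<Rightarrow> real^2 \<Rightarrow> real^2) \<Rightarrow> bool" where
  "group_invariant \<eta> g U A k \<longleftrightarrow>
     independent_of_position U A k \<and>
     (\<forall>\<pi> \<Omega>. transpose \<Omega> = - \<Omega> \<longrightarrow>
       (\<exists>\<Phi> \<Xi> \<Psi> :: real^2 \<Rightarrow> real^2 \<Rightarrow> real^2^2.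
          \<forall>t x v v' dt dx dv dv'. v \<in> U \<longrightarrow>
            lie_derivative (generator \<eta> g \<pi> \<Omega>) (eps_form A k) (t, x, v, v') (dt, dx, dv, dv') =
              \<Phi> v v' *v eps_form A k (t, x, v, v') (dt, dx, dv, dv')
              + \<Xi> v v' *v (dx - dt *\<^sub>R v) + \<Psi> v v' *v (dv - dt *\<^sub>R v')))"

definition invariant_euler_poisson :: "real \<Rightarrow> real^2 \<Rightarrow> (real^2) set \<Rightarrow>
    (real \<Rightarrow> real^2 \<Rightarrow> real^2 \<Rightarrow> real^2 \<Rightarrow> real^2 \<Rightarrow> real^2) \<Rightarrow> bool" where
  "invariant_euler_poisson \<eta> g U E \<longleftrightarrow>
     variational U E \<and>
     (\<exists>A B c. third_order_form U E A B c \<and> group_invariant \<eta> g U A (k_term A B c))"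


section \<open>The family of equations\<close>

definition levi :: "2 \<Rightarrow> 2 \<Rightarrow> real" where
  "levi i j = (if i = 1 \<and> j = 2 then 1 else if i = 2 \<and> j = 1 then -1 else 0)"

definition star :: "real^2 \<Rightarrow> real^2" where
  "star w = (\<chi> i. \<Sum>j\<in>UNIV. levi j i * w $ j)"

text \<open>
  The formula for a metric \<open>diag(1, h $ 1, h $ 2)\<close>.  The metrics \<open>diag(\<eta>, g $ 1, g $ 2)\<close> and
  \<open>\<eta> \<cdot> diag(\<eta>, g $ 1, g $ 2) = diag(1, \<eta> g $ 1, \<eta> g $ 2)\<close> have the same isometries, so for
  \<open>\<eta> = -1\<close> it is to be used with \<open>h = - g\<close>; with \<open>h = g\<close> it is not invariant in that case.
\<close>

definition invariant_expr ::
    "real^2 \<Rightarrow> real \<Rightarrow> real^2 \<Rightarrow> real^2 \<Rightarrow> real^2 \<Rightarrow> real^2" where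
  "invariant_expr h \<mu> v v' v'' =
     - ((1 / (1 + mdot h v v) powr (3/2)) *\<^sub>R star v'')
     + (3 * mdot h v v' / (1 + mdot h v v) powr (5/2)) *\<^sub>R star v'
     + (\<mu> / (1 + mdot h v v) powr (3/2)) *\<^sub>R
         ((1 + mdot h v v) *\<^sub>R lower h v' - mdot h v' v *\<^sub>R lower h v)"

end

theory Submission
  imports Defs "HOL-Library.Function_Algebras"
begin

text \<open>
  Multiplying the metric by \<open>\<eta>\<close> only renames the parameters \<open>\<pi>\<close> and \<open>\<Omega>\<close> of the infinitesimal
  isometries, so let \<open>\<eta> = 1\<close>.  Write \<open>h\<close> for the spatial metric, \<open>q = 1 + h(v, v)\<close>, and \<open>J\<close> for the
  matrix of \<open>\<epsilon>\<^sub>i\<^sub>j\<close>.  Skew-symmetry of \<open>A\<close> means \<open>A = a J\<close> with a scalar function \<open>a\<close> of \<open>v\<close>.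

  \<^bold>\<open>Invariant variational equations belong to the family.\<close>  On tangent vectors with \<open>dx = v dt\<close>,
  \<open>dv = v' dt\<close> and \<open>\<epsilon> = 0\<close> the three unknown matrices drop out of the invariance condition: the Lie
  derivative of \<open>\<epsilon>\<close> has to vanish there.  For a rotation \<open>\<Omega>\<close> and a point \<open>v\<close>, the generator with
  parameters \<open>\<pi> = \<Omega> v\<close> and \<open>- \<Omega>\<close> does not move \<open>v\<close>: it spans the isotropy algebra of the
  direction \<open>(1, v)\<close>.  For it the condition contains derivatives of \<open>k\<close> with respect to \<open>v'\<close> only,
  and \<open>k\<close> is an explicit quadratic polynomial in \<open>v'\<close>.  So the condition is algebraic at each point
  \<open>v\<close>, and splits by degree in \<open>v'\<close> (\<open>stabilizer_equation\<close>, \<open>stabilizer_system\<close>):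
  degree 0 gives \<open>c = 0\<close>, degree 2 gives \<open>d log a = - 3 h(v, dv) / q\<close>, and degree 1 leaves for the
  matrix \<open>B\<close> a two-dimensional space, spanned by \<open>J\<close> and by the Hessian of \<open>\<surd>q\<close>.

  Variationality is used once, to remove \<open>J\<close>.  An Euler--Lagrange expression has a formally
  self-adjoint linearization; the part of this symmetry that belongs to second derivatives, evaluated
  at \<open>v' = 0\<close>, says that \<open>B\<close> is symmetric (\<open>variational_symmetric\<close>).  It is derived
  for Lagrangians of every order with the higher Euler operators, on which total derivatives act as a
  shift of the index.

  Hence \<open>a q\<^bsup>3/2\<^esup>\<close> has derivative zero and is constant on the connected set \<open>U\<close>, and \<open>B\<close> is a function
  \<open>m\<close> of \<open>v\<close> times the Hessian of \<open>\<surd>q\<close>.  With constant \<open>m\<close> the form \<open>\<epsilon>\<close> is invariant, so for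
  variable \<open>m\<close> the only obstruction to invariance is the derivative of \<open>m\<close> along the generators
  (\<open>lie_derivative_family\<close>).  Their velocity parts \<open>\<pi> + h(\<pi>, v) v\<close> exhaust all directions since
  \<open>q \<noteq> 0\<close>, so \<open>m\<close> is constant too.

  \<^bold>\<open>The family is invariant and variational.\<close>  Invariance is the same computation of the Lie
  derivative, now with constant \<open>m\<close>.  A Lagrangian is \<open>f\<^sub>1 v'\<^sup>1 + f\<^sub>2 v'\<^sup>2 - m \<surd>q\<close>, with functions \<open>f\<^sub>i\<close> of \<open>v\<close>
  whose curl is a multiple of \<open>q\<^bsup>-3/2\<^esup>\<close>: the Euler--Lagrange expression of a Lagrangian that is linear
  in \<open>v'\<close> is of order three and involves \<open>f\<close> only through its curl.  Such \<open>f\<close> exist near every point of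
  \<open>U\<close> (\<open>family_variational\<close>).
\<close>

section \<open>Partial derivatives on jet space\<close>

lemma shift_0 [simp]: "shift c 0 p = p"
  by (cases c; cases p) auto

lemma shift_shift: "shift c h (shift c k p) = shift c (h + k) p"
  by (cases c; cases p) (auto simp: algebra_simps)

lemma shift_commute: "shift c h (shift d k p) = shift d k (shift c h p)"
  by (cases c; cases d; cases p) (auto simp: algebra_simps fun_eq_iff)

lemma snd_shift: "snd (shift c h p) s $ i = snd p s $ i + (if c = Deriv s i then h else 0)"
  by (cases c; cases p) (auto simp: axis_def)

lemma continuous_on_shift [continuous_intros]:
  assumes "continuous_on S f" "continuous_on S g"
  shows "continuous_on S (\<lambda>x. shift c (f x) (g x))"
proof (cases c)
  case Time
  have eq: "shift c (f x) (g x) = (fst (g x) + f x, snd (g x))" for x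
    by (cases "g x") (auto simp: Time)
  show ?thesis
    unfolding eq using assms by (intro continuous_intros)
next
  case (Deriv s i)
  have eq: "shift c (f x) (g x) = (fst (g x), \<lambda>n. if n = s then snd (g x) s + f x *\<^sub>R axis i 1 else snd (g x) n)" for x
    by (cases "g x") (auto simp: Deriv fun_eq_iff)
  have "continuous_on S (\<lambda>x. snd (g x) n)" for n
    by (rule continuous_on_product_then_coordinatewise) (rule continuous_on_snd[OF assms(2)])
  then have "continuous_on S (\<lambda>x. if n = s then snd (g x) s + f x *\<^sub>R axis i 1 else snd (g x) n)" for n
    by (cases "n = s") (use assms in \<open>auto intro!: continuous_intros\<close>)
  then show ?thesis
    unfolding eq using assms
    by (auto intro!: continuous_intros continuous_on_coordinatewise_then_product)
qed

lemma continuous_on_jet_coord: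
  "continuous_on S (\<lambda>p::jet. snd p s)"
  by (rule continuous_on_product_then_coordinatewise) (rule continuous_on_snd continuous_on_id)+

text \<open>A partial derivative at a point of an open set of jets depends only on the values in that set.  All
  identities between functions on jets below are therefore identities on an open set \<open>W\<close>.\<close>

lemma eventually_shift_in:
  assumes "open W" "p \<in> W"
  shows "\<forall>\<^sub>F h in nhds 0. shift c h p \<in> W"
proof -
  have "continuous_on UNIV (\<lambda>h. shift c h p)"
    by (intro continuous_intros)
  then have "open ((\<lambda>h. shift c h p) -` W)"
    using assms(1) by (simp add: continuous_on_open_vimage)
  moreover have "0 \<in> (\<lambda>h. shift c h p) -` W" using assms by simp
  ultimately show ?thesis
    unfolding eventually_nhds by (intro exI[of _ "(\<lambda>h. shift c h p) -` W"]) auto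
qed

lemma pd_eqI: "((\<lambda>h. F (shift c h p)) has_field_derivative d) (at 0) \<Longrightarrow> pd c F p = d"
  by (simp add: pd_def DERIV_imp_deriv)

lemma jet_cong_ev:
  assumes "open W" "\<And>q. q \<in> W \<Longrightarrow> F q = G q" "p \<in> W"
  shows "\<forall>\<^sub>F h in nhds 0. F (shift c h p) = G (shift c h p)"
  using eventually_shift_in[OF assms(1,3), of c] by eventually_elim (simp add: assms)

lemma pd_cong:
  assumes "open W" "\<And>q. q \<in> W \<Longrightarrow> F q = G q" "p \<in> W"
  shows "pd c F p = pd c G p"
  unfolding pd_def by (intro deriv_cong_ev jet_cong_ev[OF assms]) auto

lemma Ck_jet_cong:
  assumes "open W" "\<And>q. q \<in> W \<Longrightarrow> F q = G q" "Ck_jet n W F"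
  shows "Ck_jet n W G"
  using assms(2,3)
proof (induction n arbitrary: F G)
  case 0
  then show ?case by (simp cong: continuous_on_cong)
next
  case (Suc n)
  have "(\<lambda>h. G (shift c h p)) field_differentiable (at 0)" if "p \<in> W" for c p
  proof -
    obtain d where "((\<lambda>h. F (shift c h p)) has_field_derivative d) (at 0)"
      using Suc.prems(2) \<open>p \<in> W\<close> by (auto simp: field_differentiable_def)
    then have "((\<lambda>h. G (shift c h p)) has_field_derivative d) (at 0)"
      using DERIV_cong_ev[OF refl jet_cong_ev[of W F G, OF assms(1) Suc.prems(1) that] refl]
      by simp
    then show ?thesis by (auto simp: field_differentiable_def)
  qed
  moreover have "Ck_jet n W (pd c G)" for c
    by (rule Suc.IH[of "pd c F"])
      (use pd_cong[of W F G, OF assms(1) Suc.prems(1)] Suc.prems(2) in simp_all)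
  moreover have "continuous_on W G"
    using Suc.prems by (simp cong: continuous_on_cong)
  ultimately show ?case by simp
qed

lemma Ck_jet_SucD: "Ck_jet (Suc n) W F \<Longrightarrow> Ck_jet n W F"
  by (induction n arbitrary: F) auto

lemma Ck_jet_DERIV:
  assumes "Ck_jet (Suc n) W F" "p \<in> W"
  shows "((\<lambda>h. F (shift c h p)) has_field_derivative pd c F p) (at 0)"
  using assms by (auto simp: pd_def field_differentiable_derivI)

text \<open>Smoothness is defined through the operators \<open>pd\<close>.  All closure properties are inductions that use
  this step: it suffices to know the partial derivatives on \<open>W\<close>, not as functions.\<close>

lemma Ck_jet_SucI:
  assumes "open W" "continuous_on W F"
    "\<And>c p. p \<in> W \<Longrightarrow> ((\<lambda>h. F (shift c h p)) has_field_derivative F' c p) (at 0)"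
    "\<And>c. Ck_jet n W (F' c)"
  shows "Ck_jet (Suc n) W F"
proof -
  have "F' c p = pd c F p" if "p \<in> W" for c p
    using pd_eqI[of F c p "F' c p"] assms(3)[OF that, of c] by simp
  then have "Ck_jet n W (pd c F)" for c
    using Ck_jet_cong[of W "F' c" "pd c F" n] assms(1,4) by blast
  moreover have "(\<lambda>h. F (shift c h p)) field_differentiable (at 0)" if "p \<in> W" for c p
    unfolding field_differentiable_def by (rule exI[of _ "F' c p"]) (rule assms(3)[OF that])
  ultimately show ?thesis
    unfolding Ck_jet.simps by (intro conjI allI ballI assms(2))
qed

lemma Ck_jet_const: "Ck_jet n W (\<lambda>_. a)"
proof (induction n arbitrary: a)
  case (Suc n)
  have "pd c (\<lambda>_. a) = (\<lambda>_. 0)" for c by (auto simp: pd_def)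
  then show ?case using Suc by (auto simp: field_differentiable_const)
qed auto

lemma Ck_jet_coord:
  assumes "open W" shows "Ck_jet n W (\<lambda>p. snd p s $ i)"
proof (cases n)
  case (Suc m)
  show ?thesis unfolding Suc
    by (rule Ck_jet_SucI[where F' = "\<lambda>c p. if c = Deriv s i then 1 else 0"])
      (auto simp: assms snd_shift Ck_jet_const
        intro!: derivative_eq_intros continuous_intros continuous_on_jet_coord)
qed (auto intro!: continuous_intros continuous_on_jet_coord)

lemma Ck_jet_add:
  assumes "open W" "Ck_jet n W F" "Ck_jet n W G"
  shows "Ck_jet n W (\<lambda>p. F p + G p)"
  using assms(2,3)
proof (induction n arbitrary: F G)
  case (Suc n)
  show ?case
    by (rule Ck_jet_SucI[OF assms(1), where F' = "\<lambda>c p. pd c F p + pd c G p"])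
      (use Suc in \<open>auto intro!: continuous_intros derivative_intros Ck_jet_DERIV Suc.IH\<close>)
qed (auto intro!: continuous_intros)

lemma Ck_jet_mult:
  assumes "open W" "Ck_jet n W F" "Ck_jet n W G"
  shows "Ck_jet n W (\<lambda>p. F p * G p)"
  using assms(2,3)
proof (induction n arbitrary: F G)
  case (Suc n)
  show ?case
  proof (rule Ck_jet_SucI[OF assms(1), where F' = "\<lambda>c p. pd c F p * G p + pd c G p * F p"])
    show "((\<lambda>h. F (shift c h p) * G (shift c h p)) has_field_derivative pd c F p * G p + pd c G p * F p) (at 0)"
      if "p \<in> W" for c p
      using DERIV_mult[OF Ck_jet_DERIV[OF Suc.prems(1) that] Ck_jet_DERIV[OF Suc.prems(2) that]]
      by simp
    show "Ck_jet n W (\<lambda>p. pd c F p * G p + pd c G p * F p)" for c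
      using Suc.prems Ck_jet_SucD by (intro Ck_jet_add Suc.IH assms) auto
  qed (use Suc in \<open>auto intro!: continuous_intros\<close>)
qed (auto intro!: continuous_intros)

lemma Ck_jet_powr:
  assumes "open W" "Ck_jet n W F" "\<And>p. p \<in> W \<Longrightarrow> F p > 0"
  shows "Ck_jet n W (\<lambda>p. F p powr a)"
  using assms(2)
proof (induction n arbitrary: a)
  case 0
  then show ?case using assms(3) by (auto intro!: continuous_intros) (metis less_irrefl)
next
  case (Suc n)
  show ?case
  proof (rule Ck_jet_SucI[OF assms(1), where F' = "\<lambda>c p. (a * F p powr (a - 1)) * pd c F p"])
    show "((\<lambda>h. F (shift c h p) powr a) has_field_derivative (a * F p powr (a - 1)) * pd c F p) (at 0)"
      if "p \<in> W" for c p
    proof -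
      have "((\<lambda>x. x powr a) has_field_derivative a * F p powr (a - 1)) (at (F (shift c 0 p)))"
        using has_real_derivative_powr[of "F p" a] assms(3)[OF that] by simp
      from DERIV_chain2[OF this Ck_jet_DERIV[OF Suc.prems that, of c]] show ?thesis .
    qed
    show "Ck_jet n W (\<lambda>p. (a * F p powr (a - 1)) * pd c F p)" for c
      using Suc.prems Ck_jet_SucD by (intro Ck_jet_mult Suc.IH Ck_jet_const assms) auto
    show "continuous_on W (\<lambda>p. F p powr a)"
      using Suc.prems assms(3) by (auto intro!: continuous_intros) (metis less_irrefl)
  qed
qed

lemma Ck_jet_inverse:
  assumes "open W" "Ck_jet n W F" "\<And>p. p \<in> W \<Longrightarrow> F p \<noteq> 0"
  shows "Ck_jet n W (\<lambda>p. inverse (F p))"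
  using assms(2)
proof (induction n)
  case (Suc n)
  show ?case
  proof (rule Ck_jet_SucI[OF assms(1), where F' = "\<lambda>c p. (- 1 * (inverse (F p) * inverse (F p))) * pd c F p"])
    show "((\<lambda>h. inverse (F (shift c h p))) has_field_derivative (- 1 * (inverse (F p) * inverse (F p))) * pd c F p) (at 0)"
      if "p \<in> W" for c p
      using DERIV_inverse'[OF Ck_jet_DERIV[OF Suc.prems that, of c]] assms(3)[OF that]
      by (simp add: algebra_simps)
    show "Ck_jet n W (\<lambda>p. (- 1 * (inverse (F p) * inverse (F p))) * pd c F p)" for c
      using Suc Ck_jet_SucD by (intro Ck_jet_mult Suc.IH Ck_jet_const assms) auto
    show "continuous_on W (\<lambda>p. inverse (F p))"
      using Suc.prems assms(3) by (auto intro!: continuous_intros)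
  qed
qed (use assms(3) in \<open>auto intro!: continuous_intros\<close>)

lemma smooth_jet_DERIV:
  "smooth_jet W F \<Longrightarrow> p \<in> W \<Longrightarrow> ((\<lambda>h. F (shift c h p)) has_field_derivative pd c F p) (at 0)"
  unfolding smooth_jet_def by (metis Ck_jet_DERIV)

lemma smooth_jet_continuous: "smooth_jet W F \<Longrightarrow> continuous_on W F"
  unfolding smooth_jet_def by (metis Ck_jet.simps(1))

lemma smooth_jet_pd: "smooth_jet W F \<Longrightarrow> smooth_jet W (pd c F)"
  unfolding smooth_jet_def by (metis Ck_jet.simps(2))

lemma smooth_jet_cong:
  "open W \<Longrightarrow> (\<And>q. q \<in> W \<Longrightarrow> F q = G q) \<Longrightarrow> smooth_jet W F \<Longrightarrow> smooth_jet W G"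
  unfolding smooth_jet_def by (metis Ck_jet_cong)

lemma smooth_jet_const: "smooth_jet W (\<lambda>_. a)"
  by (simp add: smooth_jet_def Ck_jet_const)

lemma smooth_jet_coord: "open W \<Longrightarrow> smooth_jet W (\<lambda>p. snd p s $ i)"
  by (simp add: smooth_jet_def Ck_jet_coord)

lemma smooth_jet_add:
  "open W \<Longrightarrow> smooth_jet W F \<Longrightarrow> smooth_jet W G \<Longrightarrow> smooth_jet W (\<lambda>p. F p + G p)"
  by (simp add: smooth_jet_def Ck_jet_add)

lemma smooth_jet_mult:
  "open W \<Longrightarrow> smooth_jet W F \<Longrightarrow> smooth_jet W G \<Longrightarrow> smooth_jet W (\<lambda>p. F p * G p)"
  by (simp add: smooth_jet_def Ck_jet_mult)

lemma smooth_jet_diff: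
  "open W \<Longrightarrow> smooth_jet W F \<Longrightarrow> smooth_jet W G \<Longrightarrow> smooth_jet W (\<lambda>p. F p - G p)"
  using smooth_jet_add[of W F "\<lambda>p. -1 * G p"] smooth_jet_mult[of W "\<lambda>_. -1" G] smooth_jet_const[of W "-1"]
  by simp

lemma smooth_jet_sum:
  assumes "open W" "\<And>k. k \<in> K \<Longrightarrow> smooth_jet W (F k)"
  shows "smooth_jet W (\<lambda>p. \<Sum>k\<in>K. F k p)"
  using assms(2)
  by (induction K rule: infinite_finite_induct) (auto intro!: smooth_jet_const smooth_jet_add assms(1))

lemma smooth_jet_powr:
  "open W \<Longrightarrow> smooth_jet W F \<Longrightarrow> (\<And>p. p \<in> W \<Longrightarrow> F p > 0) \<Longrightarrow> smooth_jet W (\<lambda>p. F p powr a)"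
  by (simp add: smooth_jet_def Ck_jet_powr)

lemma smooth_jet_inverse:
  "open W \<Longrightarrow> smooth_jet W F \<Longrightarrow> (\<And>p. p \<in> W \<Longrightarrow> F p \<noteq> 0) \<Longrightarrow> smooth_jet W (\<lambda>p. inverse (F p))"
  by (simp add: smooth_jet_def Ck_jet_inverse)

lemmas smooth_jet_intros = smooth_jet_const smooth_jet_coord smooth_jet_add smooth_jet_diff
  smooth_jet_mult smooth_jet_sum smooth_jet_powr smooth_jet_inverse

section \<open>Symmetry of second derivatives\<close>

text \<open>The mean value theorem, applied in one variable after the other, turns the second difference of \<open>f\<close>
  over a square into a mixed derivative.\<close>

lemma second_difference_mean_value:
  fixes f :: "real \<Rightarrow> real \<Rightarrow> real"
  assumes "0 < e"
    and fx: "\<And>x y. 0 \<le> x \<Longrightarrow> x \<le> e \<Longrightarrow> 0 \<le> y \<Longrightarrow> y \<le> e \<Longrightarrow> ((\<lambda>x. f x y) has_field_derivative fx x y) (at x)"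
    and fxy: "\<And>x y. 0 \<le> x \<Longrightarrow> x \<le> e \<Longrightarrow> 0 \<le> y \<Longrightarrow> y \<le> e \<Longrightarrow> (fx x has_field_derivative fxy x y) (at y)"
  obtains x y where "0 < x" "x < e" "0 < y" "y < e" "f e e - f e 0 - f 0 e + f 0 0 = e * e * fxy x y"
proof -
  have "\<exists>z. 0 < z \<and> z < e \<and> (f e e - f e 0) - (f 0 e - f 0 0) = (e - 0) * (fx z e - fx z 0)"
    by (rule MVT2) (use assms in \<open>auto intro!: DERIV_diff\<close>)
  then obtain x where x: "0 < x" "x < e" "(f e e - f e 0) - (f 0 e - f 0 0) = e * (fx x e - fx x 0)"
    by auto
  have "\<exists>z. 0 < z \<and> z < e \<and> fx x e - fx x 0 = (e - 0) * fxy x z"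
    by (rule MVT2) (use assms x in auto)
  then obtain y where "0 < y" "y < e" "fx x e - fx x 0 = e * fxy x y" by auto
  with x show ?thesis by (intro that[of x y]) auto
qed

text \<open>The second difference is symmetric in the two variables, so on each small square the two mixed
  derivatives take a common value; continuity does the rest.\<close>

lemma mixed_partials_eq:
  fixes f :: "real \<Rightarrow> real \<Rightarrow> real"
  assumes "0 < d"
    and fx: "\<And>x y. \<bar>x\<bar> < d \<Longrightarrow> \<bar>y\<bar> < d \<Longrightarrow> ((\<lambda>x. f x y) has_field_derivative fx x y) (at x)"
    and fy: "\<And>x y. \<bar>x\<bar> < d \<Longrightarrow> \<bar>y\<bar> < d \<Longrightarrow> ((\<lambda>y. f x y) has_field_derivative fy x y) (at y)"
    and fxy: "\<And>x y. \<bar>x\<bar> < d \<Longrightarrow> \<bar>y\<bar> < d \<Longrightarrow> ((\<lambda>y. fx x y) has_field_derivative fxy x y) (at y)"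
    and fyx: "\<And>x y. \<bar>x\<bar> < d \<Longrightarrow> \<bar>y\<bar> < d \<Longrightarrow> ((\<lambda>x. fy x y) has_field_derivative fyx x y) (at x)"
    and cont: "isCont (\<lambda>z. fxy (fst z) (snd z)) (0, 0)" "isCont (\<lambda>z. fyx (fst z) (snd z)) (0, 0)"
  shows "fxy 0 0 = fyx 0 0"
proof -
  have "\<exists>a b. dist a (0,0) < e \<and> dist b (0,0) < e \<and> fxy (fst a) (snd a) = fyx (fst b) (snd b)"
    if "e > 0" for e
  proof -
    (* a square with sides of length r stays within distance 2 r of the origin *)
    define r where "r = min (d/2) (e/2)"
    have r: "0 < r" "r < d" "2 * r \<le> e" using that \<open>0 < d\<close> by (auto simp: r_def)
    obtain x y where xy: "0 < x" "x < r" "0 < y" "y < r"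
        "f r r - f r 0 - f 0 r + f 0 0 = r * r * fxy x y"
      by (rule second_difference_mean_value[of r f fx fxy]) (use r fx fxy in auto)
    obtain y' x' where xy': "0 < y'" "y' < r" "0 < x'" "x' < r"
        "f r r - f 0 r - f r 0 + f 0 0 = r * r * fyx x' y'"
      by (rule second_difference_mean_value[of r "\<lambda>y x. f x y" "\<lambda>y x. fy x y" "\<lambda>y x. fyx x y"])
        (use r fy fyx in auto)
    have small: "dist (a, b) (0, 0::real) < e" if "0 < a" "a < r" "0 < b" "b < r" for a b :: real
      using sqrt_sum_squares_le_sum_abs[of a b] that r by (auto simp: dist_prod_def)
    have "r * r * fxy x y = r * r * fyx x' y'" using xy(5) xy'(5) by linarith
    then have "fxy x y = fyx x' y'" using r by simp
    then show ?thesis using small[OF xy(1-4)] small[OF xy'(3,4,1,2)]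
      by (intro exI[of _ "(x,y)"] exI[of _ "(x',y')"]) auto
  qed
  then have "\<forall>n. \<exists>a b. dist a (0,0) < inverse (real (Suc n)) \<and> dist b (0,0) < inverse (real (Suc n))
      \<and> fxy (fst a) (snd a) = fyx (fst b) (snd b)" by simp
  then obtain a b where ab: "\<And>n. dist (a n) (0,0) < inverse (real (Suc n))"
      "\<And>n. dist (b n) (0,0) < inverse (real (Suc n))"
      "\<And>n. fxy (fst (a n)) (snd (a n)) = fyx (fst (b n)) (snd (b n))"
    by metis
  have lim: "c \<longlonglongrightarrow> (0::real, 0::real)" if "\<And>n. dist (c n) (0,0) < inverse (real (Suc n))" for c
    by (rule iffD2[OF tendsto_dist_iff],
        rule tendsto_sandwich[OF _ _ tendsto_const LIMSEQ_inverse_real_of_nat])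
      (use that in \<open>auto intro!: always_eventually less_imp_le simp del: of_nat_Suc\<close>)
  have "(\<lambda>n. fxy (fst (a n)) (snd (a n))) \<longlonglongrightarrow> fxy 0 0"
    using isCont_tendsto_compose[OF cont(1) lim[OF ab(1)]] by simp
  moreover have "(\<lambda>n. fyx (fst (b n)) (snd (b n))) \<longlonglongrightarrow> fyx 0 0"
    using isCont_tendsto_compose[OF cont(2) lim[OF ab(2)]] by simp
  ultimately show ?thesis
    using LIMSEQ_unique ab(3) by (metis (no_types, lifting) ext)
qed

lemma pd_commute:
  assumes "open W" "smooth_jet W F" "p \<in> W"
  shows "pd c (pd e F) p = pd e (pd c F) p"
proof -
  let ?\<phi> = "\<lambda>x y. shift c x (shift e y p)"
  have cont: "continuous_on UNIV (\<lambda>z. ?\<phi> (fst z) (snd z))"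
    by (intro continuous_intros)
  have "open ((\<lambda>z. ?\<phi> (fst z) (snd z)) -` W)" (is "open ?V")
    using cont assms(1) by (simp add: continuous_on_open_vimage)
  moreover have "(0,0) \<in> ?V" using assms by simp
  ultimately obtain d where d: "0 < d" "ball (0,0) d \<subseteq> ?V"
    by (meson openE)
  have inW: "?\<phi> x y \<in> W" if "\<bar>x\<bar> < d/2" "\<bar>y\<bar> < d/2" for x y
  proof -
    have "(x, y) \<in> ball (0,0) d"
      using sqrt_sum_squares_le_sum_abs[of x y] that by (auto simp: dist_prod_def dist_real_def)
    then show ?thesis using d by auto
  qed
  have D1: "((\<lambda>x. G (?\<phi> x y)) has_field_derivative pd c G (?\<phi> x y)) (at x)"
    if "\<bar>x\<bar> < d/2" "\<bar>y\<bar> < d/2" "smooth_jet W G" for x y G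
  proof -
    have "((\<lambda>h. G (shift c h (?\<phi> x y))) has_field_derivative pd c G (?\<phi> x y)) (at 0)"
      using smooth_jet_DERIV[OF that(3) inW[OF that(1,2)]] .
    then show ?thesis
      unfolding shift_shift using DERIV_shift[of "\<lambda>x. G (?\<phi> x y)" _ 0 x] by simp
  qed
  have D2: "((\<lambda>y. G (?\<phi> x y)) has_field_derivative pd e G (?\<phi> x y)) (at y)"
    if "\<bar>x\<bar> < d/2" "\<bar>y\<bar> < d/2" "smooth_jet W G" for x y G
  proof -
    have "((\<lambda>h. G (shift e h (?\<phi> x y))) has_field_derivative pd e G (?\<phi> x y)) (at 0)"
      using smooth_jet_DERIV[OF that(3) inW[OF that(1,2)]] .
    then show ?thesis
      unfolding shift_commute[of e _ c] shift_shift
      using DERIV_shift[of "\<lambda>y. G (?\<phi> x y)" _ 0 y] by simp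
  qed
  have C: "isCont (\<lambda>z. G (?\<phi> (fst z) (snd z))) (0,0)" if "smooth_jet W G" for G
  proof -
    have "continuous_on ?V (\<lambda>z. G (?\<phi> (fst z) (snd z)))"
      by (rule continuous_on_compose2[OF smooth_jet_continuous[OF that] continuous_on_subset[OF cont]]) auto
    then show ?thesis
      using \<open>open ?V\<close> \<open>(0,0) \<in> ?V\<close> continuous_on_eq_continuous_at by blast
  qed
  have "pd e (pd c F) (?\<phi> 0 0) = pd c (pd e F) (?\<phi> 0 0)"
    by (rule mixed_partials_eq[of "d/2" "\<lambda>x y. F (?\<phi> x y)" "\<lambda>x y. pd c F (?\<phi> x y)"
          "\<lambda>x y. pd e F (?\<phi> x y)" "\<lambda>x y. pd e (pd c F) (?\<phi> x y)" "\<lambda>x y. pd c (pd e F) (?\<phi> x y)"])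
      (use d assms smooth_jet_pd in \<open>auto intro!: D1 D2 C\<close>)
  then show ?thesis by simp
qed

section \<open>Continuously differentiable functions of two variables\<close>

text \<open>Coefficients are smooth in the sense of partial derivatives, whereas Lie derivatives are taken with
  Frechet derivatives; this is the bridge.\<close>

lemma continuously_differentiable_vec2:
  fixes f :: "real^2 \<Rightarrow> real" and f' :: "2 \<Rightarrow> real^2 \<Rightarrow> real"
  assumes "open U" "v \<in> U"
    and D: "\<And>i w. w \<in> U \<Longrightarrow> ((\<lambda>h. f (w + h *\<^sub>R axis i 1)) has_field_derivative f' i w) (at 0)"
    and cont: "\<And>i. continuous_on U (f' i)"
  shows "(f has_derivative (\<lambda>w. \<Sum>i\<in>UNIV. w $ i * f' i v)) (at v)"
proof -
  define J :: "real \<Rightarrow> real \<Rightarrow> real^2" where "J x y = x *\<^sub>R axis 1 1 + y *\<^sub>R axis 2 1" for x y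
  have J_nth: "J x y $ 1 = x" "J x y $ 2 = y" for x y by (simp_all add: J_def axis_def)
  have J_eta: "J (w $ 1) (w $ 2) = w" for w
    by (simp add: vec_eq_iff forall_2 J_nth)
  have contJ: "continuous_on S (\<lambda>z. J (fst z) (snd z))" for S
    unfolding J_def by (intro continuous_intros)
  have "open ((\<lambda>z. J (fst z) (snd z)) -` U)" (is "open ?V")
    using contJ[of UNIV] assms(1) by (simp add: continuous_on_open_vimage)
  moreover have V: "(v $ 1, v $ 2) \<in> ?V" using assms by (simp add: J_eta)
  ultimately obtain X Y where "open X" "open Y" "(v $ 1, v $ 2) \<in> X \<times> Y" "X \<times> Y \<subseteq> ?V"
    by (rule open_prod_elim)
  then have XY: "open X" "open Y" "v $ 1 \<in> X" "v $ 2 \<in> Y" "X \<times> Y \<subseteq> ?V"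
    by simp_all
  then obtain e where e: "0 < e" "ball (v $ 2) e \<subseteq> Y" by (meson openE)
  define Z where "Z = ball (v $ 2) e"
  have Z: "open Z" "convex Z" "v $ 2 \<in> Z" "X \<times> Z \<subseteq> ?V"
    using e XY by (auto simp: Z_def)
  have D1: "((\<lambda>x. f (J x y)) has_field_derivative f' 1 (J x y)) (at x)" if "x \<in> X" "y \<in> Z" for x y
  proof -
    have "J x y \<in> U" using Z that by auto
    moreover have "J x y + h *\<^sub>R axis 1 1 = J (h + x) y" for h by (simp add: J_def algebra_simps)
    ultimately have "((\<lambda>h. f (J (h + x) y)) has_field_derivative f' 1 (J x y)) (at 0)"
      using D[of "J x y" 1] by simp
    then show ?thesis using DERIV_shift[of "\<lambda>x. f (J x y)" _ 0 x] by simp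
  qed
  have D2: "((\<lambda>y. f (J x y)) has_field_derivative f' 2 (J x y)) (at y)" if "x \<in> X" "y \<in> Z" for x y
  proof -
    have "J x y \<in> U" using Z that by auto
    moreover have "J x y + h *\<^sub>R axis 2 1 = J x (h + y)" for h by (simp add: J_def algebra_simps)
    ultimately have "((\<lambda>h. f (J x (h + y))) has_field_derivative f' 2 (J x y)) (at 0)"
      using D[of "J x y" 2] by simp
    then show ?thesis using DERIV_shift[of "\<lambda>y. f (J x y)" _ 0 y] by simp
  qed
  have "((\<lambda>(x, y). f (J x y)) has_derivative
      (\<lambda>(tx, ty). f' 1 v * tx + blinfun_apply (blinfun_mult_right (f' 2 (J (v $ 1) (v $ 2)))) ty))
      (at (v $ 1, v $ 2) within X \<times> Z)"
  proof (rule has_derivative_partialsI[where fy = "\<lambda>x y. blinfun_mult_right (f' 2 (J x y))"])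
    show "((\<lambda>x. f (J x (v $ 2))) has_derivative (\<lambda>tx. f' 1 v * tx)) (at (v $ 1) within X)"
      by (rule has_derivative_at_withinI)
        (use D1[OF XY(3) Z(3)] in \<open>simp add: has_field_derivative_def J_eta\<close>)
    show "((\<lambda>y. f (J x y)) has_derivative blinfun_apply (blinfun_mult_right (f' 2 (J x y)))) (at y within Z)"
      if "x \<in> X" "y \<in> Z" for x y
      by (rule has_derivative_at_withinI) (use D2[OF that] in \<open>simp add: has_field_derivative_def\<close>)
    have "continuous_on ?V (\<lambda>z. f' 2 (J (fst z) (snd z)))"
      by (rule continuous_on_compose2[OF cont contJ]) auto
    then have "continuous_on (X \<times> Z) (\<lambda>z. f' 2 (J (fst z) (snd z)))"
      using Z(4) continuous_on_subset by blast
    then have "continuous_on (X \<times> Z) (\<lambda>z. blinfun_mult_right (f' 2 (J (fst z) (snd z))))"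
      by (intro bounded_linear.continuous_on[OF bounded_linear_blinfun_mult_right])
    then show "continuous (at (v $ 1, v $ 2) within X \<times> Z) (\<lambda>(x, y). blinfun_mult_right (f' 2 (J x y)))"
      using XY Z by (auto simp: continuous_on_eq_continuous_within split_beta')
  qed (use Z in auto)
  moreover have "open (X \<times> Z)" "(v $ 1, v $ 2) \<in> X \<times> Z" using XY Z by (auto intro: open_Times)
  ultimately have X: "((\<lambda>(x, y). f (J x y)) has_derivative
      (\<lambda>(tx, ty). tx * f' 1 v + ty * f' 2 v)) (at (v $ 1, v $ 2))"
    using at_within_open[of "(v $ 1, v $ 2)" "X \<times> Z"] by (simp add: J_eta mult.commute)
  have Y: "((\<lambda>w. (w $ 1, w $ 2)) has_derivative (\<lambda>w. (w $ 1, w $ 2))) (at v)"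
    by (intro has_derivative_Pair bounded_linear.has_derivative[OF bounded_linear_vec_nth has_derivative_ident])
  have "((\<lambda>w. f (J (w $ 1) (w $ 2))) has_derivative (\<lambda>w. w $ 1 * f' 1 v + w $ 2 * f' 2 v)) (at v)"
    using has_derivative_compose[OF Y X] by simp
  then show ?thesis by (simp add: J_eta sum_2)
qed

section \<open>Finite order and the total derivative\<close>

text \<open>The class of functions on which all operators act: for these the series in the total derivative and
  in the Euler--Lagrange expression are finite sums.\<close>

definition finite_order_smooth :: "jet set \<Rightarrow> (jet \<Rightarrow> real) \<Rightarrow> bool" where
  "finite_order_smooth W F \<longleftrightarrow> smooth_jet W F \<and> (\<exists>r. order_le r W F)"

lemma order_leD:
  "order_le r W F \<Longrightarrow> (t, u) \<in> W \<Longrightarrow> (t, w) \<in> W \<Longrightarrow> (\<And>s. s \<le> r \<Longrightarrow> u s = w s) \<Longrightarrow>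
    F (t, u) = F (t, w)"
  unfolding order_le_def by metis

lemma order_le_mono: "order_le r W F \<Longrightarrow> r \<le> r' \<Longrightarrow> order_le r' W F"
  unfolding order_le_def by (meson le_trans)

lemma order_le_cong: "(\<And>q. q \<in> W \<Longrightarrow> F q = G q) \<Longrightarrow> order_le r W F \<Longrightarrow> order_le r W G"
  unfolding order_le_def by metis

lemma pd_above_order:
  assumes "open W" "order_le r W F" "r < s" "p \<in> W"
  shows "pd (Deriv s i) F p = 0"
proof (rule pd_eqI)
  obtain t u where p: "p = (t, u)" by (cases p)
  have "\<forall>\<^sub>F h in nhds 0. F (shift (Deriv s i) h p) = F p"
    using eventually_shift_in[OF assms(1,4), of "Deriv s i"]
  proof eventually_elim
    case (elim h)
    have "F (t, u(s := u s + h *\<^sub>R axis i 1)) = F (t, u)"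
      by (rule order_leD[OF assms(2)]) (use assms(3,4) elim p in auto)
    then show ?case by (simp add: p)
  qed
  from DERIV_cong_ev[OF refl this refl]
  show "((\<lambda>h. F (shift (Deriv s i) h p)) has_field_derivative 0) (at 0)" by simp
qed

lemma order_le_pd:
  assumes "open W" "order_le r W F"
  shows "order_le r W (pd c F)"
  unfolding order_le_def
proof (intro allI impI)
  fix t u w assume *: "(t, u) \<in> W" "(t, w) \<in> W" "\<forall>s\<le>r. u s = w s"
  have "\<forall>\<^sub>F h in nhds 0. F (shift c h (t, u)) = F (shift c h (t, w))"
    using eventually_shift_in[OF assms(1) *(1), of c] eventually_shift_in[OF assms(1) *(2), of c]
  proof eventually_elim
    case (elim h)
    have eq: "shift c h (t, w) = (fst (shift c h (t, u)), snd (shift c h (t, w)))"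
      by (cases c) auto
    have "F (fst (shift c h (t, u)), snd (shift c h (t, u))) =
        F (fst (shift c h (t, u)), snd (shift c h (t, w)))"
    proof (rule order_leD[OF assms(2)])
      show "snd (shift c h (t, u)) s = snd (shift c h (t, w)) s" if "s \<le> r" for s
        using *(3) that by (cases c) auto
    qed (use elim eq in auto)
    then show ?case using eq by simp
  qed
  then show "pd c F (t, u) = pd c F (t, w)"
    unfolding pd_def by (intro deriv_cong_ev) auto
qed

lemma total_deriv_finite:
  assumes "open W" "order_le r W F" "p \<in> W"
  shows "total_deriv F p = pd Time F p + (\<Sum>s\<le>r. \<Sum>i\<in>UNIV. snd p (Suc s) $ i * pd (Deriv s i) F p)"
  unfolding total_deriv_def
  by (subst suminf_finite[of "{..r}"]) (auto simp: pd_above_order[OF assms(1,2) _ assms(3)] not_le)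

lemma order_le_total_deriv:
  assumes "open W" "order_le r W F"
  shows "order_le (Suc r) W (total_deriv F)"
proof -
  have "order_le (Suc r) W (\<lambda>p. pd Time F p + (\<Sum>s\<le>r. \<Sum>i\<in>UNIV. snd p (Suc s) $ i * pd (Deriv s i) F p))"
    unfolding order_le_def
  proof (intro allI impI)
    fix t u w assume *: "(t, u) \<in> W" "(t, w) \<in> W" "\<forall>s\<le>Suc r. u s = w s"
    have "pd c F (t, u) = pd c F (t, w)" for c
      by (rule order_leD[OF order_le_pd[OF assms] *(1,2)]) (use *(3) in auto)
    then show "pd Time F (t, u) + (\<Sum>s\<le>r. \<Sum>i\<in>UNIV. snd (t, u) (Suc s) $ i * pd (Deriv s i) F (t, u))
      = pd Time F (t, w) + (\<Sum>s\<le>r. \<Sum>i\<in>UNIV. snd (t, w) (Suc s) $ i * pd (Deriv s i) F (t, w))"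
      using *(3) by auto
  qed
  then show ?thesis
    by (rule order_le_cong[rotated]) (simp add: total_deriv_finite[OF assms])
qed

lemma finite_order_smooth_cong:
  "open W \<Longrightarrow> (\<And>q. q \<in> W \<Longrightarrow> F q = G q) \<Longrightarrow> finite_order_smooth W F \<Longrightarrow> finite_order_smooth W G"
  unfolding finite_order_smooth_def
  using order_le_cong[of W F G] smooth_jet_cong[of W F G] by blast

lemma finite_order_smooth_pd:
  "open W \<Longrightarrow> finite_order_smooth W F \<Longrightarrow> finite_order_smooth W (pd c F)"
  unfolding finite_order_smooth_def by (meson order_le_pd smooth_jet_pd)

lemma finite_order_smooth_total_deriv:
  assumes "open W" "finite_order_smooth W F"
  shows "finite_order_smooth W (total_deriv F)"
proof -
  obtain r where r: "smooth_jet W F" "order_le r W F"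
    using assms by (auto simp: finite_order_smooth_def)
  have "smooth_jet W (\<lambda>p. pd Time F p + (\<Sum>s\<le>r. \<Sum>i\<in>UNIV. snd p (Suc s) $ i * pd (Deriv s i) F p))"
    by (intro smooth_jet_intros smooth_jet_pd assms r)
  then have "smooth_jet W (total_deriv F)"
    by (rule smooth_jet_cong[OF assms(1), rotated]) (simp add: total_deriv_finite[OF assms(1) r(2)])
  then show ?thesis
    unfolding finite_order_smooth_def using order_le_total_deriv[OF assms(1) r(2)] by blast
qed

lemma order_le_combine2:
  "order_le r W F \<Longrightarrow> order_le r' W G \<Longrightarrow> order_le (max r r') W (\<lambda>p. f (F p) (G p))"
  unfolding order_le_def[of "max r r'"]
  by (intro allI impI arg_cong2[where f = f] order_leD[of r W F] order_leD[of r' W G]) auto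

lemma finite_order_smooth_const: "finite_order_smooth W (\<lambda>_. a)"
  by (auto simp: finite_order_smooth_def smooth_jet_const order_le_def)

lemma finite_order_smooth_add:
  "open W \<Longrightarrow> finite_order_smooth W F \<Longrightarrow> finite_order_smooth W G \<Longrightarrow>
    finite_order_smooth W (\<lambda>p. F p + G p)"
  unfolding finite_order_smooth_def
  by (metis smooth_jet_add order_le_combine2[where f = "(+)"])

lemma finite_order_smooth_mult:
  "open W \<Longrightarrow> finite_order_smooth W F \<Longrightarrow> finite_order_smooth W G \<Longrightarrow>
    finite_order_smooth W (\<lambda>p. F p * G p)"
  unfolding finite_order_smooth_def
  by (metis smooth_jet_mult order_le_combine2[where f = "(*)"])

lemma finite_order_smooth_DERIV:
  "finite_order_smooth W F \<Longrightarrow> p \<in> W \<Longrightarrow>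
    ((\<lambda>h. F (shift c h p)) has_field_derivative pd c F p) (at 0)"
  unfolding finite_order_smooth_def using smooth_jet_DERIV by blast

lemma pd_add:
  assumes "finite_order_smooth W F" "finite_order_smooth W G" "p \<in> W"
  shows "pd c (\<lambda>p. F p + G p) p = pd c F p + pd c G p"
  by (rule pd_eqI) (intro derivative_intros finite_order_smooth_DERIV[OF assms(1,3)]
      finite_order_smooth_DERIV[OF assms(2,3)])

lemma pd_mult:
  assumes "finite_order_smooth W F" "finite_order_smooth W G" "p \<in> W"
  shows "pd c (\<lambda>p. F p * G p) p = pd c F p * G p + F p * pd c G p"
  using DERIV_mult[OF finite_order_smooth_DERIV[OF assms(1,3)] finite_order_smooth_DERIV[OF assms(2,3)]]
  by (intro pd_eqI) (simp add: mult.commute)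

lemma common_order:
  assumes "finite_order_smooth W F" "finite_order_smooth W G"
  obtains r where "order_le r W F" "order_le r W G" "k \<le> r"
proof -
  obtain a b where "order_le a W F" "order_le b W G"
    using assms by (auto simp: finite_order_smooth_def)
  then have "order_le (max (max a b) k) W F" "order_le (max (max a b) k) W G"
    by (meson max.cobounded1 max.cobounded2 order_le_mono le_trans)+
  then show ?thesis by (intro that[of "max (max a b) k"]) auto
qed

lemma total_deriv_add:
  assumes "open W" "finite_order_smooth W F" "finite_order_smooth W G" "p \<in> W"
  shows "total_deriv (\<lambda>p. F p + G p) p = total_deriv F p + total_deriv G p"
proof -
  obtain r where r: "order_le r W F" "order_le r W G" by (rule common_order[OF assms(2,3), where k = 0])
  have "order_le r W (\<lambda>p. F p + G p)"
    using order_le_combine2[OF r, where f = "(+)"] by simp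
  then show ?thesis
    using r assms
    by (simp add: total_deriv_finite pd_add distrib_left sum.distrib)
qed

lemma total_deriv_mult:
  assumes "open W" "finite_order_smooth W F" "finite_order_smooth W G" "p \<in> W"
  shows "total_deriv (\<lambda>p. F p * G p) p = total_deriv F p * G p + F p * total_deriv G p"
proof -
  obtain r where r: "order_le r W F" "order_le r W G" by (rule common_order[OF assms(2,3), where k = 0])
  have "order_le r W (\<lambda>p. F p * G p)"
    using order_le_combine2[OF r, where f = "(*)"] by simp
  then have "total_deriv (\<lambda>p. F p * G p) p = pd Time F p * G p + F p * pd Time G p +
      (\<Sum>s\<le>r. \<Sum>i\<in>UNIV. snd p (Suc s) $ i * (pd (Deriv s i) F p * G p + F p * pd (Deriv s i) G p))"
    using assms by (simp add: total_deriv_finite pd_mult)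
  also have "(\<Sum>s\<le>r. \<Sum>i\<in>UNIV. snd p (Suc s) $ i * (pd (Deriv s i) F p * G p + F p * pd (Deriv s i) G p))
    = (\<Sum>s\<le>r. \<Sum>i\<in>UNIV. snd p (Suc s) $ i * pd (Deriv s i) F p) * G p +
      F p * (\<Sum>s\<le>r. \<Sum>i\<in>UNIV. snd p (Suc s) $ i * pd (Deriv s i) G p)"
    by (simp add: sum_distrib_left sum_distrib_right sum.distrib[symmetric] algebra_simps)
  finally show ?thesis
    using r assms by (simp add: total_deriv_finite algebra_simps)
qed

lemma total_deriv_const: "total_deriv (\<lambda>_. a) p = 0"
  by (simp add: total_deriv_def pd_def)

lemma total_deriv_cong:
  assumes "open W" "\<And>q. q \<in> W \<Longrightarrow> F q = G q" "p \<in> W"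
  shows "total_deriv F p = total_deriv G p"
  unfolding total_deriv_def by (simp add: pd_cong[OF assms])

lemma funpow_total_deriv_cong:
  assumes "open W" "\<And>q. q \<in> W \<Longrightarrow> F q = G q" "p \<in> W"
  shows "(total_deriv ^^ n) F p = (total_deriv ^^ n) G p"
  using assms(3)
  by (induction n arbitrary: p) (auto simp: assms(2) intro!: total_deriv_cong[OF assms(1)])

text \<open>Partial derivatives commute with each other, so the second summand can only come from the
  coefficients \<open>u\<^sub>s\<^sub>+\<^sub>1\<close> of the total derivative.\<close>

lemma pd_total_deriv:
  assumes "open W" "finite_order_smooth W F" "p \<in> W"
  shows "pd (Deriv k j) (total_deriv F) p =
    total_deriv (pd (Deriv k j) F) p + (case k of 0 \<Rightarrow> 0 | Suc m \<Rightarrow> pd (Deriv m j) F p)"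
proof -
  obtain r where r: "order_le r W F" "k \<le> r" by (rule common_order[OF assms(2,2)])
  have smooth: "smooth_jet W F" using assms by (simp add: finite_order_smooth_def)
  let ?c = "Deriv k j"
  let ?S = "\<lambda>p. pd Time F p + (\<Sum>s\<le>r. \<Sum>i\<in>UNIV. snd p (Suc s) $ i * pd (Deriv s i) F p)"
  have D: "((\<lambda>h. pd c F (shift ?c h p)) has_field_derivative pd ?c (pd c F) p) (at 0)" for c
    by (rule finite_order_smooth_DERIV[OF finite_order_smooth_pd[OF assms(1,2)] assms(3)])
  have C: "((\<lambda>h. snd (shift ?c h p) (Suc s) $ i) has_field_derivative
      (if k = Suc s \<and> j = i then 1 else 0)) (at 0)" for s i
    unfolding snd_shift by (auto intro!: derivative_eq_intros)
  have "pd ?c (total_deriv F) p = pd ?c ?S p"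
    by (rule pd_cong[OF assms(1) _ assms(3)]) (simp add: total_deriv_finite[OF assms(1) r(1)])
  also have "\<dots> = pd ?c (pd Time F) p +
      (\<Sum>s\<le>r. \<Sum>i\<in>UNIV. (if k = Suc s \<and> j = i then 1 else 0) * pd (Deriv s i) F p
         + pd ?c (pd (Deriv s i) F) p * snd p (Suc s) $ i)"
    using DERIV_mult[OF C D] by (intro pd_eqI DERIV_add DERIV_sum D) simp
  also have "\<dots> = pd Time (pd ?c F) p +
      (\<Sum>s\<le>r. \<Sum>i\<in>UNIV. snd p (Suc s) $ i * pd (Deriv s i) (pd ?c F) p) +
      (\<Sum>s\<le>r. \<Sum>i\<in>UNIV. (if k = Suc s \<and> j = i then 1 else 0) * pd (Deriv s i) F p)"
    using pd_commute[OF assms(1) smooth assms(3)]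
    by (simp add: sum.distrib algebra_simps)
  also have "(\<Sum>s\<le>r. \<Sum>i\<in>UNIV. (if k = Suc s \<and> j = i then 1 else 0) * pd (Deriv s i) F p)
      = (\<Sum>s\<le>r. if k = Suc s then pd (Deriv s j) F p else 0)"
  proof (rule sum.cong[OF refl])
    fix s show "(\<Sum>i\<in>UNIV. (if k = Suc s \<and> j = i then 1 else 0) * pd (Deriv s i) F p) =
        (if k = Suc s then pd (Deriv s j) F p else 0)"
      using sum.delta'[of "UNIV :: 2 set" j "\<lambda>i. pd (Deriv s i) F p"]
      by (auto simp: if_distrib[of "\<lambda>x. x * _"] cong: if_cong)
  qed
  also have "\<dots> = (case k of 0 \<Rightarrow> 0 | Suc m \<Rightarrow> pd (Deriv m j) F p)"
    using r(2) by (cases k) (auto simp: sum.delta' if_distrib cong: if_cong)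
  finally show ?thesis
    by (simp add: total_deriv_finite[OF assms(1) order_le_pd[OF assms(1) r(1)] assms(3)])
qed

section \<open>Higher Euler operators and the Helmholtz conditions\<close>

text \<open>Abstractly, \<open>D\<close> is the total derivative and \<open>P k i\<close> the derivative with respect to the \<open>i\<close>-th component
  of \<open>u\<^sub>k\<close>.  The Helmholtz conditions follow from the commutation relations alone.  The carrier \<open>S\<close> is
  explicit because the operators are additive on smooth functions only.\<close>

locale euler_calculus =
  fixes S :: "'a::real_vector set" and D :: "'a \<Rightarrow> 'a" and P :: "nat \<Rightarrow> 'i \<Rightarrow> 'a \<Rightarrow> 'a"
  assumes subspace: "subspace S"
    and D_closed: "F \<in> S \<Longrightarrow> D F \<in> S"
    and P_closed: "F \<in> S \<Longrightarrow> P k i F \<in> S"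
    and D_add: "F \<in> S \<Longrightarrow> G \<in> S \<Longrightarrow> D (F + G) = D F + D G"
    and D_scale: "F \<in> S \<Longrightarrow> D (a *\<^sub>R F) = a *\<^sub>R D F"
    and P_add: "F \<in> S \<Longrightarrow> G \<in> S \<Longrightarrow> P k i (F + G) = P k i F + P k i G"
    and P_scale: "F \<in> S \<Longrightarrow> P k i (a *\<^sub>R F) = a *\<^sub>R P k i F"
    and P_commute: "F \<in> S \<Longrightarrow> P k i (P l j F) = P l j (P k i F)"
    and P_0_D: "F \<in> S \<Longrightarrow> P 0 i (D F) = D (P 0 i F)"
    and P_Suc_D: "F \<in> S \<Longrightarrow> P (Suc k) i (D F) = D (P (Suc k) i F) + P k i F"
begin

lemma zero_S: "0 \<in> S" using subspace by (simp add: subspace_def)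
lemma add_S: "F \<in> S \<Longrightarrow> G \<in> S \<Longrightarrow> F + G \<in> S" using subspace by (simp add: subspace_def)
lemma scale_S: "F \<in> S \<Longrightarrow> a *\<^sub>R F \<in> S" using subspace by (simp add: subspace_def)
lemma sum_S: "(\<And>k. k \<in> K \<Longrightarrow> F k \<in> S) \<Longrightarrow> sum F K \<in> S" using subspace by (rule subspace_sum)

lemma D_0: "D 0 = 0" using D_scale[OF zero_S, of 0] by simp
lemma P_0: "P k i 0 = 0" using P_scale[OF zero_S, of k i 0] by simp

lemma P_sum: "(\<And>k. k \<in> K \<Longrightarrow> F k \<in> S) \<Longrightarrow> P l i (sum F K) = (\<Sum>k\<in>K. P l i (F k))"
  by (induction K rule: infinite_finite_induct) (auto simp: P_0 P_add sum_S)

lemma Dn_closed: "F \<in> S \<Longrightarrow> (D ^^ n) F \<in> S"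
  by (induction n) (auto simp: D_closed)

lemma Dn_0: "(D ^^ n) 0 = 0"
  by (induction n) (auto simp: D_0)

lemma Dn_add: "F \<in> S \<Longrightarrow> G \<in> S \<Longrightarrow> (D ^^ n) (F + G) = (D ^^ n) F + (D ^^ n) G"
  by (induction n) (auto simp: D_add Dn_closed)

lemma Dn_scale: "F \<in> S \<Longrightarrow> (D ^^ n) (a *\<^sub>R F) = a *\<^sub>R (D ^^ n) F"
  by (induction n) (auto simp: D_scale Dn_closed)

text \<open>For \<open>k = 0\<close> this is the Euler--Lagrange expression, and in general the coefficient of \<open>\<lambda>\<^sup>k\<close> in
  \<open>\<Sum>\<^sub>s (\<lambda> - D)\<^sup>s P\<^sub>s F\<close>.  The sum is cut off at \<open>N\<close>; the terms beyond the order of \<open>F\<close> vanish.\<close>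

definition higher_euler :: "nat \<Rightarrow> nat \<Rightarrow> 'i \<Rightarrow> 'a \<Rightarrow> 'a" where
  "higher_euler N k i F = (\<Sum>m\<le>N. ((-1) ^ m * real ((k + m) choose k)) *\<^sub>R (D ^^ m) (P (k + m) i F))"

lemma higher_euler_add:
  "F \<in> S \<Longrightarrow> G \<in> S \<Longrightarrow> higher_euler N k i (F + G) = higher_euler N k i F + higher_euler N k i G"
  by (simp add: higher_euler_def P_add Dn_add P_closed scaleR_add_right sum.distrib)

lemma higher_euler_scale:
  "F \<in> S \<Longrightarrow> higher_euler N k i (a *\<^sub>R F) = a *\<^sub>R higher_euler N k i F"
  by (simp add: higher_euler_def P_scale Dn_scale P_closed scaleR_sum_right mult.commute)

lemma higher_euler_0: "higher_euler N k i 0 = 0"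
  by (simp add: higher_euler_def P_0 Dn_0)

lemma higher_euler_sum:
  "(\<And>l. l \<in> K \<Longrightarrow> F l \<in> S) \<Longrightarrow> higher_euler N k i (sum F K) = (\<Sum>l\<in>K. higher_euler N k i (F l))"
  by (induction K rule: infinite_finite_induct) (auto simp: higher_euler_0 higher_euler_add sum_S)

definition depends_below :: "nat \<Rightarrow> 'a \<Rightarrow> bool" where
  "depends_below M F \<longleftrightarrow> F \<in> S \<and> (\<forall>k\<ge>M. \<forall>i. P k i F = 0)"

lemma depends_below_mono: "depends_below M F \<Longrightarrow> M \<le> N \<Longrightarrow> depends_below N F"
  by (auto simp: depends_below_def)

lemma depends_below_P: "depends_below M F \<Longrightarrow> depends_below M (P k i F)"
  unfolding depends_below_def by (metis P_closed P_commute P_0)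

lemma depends_below_D:
  assumes "depends_below M F" shows "depends_below (Suc M) (D F)"
  unfolding depends_below_def
proof (intro conjI allI impI)
  show "D F \<in> S" using assms by (simp add: depends_below_def D_closed)
  fix k i assume "Suc M \<le> k"
  then obtain l where "k = Suc l" "M \<le> l" by (cases k) auto
  then show "P k i (D F) = 0" using assms by (simp add: depends_below_def P_Suc_D D_0)
qed

lemma depends_below_Dn: "depends_below M F \<Longrightarrow> depends_below (n + M) ((D ^^ n) F)"
  by (induction n) (auto simp: depends_below_D)

text \<open>The pairs \<open>x (m + 1) + x m\<close> come from the commutator of \<open>P\<close> and \<open>D\<close>, and the recursion for \<open>c\<close> will be
  Pascal's rule.\<close>

lemma alternating_summation:
  fixes x :: "nat \<Rightarrow> 'b::real_vector"
  assumes "c 0 = d 0" "\<And>m. c (Suc m) = c m + d (Suc m)"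
  shows "(\<Sum>m\<le>N. ((-1) ^ m * c m) *\<^sub>R (x (Suc m) + x m)) =
    (\<Sum>m\<le>N. ((-1) ^ m * d m) *\<^sub>R x m) + ((-1) ^ N * c N) *\<^sub>R x (Suc N)"
  by (induction N) (auto simp: assms algebra_simps)

text \<open>With the generating function \<open>\<Sum>\<^sub>s (\<lambda> - D)\<^sup>s P\<^sub>s\<close>, composing with \<open>D\<close> amounts to multiplying by \<open>\<lambda>\<close>.\<close>

lemma higher_euler_Suc_D:
  assumes "depends_below N F"
  shows "higher_euler N (Suc k) i (D F) = higher_euler N k i F"
proof -
  have F: "F \<in> S" using assms by (simp add: depends_below_def)
  let ?x = "\<lambda>m. (D ^^ m) (P (k + m) i F)"
  let ?c = "\<lambda>m. real ((Suc k + m) choose (Suc k))" and ?d = "\<lambda>m. real ((k + m) choose k)"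
  have "(D ^^ m) (P (Suc k + m) i (D F)) = ?x (Suc m) + ?x m" for m
    using F by (simp add: P_Suc_D Dn_add P_closed D_closed funpow_swap1)
  then have "higher_euler N (Suc k) i (D F) = (\<Sum>m\<le>N. ((-1) ^ m * ?c m) *\<^sub>R (?x (Suc m) + ?x m))"
    unfolding higher_euler_def by presburger
  also have "\<dots> = (\<Sum>m\<le>N. ((-1) ^ m * ?d m) *\<^sub>R ?x m) + ((-1) ^ N * ?c N) *\<^sub>R ?x (Suc N)"
    by (rule alternating_summation) auto
  also have "?x (Suc N) = 0"
    using assms by (simp add: depends_below_def Dn_0 D_0 del: funpow.simps)
  finally show ?thesis by (simp add: higher_euler_def)
qed

text \<open>Total derivatives are null Lagrangians.\<close>

lemma higher_euler_0_D:
  assumes "depends_below N F"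
  shows "higher_euler N 0 i (D F) = 0"
proof -
  have F: "F \<in> S" using assms by (simp add: depends_below_def)
  let ?x = "\<lambda>m. case m of 0 \<Rightarrow> 0 | Suc n \<Rightarrow> (D ^^ Suc n) (P n i F)"
  have "(D ^^ m) (P m i (D F)) = ?x (Suc m) + ?x m" for m
  proof (cases m)
    case (Suc n)
    show ?thesis
      unfolding Suc P_Suc_D[OF F] Dn_add[OF D_closed[OF P_closed[OF F]] P_closed[OF F]]
      by (simp add: funpow_swap1)
  qed (simp add: P_0_D F)
  then have "higher_euler N 0 i (D F) = (\<Sum>m\<le>N. ((-1) ^ m * 1) *\<^sub>R (?x (Suc m) + ?x m))"
    by (simp add: higher_euler_def)
  also have "\<dots> = (\<Sum>m\<le>N. ((-1) ^ m * (if m = 0 then 1 else 0)) *\<^sub>R ?x m) + ((-1) ^ N * 1) *\<^sub>R ?x (Suc N)"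
    by (rule alternating_summation) auto
  also have "?x (Suc N) = 0"
    using assms by (simp add: depends_below_def Dn_0 D_0 del: funpow.simps)
  also have "(\<Sum>m\<le>N. ((-1) ^ m * (if m = 0 then 1 else 0)) *\<^sub>R ?x m) = 0"
    by (rule sum.neutral) auto
  finally show ?thesis by simp
qed

lemma higher_euler_Dn:
  assumes "depends_below M F" "n + M \<le> N"
  shows "higher_euler N k i ((D ^^ n) F) = (if n \<le> k then higher_euler N (k - n) i F else 0)"
  using assms(2)
proof (induction n arbitrary: k)
  case (Suc n)
  have "depends_below N ((D ^^ n) F)"
    by (rule depends_below_mono[OF depends_below_Dn[OF assms(1)]]) (use Suc.prems in auto)
  then show ?case
    using Suc by (cases k) (auto simp: higher_euler_Suc_D higher_euler_0_D)
qed simp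

text \<open>These three cases suffice for the Helmholtz condition on second derivatives.\<close>

lemma P_Dn:
  assumes "F \<in> S"
  shows "P 0 j ((D ^^ s) F) = (D ^^ s) (P 0 j F)"
    and "P 1 j ((D ^^ s) F) = (D ^^ s) (P 1 j F) + real s *\<^sub>R (D ^^ (s - 1)) (P 0 j F)"
    and "P 2 j ((D ^^ s) F) = (D ^^ s) (P 2 j F) + real s *\<^sub>R (D ^^ (s - 1)) (P 1 j F)
      + real (s choose 2) *\<^sub>R (D ^^ (s - 2)) (P 0 j F)"
proof -
  show P0: "P 0 j ((D ^^ s) F) = (D ^^ s) (P 0 j F)" for s
    by (induction s) (auto simp: P_0_D Dn_closed assms)
  show P1: "P 1 j ((D ^^ s) F) = (D ^^ s) (P 1 j F) + real s *\<^sub>R (D ^^ (s - 1)) (P 0 j F)" for s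
  proof (induction s)
    case (Suc s)
    have "D (real s *\<^sub>R (D ^^ (s - 1)) (P 0 j F)) = real s *\<^sub>R (D ^^ s) (P 0 j F)"
      by (cases s) (auto simp: D_0 D_scale Dn_closed P_closed assms)
    then show ?case
      using P_Suc_D[OF Dn_closed[OF assms, of s], of 0 j] P0[of s] Suc
      by (simp add: D_add Dn_closed P_closed assms scale_S algebra_simps)
  qed simp
  show "P 2 j ((D ^^ s) F) = (D ^^ s) (P 2 j F) + real s *\<^sub>R (D ^^ (s - 1)) (P 1 j F)
      + real (s choose 2) *\<^sub>R (D ^^ (s - 2)) (P 0 j F)"
  proof (induction s)
    case (Suc s)
    have 1: "D (real s *\<^sub>R (D ^^ (s - 1)) (P 1 j F)) = real s *\<^sub>R (D ^^ s) (P 1 j F)"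
      by (cases s) (auto simp: D_0 D_scale Dn_closed P_closed assms)
    have 2: "D (real (s choose 2) *\<^sub>R (D ^^ (s - 2)) (P 0 j F)) =
        real (s choose 2) *\<^sub>R (D ^^ (s - 1)) (P 0 j F)"
    proof (cases "s \<ge> 2")
      case True
      then have "s - 1 = Suc (s - 2)" by simp
      then show ?thesis by (simp add: D_scale Dn_closed P_closed assms)
    next
      case False
      then show ?thesis by (simp add: binomial_eq_0 D_0)
    qed
    have 3: "real (Suc s choose 2) = real s + real (s choose 2)"
      by (simp add: numeral_2_eq_2)
    show ?case
      using P_Suc_D[OF Dn_closed[OF assms, of s], of 1 j] P1[of s] Suc
      by (simp add: D_add Dn_closed P_closed assms scale_S add_S 1[unfolded One_nat_def] 2[unfolded One_nat_def] 3 numeral_2_eq_2[symmetric] algebra_simps)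
  qed (simp add: binomial_eq_0)
qed

text \<open>Both sides equal \<open>H\<^sub>2 (P\<^sub>0 L) - H\<^sub>1 (P\<^sub>1 L) + H\<^sub>0 (P\<^sub>2 L)\<close>, where \<open>H\<^sub>k\<close> is the \<open>k\<close>-th Euler operator in the
  \<open>i\<close>-th and \<open>P\<^sub>k\<close> the partial derivative in the \<open>j\<close>-th variable: on the right because \<open>D\<close> shifts the
  index of \<open>H\<close>, on the left by moving \<open>P\<^sub>2\<close> past the powers of \<open>D\<close>.\<close>

lemma helmholtz_second:
  assumes L: "depends_below M L" and N: "2 * M + 2 \<le> N"
  defines "E \<equiv> \<lambda>i. higher_euler N 0 i L"
  shows "P 2 j (E i) = higher_euler N 2 i (E j)"
proof -
  have LS: "L \<in> S" using L by (simp add: depends_below_def)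
  have E: "E i = (\<Sum>n\<le>N. ((-1) ^ n) *\<^sub>R (D ^^ n) (P n i L))" for i
    by (simp add: E_def higher_euler_def)
  have PS: "P k i L \<in> S" for k i by (simp add: P_closed LS)
  define H where "H = higher_euler N 2 i (P 0 j L) - higher_euler N 1 i (P 1 j L) + higher_euler N 0 i (P 2 j L)"
  have "higher_euler N 2 i (E j) = (\<Sum>n\<le>N. ((-1) ^ n) *\<^sub>R higher_euler N 2 i ((D ^^ n) (P n j L)))"
    unfolding E by (simp add: higher_euler_sum higher_euler_scale PS Dn_closed scale_S)
  also have "\<dots> = (\<Sum>n\<le>N. if n \<le> 2 then ((-1) ^ n) *\<^sub>R higher_euler N (2 - n) i (P n j L) else 0)"
  proof (rule sum.cong[OF refl])
    fix n
    show "((-1) ^ n) *\<^sub>R higher_euler N 2 i ((D ^^ n) (P n j L)) =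
      (if n \<le> 2 then ((-1) ^ n) *\<^sub>R higher_euler N (2 - n) i (P n j L) else 0)"
    proof (cases "n < M")
      case True
      then have "n + M \<le> N" using N by simp
      from higher_euler_Dn[OF depends_below_P[OF L] this] show ?thesis by simp
    next
      case False
      then have "P n j L = 0" using L by (simp add: depends_below_def)
      then show ?thesis by (simp add: Dn_0 higher_euler_0)
    qed
  qed
  also have "\<dots> = (\<Sum>n\<in>{0,1,2}. if n \<le> 2 then ((-1) ^ n) *\<^sub>R higher_euler N (2 - n) i (P n j L) else 0)"
    by (rule sum.mono_neutral_right) (use N in auto)
  also have "\<dots> = H" by (simp add: H_def)
  finally have rhs: "higher_euler N 2 i (E j) = H" .
  have "P 2 j (E i) = (\<Sum>n\<le>N. ((-1) ^ n) *\<^sub>R P 2 j ((D ^^ n) (P n i L)))"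
    unfolding E by (simp add: P_sum P_scale PS Dn_closed scale_S)
  also have "\<dots> = (\<Sum>n\<le>N. ((-1) ^ n) *\<^sub>R (D ^^ n) (P n i (P 2 j L)))
      + (\<Sum>n\<le>N. ((-1) ^ n * real n) *\<^sub>R (D ^^ (n - 1)) (P n i (P 1 j L)))
      + (\<Sum>n\<le>N. ((-1) ^ n * real (n choose 2)) *\<^sub>R (D ^^ (n - 2)) (P n i (P 0 j L)))"
    by (simp add: P_Dn(3)[OF PS] P_commute[OF LS, of _ j] scaleR_add_right sum.distrib)
  also have "(\<Sum>n\<le>N. ((-1) ^ n) *\<^sub>R (D ^^ n) (P n i (P 2 j L))) = higher_euler N 0 i (P 2 j L)"
    by (simp add: higher_euler_def)
  also have "(\<Sum>n\<le>N. ((-1) ^ n * real n) *\<^sub>R (D ^^ (n - 1)) (P n i (P 1 j L))) =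
      - higher_euler N 1 i (P 1 j L)"
  proof -
    have top: "P (Suc N) i (P 1 j L) = 0"
      using depends_below_P[OF L, of 1 j] N by (simp add: depends_below_def)
    have "(\<Sum>n\<le>N. ((-1) ^ n * real n) *\<^sub>R (D ^^ (n - 1)) (P n i (P 1 j L))) =
        (\<Sum>n\<le>Suc N. ((-1) ^ n * real n) *\<^sub>R (D ^^ (n - 1)) (P n i (P 1 j L)))"
      by (simp add: top[unfolded One_nat_def] Dn_0)
    also have "\<dots> = - higher_euler N 1 i (P 1 j L)"
      by (subst sum.atMost_Suc_shift) (simp add: higher_euler_def sum_negf)
    finally show ?thesis .
  qed
  also have "(\<Sum>n\<le>N. ((-1) ^ n * real (n choose 2)) *\<^sub>R (D ^^ (n - 2)) (P n i (P 0 j L))) =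
      higher_euler N 2 i (P 0 j L)"
  proof -
    have top: "P (Suc N) i (P 0 j L) = 0" "P (Suc (Suc N)) i (P 0 j L) = 0"
      using depends_below_P[OF L, of 0 j] N by (simp_all add: depends_below_def)
    have "(\<Sum>n\<le>N. ((-1) ^ n * real (n choose 2)) *\<^sub>R (D ^^ (n - 2)) (P n i (P 0 j L))) =
        (\<Sum>n\<le>Suc (Suc N). ((-1) ^ n * real (n choose 2)) *\<^sub>R (D ^^ (n - 2)) (P n i (P 0 j L)))"
      by (simp add: top Dn_0)
    also have "\<dots> = higher_euler N 2 i (P 0 j L)"
      by (simp add: sum.atMost_Suc_shift higher_euler_def binomial_eq_0 del: sum.atMost_Suc)
    finally show ?thesis .
  qed
  finally show ?thesis by (simp add: rhs H_def)
qed

lemma helmholtz_third_order: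
  assumes L: "depends_below M L" and N: "2 * M + 2 \<le> N"
    and "depends_below 4 (higher_euler N 0 j L)"
  defines "E \<equiv> \<lambda>i. higher_euler N 0 i L"
  shows "P 2 j (E i) = P 2 i (E j) - 3 *\<^sub>R D (P 3 i (E j))"
proof -
  have z: "P (2 + m) i (E j) = 0" if "m \<ge> 2" for m
    using assms(3) that by (simp add: depends_below_def E_def)
  have "higher_euler N 2 i (E j) = (\<Sum>m\<in>{0,1}. ((-1) ^ m * real ((2 + m) choose 2)) *\<^sub>R (D ^^ m) (P (2 + m) i (E j)))"
    unfolding higher_euler_def
    by (rule sum.mono_neutral_right) (use N z in \<open>auto simp: Dn_0\<close>)
  also have "\<dots> = P 2 i (E j) - 3 *\<^sub>R D (P 3 i (E j))"
    by (simp add: eval_nat_numeral)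
  finally show ?thesis
    using helmholtz_second[OF L N, of j i] by (simp add: E_def)
qed

end

section \<open>Functions of finite order on an open set of jets\<close>

text \<open>The functions on jets have to be elements of a real vector space to form a carrier.\<close>

instantiation "fun" :: (type, real_vector) real_vector
begin

definition "scaleR a F = (\<lambda>x. a *\<^sub>R F x)" for F :: "'a \<Rightarrow> 'b"

instance
  by standard (auto simp: scaleR_fun_def plus_fun_def algebra_simps)

end

text \<open>Identities hold on \<open>W\<close> only.  Setting functions to zero outside turns them into equations between
  elements of the carrier.\<close>

definition restrict_jet :: "jet set \<Rightarrow> (jet \<Rightarrow> real) \<Rightarrow> jet \<Rightarrow> real" where
  "restrict_jet W F = (\<lambda>p. if p \<in> W then F p else 0)"

lemma restrict_jet_in: "p \<in> W \<Longrightarrow> restrict_jet W F p = F p"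
  by (simp add: restrict_jet_def)

definition jet_functions :: "jet set \<Rightarrow> (jet \<Rightarrow> real) set" where
  "jet_functions W = {F. finite_order_smooth W F \<and> (\<forall>p. p \<notin> W \<longrightarrow> F p = 0)}"

lemma restrict_in_jet_functions:
  "open W \<Longrightarrow> finite_order_smooth W F \<Longrightarrow> restrict_jet W F \<in> jet_functions W"
  unfolding jet_functions_def restrict_jet_def
  by (auto elim!: finite_order_smooth_cong[rotated 2])

lemma pd_Deriv_const: "pd c (\<lambda>_. a) p = 0"
  by (simp add: pd_def)

lemma euler_calculus_jets:
  assumes W: "open W"
  shows "euler_calculus (jet_functions W) (\<lambda>F. restrict_jet W (total_deriv F))
    (\<lambda>k i F. restrict_jet W (pd (Deriv k i) F))"
proof
  have fos: "F \<in> jet_functions W \<Longrightarrow> finite_order_smooth W F" for F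
    by (simp add: jet_functions_def)
  have cong_pd: "restrict_jet W (pd c (restrict_jet W F)) = restrict_jet W (pd c F)" for c F
    by (auto simp: restrict_jet_def fun_eq_iff intro!: pd_cong[OF W])
  have cong_D: "restrict_jet W (total_deriv (restrict_jet W F)) = restrict_jet W (total_deriv F)" for F
    by (auto simp: restrict_jet_def fun_eq_iff intro!: total_deriv_cong[OF W])
  have smult: "a *\<^sub>R F = (\<lambda>p. a * F p)" for a and F :: "jet \<Rightarrow> real"
    by (simp add: scaleR_fun_def)
  show "subspace (jet_functions W)"
    unfolding subspace_def jet_functions_def smult
    by (auto simp: plus_fun_def zero_fun_def
        intro!: finite_order_smooth_const finite_order_smooth_add finite_order_smooth_mult W)
  fix F G :: "jet \<Rightarrow> real" and a :: real and k l :: nat and i j :: 2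
  assume F: "F \<in> jet_functions W"
  show "restrict_jet W (total_deriv F) \<in> jet_functions W"
    "restrict_jet W (pd (Deriv k i) F) \<in> jet_functions W"
    by (intro restrict_in_jet_functions finite_order_smooth_total_deriv finite_order_smooth_pd W fos F)+
  show "restrict_jet W (total_deriv (a *\<^sub>R F)) = a *\<^sub>R restrict_jet W (total_deriv F)"
    unfolding smult using total_deriv_mult[OF W finite_order_smooth_const fos[OF F], of _ a]
    by (auto simp: restrict_jet_def total_deriv_const)
  show "restrict_jet W (pd (Deriv k i) (a *\<^sub>R F)) = a *\<^sub>R restrict_jet W (pd (Deriv k i) F)"
    unfolding smult using pd_mult[OF finite_order_smooth_const fos[OF F], of _ "Deriv k i" a]
    by (auto simp: restrict_jet_def pd_Deriv_const)
  show "restrict_jet W (pd (Deriv k i) (restrict_jet W (pd (Deriv l j) F))) =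
      restrict_jet W (pd (Deriv l j) (restrict_jet W (pd (Deriv k i) F)))"
    unfolding cong_pd using pd_commute[OF W] fos[OF F]
    by (auto simp: restrict_jet_def finite_order_smooth_def)
  show "restrict_jet W (pd (Deriv 0 i) (restrict_jet W (total_deriv F))) =
      restrict_jet W (total_deriv (restrict_jet W (pd (Deriv 0 i) F)))"
    unfolding cong_pd cong_D using pd_total_deriv[OF W fos[OF F], of _ 0]
    by (auto simp: restrict_jet_def)
  show "restrict_jet W (pd (Deriv (Suc k) i) (restrict_jet W (total_deriv F))) =
      restrict_jet W (total_deriv (restrict_jet W (pd (Deriv (Suc k) i) F))) + restrict_jet W (pd (Deriv k i) F)"
    unfolding cong_pd cong_D using pd_total_deriv[OF W fos[OF F], of _ "Suc k"]
    by (auto simp: restrict_jet_def plus_fun_def)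
  assume G: "G \<in> jet_functions W"
  show "restrict_jet W (total_deriv (F + G)) = restrict_jet W (total_deriv F) + restrict_jet W (total_deriv G)"
    using total_deriv_add[OF W fos[OF F] fos[OF G]] by (auto simp: restrict_jet_def plus_fun_def)
  show "restrict_jet W (pd (Deriv k i) (F + G)) =
      restrict_jet W (pd (Deriv k i) F) + restrict_jet W (pd (Deriv k i) G)"
    using pd_add[OF fos[OF F] fos[OF G]] by (auto simp: restrict_jet_def plus_fun_def)
qed

lemma euler_expr_finite:
  assumes W: "open W" and L: "order_le r W L" and p: "p \<in> W" and "r \<le> N"
  shows "euler_expr L p $ i = (\<Sum>s\<le>N. (-1) ^ s * (total_deriv ^^ s) (pd (Deriv s i) L) p)"
proof -
  have "(total_deriv ^^ s) (pd (Deriv s i) L) p = 0" if "r < s" for s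
  proof -
    have "(total_deriv ^^ s) (pd (Deriv s i) L) p = (total_deriv ^^ s) (\<lambda>_. 0) p"
      by (rule funpow_total_deriv_cong[OF W _ p]) (simp add: pd_above_order[OF W L that])
    also have "(total_deriv ^^ s) (\<lambda>_. 0) p = 0"
    proof -
      have "total_deriv (\<lambda>_. 0) = (\<lambda>_. 0)"
        by (rule ext) (rule total_deriv_const)
      then have "(total_deriv ^^ n) (\<lambda>_. 0) = (\<lambda>_. 0)" for n
        by (induction n) auto
      then show ?thesis by simp
    qed
    finally show ?thesis .
  qed
  then show ?thesis
    unfolding euler_expr_def using \<open>r \<le> N\<close>
    by (simp, subst suminf_finite[of "{..N}"]) auto
qed

lemma euler_expr_helmholtz:
  assumes W: "open W" and L: "order_le r W L" "smooth_jet W L" and p: "p \<in> W"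
    and E3: "order_le 3 W (\<lambda>q. euler_expr L q $ j)"
  defines "E \<equiv> \<lambda>i q. euler_expr L q $ i"
  shows "pd (Deriv 2 j) (E i) p = pd (Deriv 2 i) (E j) p - 3 * total_deriv (pd (Deriv 3 i) (E j)) p"
proof -
  interpret euler_calculus "jet_functions W" "\<lambda>F. restrict_jet W (total_deriv F)"
    "\<lambda>k i F. restrict_jet W (pd (Deriv k i) F)"
    by (rule euler_calculus_jets[OF W])
  let ?D = "\<lambda>F. restrict_jet W (total_deriv F)" and ?P = "\<lambda>k i F. restrict_jet W (pd (Deriv k i) F)"
  let ?L = "restrict_jet W L"
  (* large enough for all sums: total derivatives may double the order of L *)
  define N where "N = 2 * Suc r + 2"
  have fosL: "finite_order_smooth W L" using L by (auto simp: finite_order_smooth_def)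
  have L_in: "?L \<in> jet_functions W" by (rule restrict_in_jet_functions[OF W fosL])
  have order_L: "order_le r W ?L"
    by (rule order_le_cong[OF _ L(1)]) (simp add: restrict_jet_def)
  have dep_L: "depends_below (Suc r) ?L"
    using L_in pd_above_order[OF W order_L] unfolding depends_below_def
    by (auto simp: restrict_jet_def fun_eq_iff)
  have Dn: "(?D ^^ n) (restrict_jet W F) q = (total_deriv ^^ n) F q" if "q \<in> W" for n F q
    using that
    by (induction n arbitrary: q) (auto simp: restrict_jet_def intro!: total_deriv_cong[OF W])
  have P_L: "?P k i ?L = ?P k i L" for k i
    by (auto simp: restrict_jet_def fun_eq_iff intro!: pd_cong[OF W])
  have E_W: "higher_euler N 0 i ?L q = E i q" if "q \<in> W" for i q
  proof -
    have sum_apply: "(\<Sum>s\<le>N. G s) q = (\<Sum>s\<le>N. G s q)" for G :: "nat \<Rightarrow> jet \<Rightarrow> real"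
      by (induction N) auto
    have "higher_euler N 0 i ?L q = (\<Sum>s\<le>N. (-1) ^ s * (?D ^^ s) (?P s i L) q)"
      by (simp add: higher_euler_def P_L scaleR_fun_def sum_apply)
    also have "\<dots> = (\<Sum>s\<le>N. (-1) ^ s * (total_deriv ^^ s) (pd (Deriv s i) L) q)"
      by (simp add: Dn[OF that])
    also have "\<dots> = E i q"
      unfolding E_def by (rule euler_expr_finite[OF W L(1) that, symmetric]) (simp add: N_def)
    finally show ?thesis .
  qed
  have dep_E: "depends_below 4 (higher_euler N 0 j ?L)"
    unfolding depends_below_def
  proof (intro conjI allI impI)
    show "higher_euler N 0 j ?L \<in> jet_functions W"
      unfolding higher_euler_def by (intro sum_S scale_S Dn_closed P_closed L_in)
    fix k :: nat and i :: 2 assume "4 \<le> k"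
    have "order_le 3 W (higher_euler N 0 j ?L)"
      by (rule order_le_cong[OF _ E3]) (simp add: E_W E_def)
    from pd_above_order[OF W this] show "?P k i (higher_euler N 0 j ?L) = 0"
      using \<open>4 \<le> k\<close> by (auto simp: restrict_jet_def fun_eq_iff)
  qed
  have P_E: "pd c (higher_euler N 0 i ?L) q = pd c (E i) q" if "q \<in> W" for c i q
    by (rule pd_cong[OF W E_W that])
  have "?P 2 j (higher_euler N 0 i ?L) p =
      (?P 2 i (higher_euler N 0 j ?L) - 3 *\<^sub>R ?D (?P 3 i (higher_euler N 0 j ?L))) p"
    using helmholtz_third_order[OF dep_L _ dep_E] by (simp add: N_def)
  then have "pd (Deriv 2 j) (E i) p = pd (Deriv 2 i) (E j) p - 3 * total_deriv (?P 3 i (higher_euler N 0 j ?L)) p"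
    by (simp add: restrict_jet_in p P_E scaleR_fun_def)
  also have "total_deriv (?P 3 i (higher_euler N 0 j ?L)) p = total_deriv (pd (Deriv 3 i) (E j)) p"
    by (rule total_deriv_cong[OF W _ p]) (simp add: restrict_jet_in P_E)
  finally show ?thesis .
qed

section \<open>Symmetry of the linear coefficients of a variational equation\<close>

lemma k_term_axis:
  "k_term A B c t x v (h *\<^sub>R axis j 1) =
    (h * h) *\<^sub>R (vector_derivative (\<lambda>s. A t x (v + s *\<^sub>R axis j 1)) (at 0) *v axis j 1)
    + h *\<^sub>R (B t x v *v axis j 1) + c t x v"
proof -
  have "(\<Sum>l\<in>UNIV. (h *\<^sub>R axis j 1 :: real^2) $ l *\<^sub>R M l) = h *\<^sub>R M j" for M :: "2 \<Rightarrow> real^2^2"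
  proof -
    have "(h *\<^sub>R axis j 1 :: real^2) $ l *\<^sub>R M l = (if l = j then h *\<^sub>R M j else 0)" for l
      by (simp add: axis_def)
    then show ?thesis by simp
  qed
  then show ?thesis
    by (simp add: k_term_def matrix_vector_mult_scaleR scaleR_matrix_vector_assoc[symmetric])
qed

text \<open>The Helmholtz condition is evaluated at a jet with \<open>t = 0\<close>, \<open>x = 0\<close>, \<open>v' = v'' = 0\<close>.  There the part of the
  equation that is quadratic in \<open>v'\<close> does not contribute, and the total derivative of \<open>A\<close> vanishes, because
  \<open>A\<close> depends on \<open>v\<close> only.\<close>

lemma variational_symmetric:
  assumes "open U" "variational U E" and form: "third_order_form U E A B c"
    and indep: "independent_of_position U A (k_term A B c)" and "v \<in> U"
  shows "B 0 0 v $ i $ j = B 0 0 v $ j $ i"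
proof -
  define u :: "nat \<Rightarrow> real^2" where "u = (\<lambda>s. if s = 1 then v else 0)"
  define p :: jet where "p = (0, u)"
  have u: "u 0 = 0" "u 1 = v" "u 2 = 0" "u 3 = 0" "u (Suc 0) = v" by (simp_all add: u_def)
  have "p \<in> jet_domain U" using \<open>v \<in> U\<close> by (simp add: p_def jet_domain_def u)
  from bspec[OF assms(2)[unfolded variational_def] this]
  obtain W L r where W: "open W" "p \<in> W" "W \<subseteq> jet_domain U" and L: "order_le r W L" "smooth_jet W L"
    and E_all: "\<forall>(t, u) \<in> W. E t (u 0) (u 1) (u 2) (u 3) = euler_expr L (t, u)"
    by (elim exE conjE)
  have E: "E t (u 0) (u 1) (u 2) (u 3) = euler_expr L (t, u)" if "(t, u) \<in> W" for t u
    using E_all that by blast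
  define G where "G i = (\<lambda>(t, u :: nat \<Rightarrow> real^2). (A t (u 0) (u 1) *v u 3 + k_term A B c t (u 0) (u 1) (u 2)) $ i)" for i
  have G: "euler_expr L q $ i = G i q" if "q \<in> W" for q i
  proof -
    obtain t w where q: "q = (t, w)" by (cases q)
    then have "w 1 \<in> U" using W that by (auto simp: jet_domain_def)
    then have "E t (w 0) (w 1) (w 2) (w 3) = A t (w 0) (w 1) *v w 3 + k_term A B c t (w 0) (w 1) (w 2)"
      using form by (simp add: third_order_form_def)
    then have "euler_expr L q = A t (w 0) (w 1) *v w 3 + k_term A B c t (w 0) (w 1) (w 2)"
      using E[of t w] that by (simp add: q)
    then show ?thesis by (simp add: q G_def)
  qed
  have "order_le 3 W (G j)" for j
    by (simp add: order_le_def G_def)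
  then have E3: "order_le 3 W (\<lambda>q. euler_expr L q $ j)" for j
    by (rule order_le_cong[rotated]) (simp add: G)
  have P2: "pd (Deriv 2 j) (\<lambda>q. euler_expr L q $ i) p = B 0 0 v $ i $ j" for i j
  proof -
    have "pd (Deriv 2 j) (\<lambda>q. euler_expr L q $ i) p = pd (Deriv 2 j) (G i) p"
      by (rule pd_cong[OF W(1) G W(2)])
    also have "\<dots> = B 0 0 v $ i $ j"
    proof (rule pd_eqI)
      have "G i (shift (Deriv 2 j) h p) = h * h * (vector_derivative (\<lambda>s. A 0 0 (v + s *\<^sub>R axis j 1)) (at 0) *v axis j 1) $ i
          + h * B 0 0 v $ i $ j + c 0 0 v $ i" for h
        by (simp add: G_def p_def u k_term_axis matrix_vector_mult_basis column_def)
      then show "((\<lambda>h. G i (shift (Deriv 2 j) h p)) has_field_derivative B 0 0 v $ i $ j) (at 0)"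
        by (auto intro!: derivative_eq_intros)
    qed
    finally show ?thesis .
  qed
  have P3: "pd (Deriv 3 i) (\<lambda>q. euler_expr L q $ j) q = (\<lambda>(t, u). A t (u 0) (u 1) $ j $ i) q" if "q \<in> W" for q
  proof -
    obtain t w where q: "q = (t, w)" by (cases q)
    have "pd (Deriv 3 i) (\<lambda>q. euler_expr L q $ j) q = pd (Deriv 3 i) (G j) q"
      by (rule pd_cong[OF W(1) G that])
    also have "\<dots> = A t (w 0) (w 1) $ j $ i"
    proof (rule pd_eqI)
      have "G j (shift (Deriv 3 i) h q) = G j q + h * A t (w 0) (w 1) $ j $ i" for h
        by (simp add: G_def q matrix_vector_mult_basis column_def matrix_vector_right_distrib
            matrix_vector_mult_scaleR)
      then show "((\<lambda>h. G j (shift (Deriv 3 i) h q)) has_field_derivative A t (w 0) (w 1) $ j $ i) (at 0)"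
        by (auto intro!: derivative_eq_intros)
    qed
    finally show ?thesis by (simp add: q)
  qed
  let ?A = "\<lambda>(t, u :: nat \<Rightarrow> real^2). A t (u 0) (u 1) $ j $ i"
  have "order_le 1 W ?A" by (simp add: order_le_def)
  from total_deriv_finite[OF W(1) this W(2)]
  have "total_deriv ?A p = pd Time ?A p + (\<Sum>l\<in>UNIV. v $ l * pd (Deriv 0 l) ?A p)"
    by (simp add: p_def u_def)
  moreover have "?A (shift Time h p) = ?A p" "?A (shift (Deriv 0 l) h p) = ?A p" for h l
    using indep \<open>v \<in> U\<close> unfolding independent_of_position_def by (simp_all add: p_def u) metis+
  ultimately have "total_deriv ?A p = 0"
    by (simp add: pd_def)
  moreover have "total_deriv (pd (Deriv 3 i) (\<lambda>q. euler_expr L q $ j)) p = total_deriv ?A p"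
    by (rule total_deriv_cong[OF W(1) P3 W(2)])
  ultimately show ?thesis
    using euler_expr_helmholtz[OF W(1) L W(2) E3, of j i] by (simp add: P2)
qed

section \<open>Lie derivatives along the infinitesimal isometries\<close>

lemmas vec2_simps = vec_eq_iff forall_2 sum_2 matrix_vector_mult_def transpose_def
  mdot_def lower_def rot_def levi_def

lemma linear_mdot: "linear (mdot g \<pi>)"
  by (rule linearI) (simp_all add: mdot_def sum_2 algebra_simps)

lemma linear_lower: "linear (lower g)"
  by (rule linearI) (simp_all add: lower_def vec_eq_iff algebra_simps)

lemma linear_rot: "linear (rot g \<Omega>)"
  unfolding rot_def
  by (rule linear_compose[OF linear_lower matrix_vector_mul_linear, unfolded o_def])

lemma linear_matrix_apply: "linear (\<lambda>M :: real^2^2. M *v w)"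
  by (rule linearI) (simp_all add: matrix_vector_mult_add_rdistrib scaleR_matrix_vector_assoc)

lemmas has_derivative_linear_intros =
  bounded_linear.has_derivative[OF linear_conv_bounded_linear[THEN iffD1, OF linear_mdot]]
  bounded_linear.has_derivative[OF linear_conv_bounded_linear[THEN iffD1, OF linear_lower]]
  bounded_linear.has_derivative[OF linear_conv_bounded_linear[THEN iffD1, OF linear_rot]]
  bounded_linear.has_derivative[OF linear_conv_bounded_linear[THEN iffD1, OF linear_matrix_apply]]

lemma mdot_commute: "mdot g v w = mdot g w v"
  by (simp add: mdot_def mult.commute mult.left_commute)

lemma mdot_has_derivative:
  assumes "(f has_derivative f') (at x)" "(e has_derivative e') (at x)"
  shows "((\<lambda>x. mdot g (f x) (e x)) has_derivative (\<lambda>w. mdot g (f' w) (e x) + mdot g (f x) (e' w))) (at x)"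
proof -
  have c: "((\<lambda>x. f x $ i) has_derivative (\<lambda>w. f' w $ i)) (at x)"
      "((\<lambda>x. e x $ i) has_derivative (\<lambda>w. e' w $ i)) (at x)" for i
    by (rule bounded_linear.has_derivative[OF bounded_linear_vec_nth] assms)+
  show ?thesis
    unfolding mdot_def sum_2
    by (rule has_derivative_eq_rhs, (rule derivative_intros c)+) (simp add: fun_eq_iff algebra_simps)
qed

lemma generator_has_derivative:
  "(generator \<eta> g \<pi> \<Omega> has_derivative (\<lambda>(dt, dx, dv, dv').
     (- mdot g \<pi> dx, (\<eta> * dt) *\<^sub>R \<pi> + rot g \<Omega> dx,
      mdot g \<pi> dv *\<^sub>R v + mdot g \<pi> v *\<^sub>R dv + rot g \<Omega> dv,
      (2 * mdot g \<pi> dv) *\<^sub>R v' + (2 * mdot g \<pi> v) *\<^sub>R dv' + mdot g \<pi> dv' *\<^sub>R v + mdot g \<pi> v' *\<^sub>R dv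
        + rot g \<Omega> dv'))) (at (t, x, v, v'))"
proof -
  have eq: "generator \<eta> g \<pi> \<Omega> = (\<lambda>p. (- mdot g \<pi> (fst (snd p)),
      (\<eta> * fst p) *\<^sub>R \<pi> + rot g \<Omega> (fst (snd p)),
      \<eta> *\<^sub>R \<pi> + mdot g \<pi> (fst (snd (snd p))) *\<^sub>R fst (snd (snd p)) + rot g \<Omega> (fst (snd (snd p))),
      (2 * mdot g \<pi> (fst (snd (snd p)))) *\<^sub>R snd (snd (snd p))
        + mdot g \<pi> (snd (snd (snd p))) *\<^sub>R fst (snd (snd p)) + rot g \<Omega> (snd (snd (snd p)))))"
    by (rule ext) (simp add: split_paired_all)
  show ?thesis
    unfolding eq
    by (rule has_derivative_eq_rhs, (rule derivative_intros has_derivative_linear_intros)+)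
      (simp add: fun_eq_iff algebra_simps)
qed

text \<open>Since \<open>A\<close> and \<open>k\<close> depend on \<open>v\<close> and \<open>v'\<close> only, they are differentiated along the velocity part \<open>V\<close> and the
  acceleration part \<open>V'\<close> of the generator.\<close>

lemma lie_derivative_eps_form:
  fixes \<eta> :: real and g \<pi> :: "real^2" and \<Omega> :: "real^2^2"
  assumes "open U" "v \<in> U" and indep: "independent_of_position U A k"
    and A': "(A 0 0 has_derivative A') (at v)"
    and k': "((\<lambda>(v, v'). k 0 0 v v') has_derivative k') (at (v, v'))"
  defines "V \<equiv> \<eta> *\<^sub>R \<pi> + mdot g \<pi> v *\<^sub>R v + rot g \<Omega> v"
    and "V' \<equiv> (2 * mdot g \<pi> v) *\<^sub>R v' + mdot g \<pi> v' *\<^sub>R v + rot g \<Omega> v'"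
  shows "lie_derivative (generator \<eta> g \<pi> \<Omega>) (eps_form A k) (t, x, v, v') (dt, dx, dv, dv') =
    A' V *v dv' + dt *\<^sub>R k' (V, V')
    + A 0 0 v *v ((2 * mdot g \<pi> dv) *\<^sub>R v' + (2 * mdot g \<pi> v) *\<^sub>R dv' + mdot g \<pi> dv' *\<^sub>R v
        + mdot g \<pi> v' *\<^sub>R dv + rot g \<Omega> dv')
    - mdot g \<pi> dx *\<^sub>R k 0 0 v v'"
proof -
  let ?w = "(dt, dx, dv, dv')"
  let ?F = "\<lambda>q. A 0 0 (fst (snd (snd q))) *v dv'
    + dt *\<^sub>R (\<lambda>(v, v'). k 0 0 v v') (fst (snd (snd q)), snd (snd (snd q)))"
  have A_eq: "A s y z = A 0 0 z" "k s y z z' = k 0 0 z z'" if "z \<in> U" for s y z z'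
    using indep that unfolding independent_of_position_def by metis+
  have dA: "((\<lambda>q. A 0 0 (fst (snd (snd q)))) has_derivative (\<lambda>d. A' (fst (snd (snd d))))) (at (t, x, v, v'))"
    by (rule has_derivative_compose[where g = "A 0 0"], (rule derivative_intros)+) (simp add: A')
  have dk: "((\<lambda>q. (\<lambda>(v, v'). k 0 0 v v') (fst (snd (snd q)), snd (snd (snd q)))) has_derivative
      (\<lambda>d. k' (fst (snd (snd d)), snd (snd (snd d))))) (at (t, x, v, v'))"
    by (rule has_derivative_compose[where g = "\<lambda>(v, v'). k 0 0 v v'"], (rule derivative_intros)+)
      (use k' in \<open>simp add: case_prod_beta'\<close>)
  have dF: "(?F has_derivative (\<lambda>d. A' (fst (snd (snd d))) *v dv'
      + dt *\<^sub>R k' (fst (snd (snd d)), snd (snd (snd d))))) (at (t, x, v, v'))"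
    by (intro has_derivative_add has_derivative_scaleR_right has_derivative_linear_intros dA dk)
  let ?N = "(\<lambda>q :: jet2. fst (snd (snd q))) -` U"
  have "open ?N"
    using \<open>open U\<close> continuous_on_open_vimage[OF open_UNIV, of "\<lambda>q :: jet2. fst (snd (snd q))"]
    by (simp add: continuous_on_fst continuous_on_snd continuous_on_id)
  then have "((\<lambda>q. eps_form A k q ?w) has_derivative (\<lambda>d. A' (fst (snd (snd d))) *v dv'
      + dt *\<^sub>R k' (fst (snd (snd d)), snd (snd (snd d))))) (at (t, x, v, v'))"
  proof (rule has_derivative_transform_within_open[OF dF])
    show "?F q = eps_form A k q ?w" if "q \<in> ?N" for q
    proof -
      obtain s y z z' where q: "q = (s, y, z, z')" by (cases q)
      then show ?thesis using that A_eq(1)[of z s y] A_eq(2)[of z s y z'] by simp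
    qed
  qed (use \<open>v \<in> U\<close> in simp)
  from frechet_derivative_at[OF this, symmetric]
  show ?thesis
    unfolding lie_derivative_def
    using frechet_derivative_at[OF generator_has_derivative[of \<eta> g \<pi> \<Omega> v v' t x], symmetric] A_eq[OF \<open>v \<in> U\<close>, of t x]
    by (simp add: V_def V'_def)
qed

text \<open>\<open>\<eta> g\<close> is the spatial part of the metric after it has been scaled to have \<open>1\<close> as time component.\<close>

lemma generator_normalize:
  assumes "\<eta> \<in> {1, -1}"
  shows "generator \<eta> g \<pi> \<Omega> = generator 1 (\<eta> *\<^sub>R g) (\<eta> *\<^sub>R \<pi>) (\<eta> *\<^sub>R \<Omega>)"
  using assms by (auto simp: fun_eq_iff vec2_simps)

definition preserves_equation where
  "preserves_equation U A k X \<longleftrightarrow>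
    (\<exists>\<Phi> \<Xi> \<Psi> :: real^2 \<Rightarrow> real^2 \<Rightarrow> real^2^2. \<forall>t x v v' dt dx dv dv'. v \<in> U \<longrightarrow>
       lie_derivative X (eps_form A k) (t, x, v, v') (dt, dx, dv, dv') =
         \<Phi> v v' *v eps_form A k (t, x, v, v') (dt, dx, dv, dv')
         + \<Xi> v v' *v (dx - dt *\<^sub>R v) + \<Psi> v v' *v (dv - dt *\<^sub>R v'))"

lemma group_invariant_iff:
  "group_invariant \<eta> g U A k \<longleftrightarrow> independent_of_position U A k \<and>
    (\<forall>\<pi> \<Omega>. transpose \<Omega> = - \<Omega> \<longrightarrow> preserves_equation U A k (generator \<eta> g \<pi> \<Omega>))"
  unfolding group_invariant_def preserves_equation_def ..

lemma group_invariant_normalize: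
  assumes "\<eta> \<in> {1, -1}"
  shows "group_invariant \<eta> g U A k \<longleftrightarrow> group_invariant 1 (\<eta> *\<^sub>R g) U A k"
proof -
  have inv: "\<eta> *\<^sub>R (\<eta> *\<^sub>R z) = z" for z :: "'z::real_vector" using assms by auto
  have tr: "transpose (\<eta> *\<^sub>R \<Omega>) = - (\<eta> *\<^sub>R \<Omega>) \<longleftrightarrow> transpose \<Omega> = - \<Omega>" for \<Omega> :: "real^2^2"
    using assms by (auto simp: vec2_simps)
  show ?thesis
    unfolding group_invariant_iff generator_normalize[OF assms]
    by (metis inv tr)
qed

section \<open>The invariant family and its Lie derivatives\<close>

definition levi_mat :: "real^2^2" where "levi_mat = (\<chi> i j. levi i j)"

definition family_A :: "real \<Rightarrow> real^2 \<Rightarrow> real^2 \<Rightarrow> real^2^2" where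
  "family_A \<kappa> h v = (\<kappa> * (1 + mdot h v v) powr (-3/2)) *\<^sub>R levi_mat"

text \<open>Applied to \<open>v'\<close>, this is \<open>q\<^bsup>3/2\<^esup>\<close> times the Hessian of \<open>\<surd>q\<close>, where \<open>q = 1 + h(v, v)\<close>.\<close>

definition family_sym :: "real^2 \<Rightarrow> real^2 \<Rightarrow> real^2 \<Rightarrow> real^2" where
  "family_sym h v v' = (1 + mdot h v v) *\<^sub>R lower h v' - mdot h v' v *\<^sub>R lower h v"

definition family_k :: "real \<Rightarrow> real \<Rightarrow> real^2 \<Rightarrow> real^2 \<Rightarrow> real^2 \<Rightarrow> real^2" where
  "family_k \<kappa> \<mu> h v v' =
    (- 3 * \<kappa> * mdot h v v' * (1 + mdot h v v) powr (-5/2)) *\<^sub>R (levi_mat *v v')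
    + (\<mu> * (1 + mdot h v v) powr (-3/2)) *\<^sub>R family_sym h v v'"

lemma levi_mat_mult: "levi_mat *v w = - star w"
  by (simp add: levi_mat_def star_def vec2_simps)

lemma levi_mat_nth: "(levi_mat *v w) $ 1 = w $ 2" "(levi_mat *v w) $ 2 = - w $ 1"
  by (simp_all add: levi_mat_def levi_def matrix_vector_mult_def sum_2)

lemma powr_half_steps:
  assumes "0 < (q::real)"
  shows "q powr (-3/2) = q * q powr (-5/2)" "q * q powr (-7/2) = q powr (-5/2)"
  using assms by (simp_all add: powr_mult_base)

lemma invariant_expr_family:
  assumes "0 < 1 + mdot h v v"
  shows "\<kappa> *\<^sub>R invariant_expr h \<mu> v v' v'' = family_A \<kappa> h v *v v'' + family_k \<kappa> (\<kappa> * \<mu>) h v v'"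
proof -
  have "(1 + mdot h v v) powr (-3/2) = 1 / (1 + mdot h v v) powr (3/2)"
    "(1 + mdot h v v) powr (-5/2) = 1 / (1 + mdot h v v) powr (5/2)"
    by (simp_all add: powr_minus_divide)
  then show ?thesis
    by (simp add: invariant_expr_def family_A_def family_k_def family_sym_def
        scaleR_matrix_vector_assoc[symmetric] levi_mat_mult scaleR_add_right algebra_simps)
qed

lemma q_powr_has_derivative:
  assumes "0 < 1 + mdot h v v"
  shows "((\<lambda>v. (1 + mdot h v v) powr a) has_derivative
    (\<lambda>w. 2 * a * (1 + mdot h v v) powr (a - 1) * mdot h v w)) (at v)"
proof -
  have "((\<lambda>v. 1 + mdot h v v) has_derivative (\<lambda>w. 2 * mdot h v w)) (at v)"
    by (rule has_derivative_eq_rhs, (rule derivative_intros mdot_has_derivative)+)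
      (simp add: fun_eq_iff mdot_commute)
  from has_derivative_powr[OF this has_derivative_const[of a] assms UNIV_I] show ?thesis
    by (rule has_derivative_eq_rhs) (use assms in \<open>simp add: fun_eq_iff powr_diff field_simps\<close>)
qed

lemma skew_eq_levi:
  assumes "transpose \<Omega> = - (\<Omega> :: real^2^2)"
  shows "\<Omega> = (\<Omega> $ 1 $ 2) *\<^sub>R levi_mat"
proof -
  have "\<Omega> $ i $ j = - (\<Omega> $ j $ i)" for i j
    using arg_cong[OF assms, of "\<lambda>M. M $ j $ i"] by (simp add: transpose_def)
  from this[of 1 1] this[of 2 2] this[of 2 1]
  show ?thesis
    by (simp add: levi_mat_def vec_eq_iff forall_2 levi_def)
qed

lemma rot_levi: "rot h (c *\<^sub>R levi_mat) w $ 1 = - (c * h $ 2 * w $ 2)" "rot h (c *\<^sub>R levi_mat) w $ 2 = c * h $ 1 * w $ 1"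
  by (simp_all add: vec2_simps levi_mat_def)

text \<open>The coefficient of \<open>dt\<close> in the Lie derivative, in components.  Here \<open>z\<close> stands for \<open>q\<^bsup>-5/2\<^esup>\<close>, which makes
  everything polynomial; \<open>\<pi> = (p1, p2)\<close>, the rotation has parameter \<open>c\<close>, and \<open>V\<close> and \<open>W\<close> are the velocity and
  acceleration parts of the generator.  The first two equations are \<open>h(v, V) = q p\<close> and the derivative of
  \<open>n = h(v, v')\<close> along the generator.\<close>

lemma family_k_identity:
  fixes \<kappa> m z q h1 h2 v1 v2 y1 y2 p1 p2 c :: real
  assumes q: "q = 1 + h1 * v1 * v1 + h2 * v2 * v2"
    and p: "p = h1 * p1 * v1 + h2 * p2 * v2" and p': "p' = h1 * p1 * y1 + h2 * p2 * y2"
    and n: "n = h1 * v1 * y1 + h2 * v2 * y2"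
    and V: "V1 = p1 + p * v1 - c * h2 * v2" "V2 = p2 + p * v2 + c * h1 * v1"
    and W: "W1 = 2 * p * y1 + p' * v1 - c * h2 * y2" "W2 = 2 * p * y2 + p' * v2 + c * h1 * y1"
    and S: "S1 = q * h1 * y1 - n * h1 * v1" "S2 = q * h2 * y2 - n * h2 * v2"
    and k: "k1 = - 3 * \<kappa> * n * z * y2 + m * q * z * S1" "k2 = 3 * \<kappa> * n * z * y1 + m * q * z * S2"
  shows "h1 * v1 * V1 + h2 * v2 * V2 = q * p"
    and "h1 * (V1 * y1 + v1 * W1) + h2 * (V2 * y2 + v2 * W2) = q * p' + 3 * p * n"
    and "- 3 * \<kappa> * ((q * p' + 3 * p * n) * z - 5 * n * z * p) * y2 - 3 * \<kappa> * n * z * W2 - 3 * m * z * q * p * S1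
      + m * q * z * (2 * q * p * h1 * y1 + q * h1 * W1 - (q * p' + 3 * p * n) * h1 * v1 - n * h1 * V1)
      = - h1 * p1 * (v1 * k1 + v2 * k2) - h1 * c * k2 + p * k1 - 3 * p' * \<kappa> * q * z * y2"
    and "3 * \<kappa> * ((q * p' + 3 * p * n) * z - 5 * n * z * p) * y1 + 3 * \<kappa> * n * z * W1 - 3 * m * z * q * p * S2
      + m * q * z * (2 * q * p * h2 * y2 + q * h2 * W2 - (q * p' + 3 * p * n) * h2 * v2 - n * h2 * V2)
      = - h2 * p2 * (v1 * k1 + v2 * k2) + h2 * c * k1 + p * k2 + 3 * p' * \<kappa> * q * z * y1"
  unfolding k S V W p p' n q by algebra+

lemma family_sym_has_derivative:
  "((\<lambda>(v, v'). family_sym h v v') has_derivative (\<lambda>(w, w').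
     (2 * mdot h v w) *\<^sub>R lower h v' + (1 + mdot h v v) *\<^sub>R lower h w'
     - (mdot h w' v + mdot h v' w) *\<^sub>R lower h v - mdot h v' v *\<^sub>R lower h w)) (at (v, v'))"
  unfolding family_sym_def case_prod_beta'
  by (rule has_derivative_eq_rhs,
      (rule derivative_intros mdot_has_derivative has_derivative_linear_intros)+)
    (simp add: fun_eq_iff mdot_commute algebra_simps)

lemma family_A_has_derivative:
  assumes "0 < 1 + mdot h v v"
  shows "(family_A \<kappa> h has_derivative
    (\<lambda>w. (- 3 * \<kappa> * (1 + mdot h v v) powr (-5/2) * mdot h v w) *\<^sub>R levi_mat)) (at v)"
  unfolding family_A_def
  by (rule has_derivative_eq_rhs, (rule derivative_intros q_powr_has_derivative[OF assms])+)
    (simp add: fun_eq_iff algebra_simps)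

lemma family_k_has_derivative:
  assumes q: "0 < 1 + mdot h v v" and m: "(m has_derivative m') (at v)"
  shows "((\<lambda>(v, v'). family_k \<kappa> (m v) h v v') has_derivative (\<lambda>(w, w').
     (- 3 * \<kappa> * ((mdot h w v' + mdot h v w') * (1 + mdot h v v) powr (-5/2)
        - 5 * mdot h v v' * (1 + mdot h v v) powr (-7/2) * mdot h v w)) *\<^sub>R (levi_mat *v v')
     + (- 3 * \<kappa> * mdot h v v' * (1 + mdot h v v) powr (-5/2)) *\<^sub>R (levi_mat *v w')
     + (m' w * (1 + mdot h v v) powr (-3/2) - 3 * m v * (1 + mdot h v v) powr (-5/2) * mdot h v w) *\<^sub>R family_sym h v v'
     + (m v * (1 + mdot h v v) powr (-3/2)) *\<^sub>R ((2 * mdot h v w) *\<^sub>R lower h v' + (1 + mdot h v v) *\<^sub>R lower h w'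
     - (mdot h w' v + mdot h v' w) *\<^sub>R lower h v - mdot h v' v *\<^sub>R lower h w))) (at (v, v'))"
proof -
  have powr: "((\<lambda>z. (1 + mdot h (fst z) (fst z)) powr a) has_derivative
      (\<lambda>w. 2 * a * (1 + mdot h v v) powr (a - 1) * mdot h v (fst w))) (at (v, v'))" for a and v' :: "real^2"
    by (rule has_derivative_compose[where f = fst and g = "\<lambda>v. (1 + mdot h v v) powr a"])
      (use q_powr_has_derivative[OF q] in \<open>auto intro!: derivative_intros\<close>)
  have m1: "((\<lambda>z. m (fst z)) has_derivative (\<lambda>w. m' (fst w))) (at (v, v'))" for v' :: "real^2"
    by (rule has_derivative_compose[where f = fst and g = m]) (use m in \<open>auto intro!: derivative_intros\<close>)
  have lev: "(f has_derivative f') F \<Longrightarrow> ((\<lambda>z. levi_mat *v f z) has_derivative (\<lambda>w. levi_mat *v f' w)) F"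
    for f f' :: "(real^2) \<times> (real^2) \<Rightarrow> real^2" and F
    by (rule bounded_linear.has_derivative[OF matrix_vector_mul_bounded_linear])
  show ?thesis
    unfolding family_k_def case_prod_beta'
    by (rule has_derivative_eq_rhs,
      (rule derivative_intros mdot_has_derivative has_derivative_linear_intros powr m1 lev
        family_sym_has_derivative[unfolded case_prod_beta'])+)
    (simp add: fun_eq_iff algebra_simps)
qed

text \<open>Up to the scalar \<open>h(\<pi>, v)\<close>, the matrix \<open>\<Phi>\<close> is minus the transpose of the derivative of the velocity part
  of the generator at \<open>v\<close>.  For constant \<open>m\<close> this is the invariance of the family.  For variable \<open>m\<close> the last term is the
  obstruction that forces \<open>m\<close> to be constant.\<close>

lemma lie_derivative_family:
  fixes h \<pi> v v' :: "real^2"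
  assumes "open U" "v \<in> U" "independent_of_position U A k"
    and q: "0 < 1 + mdot h v v"
    and A: "\<And>z. z \<in> U \<Longrightarrow> A 0 0 z = family_A \<kappa> h z"
    and k: "\<And>z z'. z \<in> U \<Longrightarrow> k 0 0 z z' = family_k \<kappa> (m z) h z z'"
    and m: "(m has_derivative m') (at v)"
    and \<Omega>: "transpose \<Omega> = - \<Omega>"
  defines "\<Phi> \<equiv> (\<chi> i j. - (h $ i * \<pi> $ i * v $ j + h $ i * \<Omega> $ i $ j)) :: real^2^2"
    and "\<Xi> \<equiv> (\<chi> i j. - (k 0 0 v v' $ i * (h $ j * \<pi> $ j))) :: real^2^2"
    and "\<Psi> \<equiv> (\<chi> i j. 2 * (A 0 0 v *v v') $ i * (h $ j * \<pi> $ j) + mdot h \<pi> v' * A 0 0 v $ i $ j) :: real^2^2"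
  shows "lie_derivative (generator 1 h \<pi> \<Omega>) (eps_form A k) (t, x, v, v') (dt, dx, dv, dv') =
    \<Phi> *v eps_form A k (t, x, v, v') (dt, dx, dv, dv') + \<Xi> *v (dx - dt *\<^sub>R v) + \<Psi> *v (dv - dt *\<^sub>R v')
    + (dt * m' (\<pi> + mdot h \<pi> v *\<^sub>R v + rot h \<Omega> v) * (1 + mdot h v v) powr (-3/2)) *\<^sub>R family_sym h v v'"
proof -
  have A': "(A 0 0 has_derivative (\<lambda>w. (- 3 * \<kappa> * (1 + mdot h v v) powr (-5/2) * mdot h v w) *\<^sub>R levi_mat)) (at v)"
    by (rule has_derivative_transform_within_open[OF family_A_has_derivative[OF q] assms(1,2)]) (simp add: A)
  have "open (U \<times> (UNIV :: (real^2) set))" using assms(1) by (simp add: open_Times)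
  then have k': "((\<lambda>(v, v'). k 0 0 v v') has_derivative (\<lambda>(w, w').
     (- 3 * \<kappa> * ((mdot h w v' + mdot h v w') * (1 + mdot h v v) powr (-5/2)
        - 5 * mdot h v v' * (1 + mdot h v v) powr (-7/2) * mdot h v w)) *\<^sub>R (levi_mat *v v')
     + (- 3 * \<kappa> * mdot h v v' * (1 + mdot h v v) powr (-5/2)) *\<^sub>R (levi_mat *v w')
     + (m' w * (1 + mdot h v v) powr (-3/2) - 3 * m v * (1 + mdot h v v) powr (-5/2) * mdot h v w) *\<^sub>R family_sym h v v'
     + (m v * (1 + mdot h v v) powr (-3/2)) *\<^sub>R ((2 * mdot h v w) *\<^sub>R lower h v' + (1 + mdot h v v) *\<^sub>R lower h w'
     - (mdot h w' v + mdot h v' w) *\<^sub>R lower h v - mdot h v' v *\<^sub>R lower h w))) (at (v, v'))"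
    by (rule has_derivative_transform_within_open[OF family_k_has_derivative[OF q m]])
      (use k \<open>v \<in> U\<close> in auto)
  obtain c where c: "\<Omega> = c *\<^sub>R levi_mat" using skew_eq_levi[OF \<Omega>] by blast
  define V where "V = 1 *\<^sub>R \<pi> + mdot h \<pi> v *\<^sub>R v + rot h \<Omega> v"
  define W where "W = (2 * mdot h \<pi> v) *\<^sub>R v' + mdot h \<pi> v' *\<^sub>R v + rot h \<Omega> v'"
  define Q z where "Q = 1 + mdot h v v" and "z = (1 + mdot h v v) powr (-5/2)"
  have z: "Q powr (-3/2) = Q * z" "Q * Q powr (-7/2) = z" "Q powr (-5/2) = z"
    "Q powr - (3/2) = Q * z" "Q powr - (5/2) = z"
    using powr_half_steps[OF q] by (simp_all add: Q_def z_def)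
  have Q: "Q = 1 + h$1 * v$1 * v$1 + h$2 * v$2 * v$2" by (simp add: Q_def mdot_def sum_2)
  define p p' n where "p = mdot h \<pi> v" and "p' = mdot h \<pi> v'" and "n = mdot h v v'"
  have p: "p = h$1 * \<pi>$1 * v$1 + h$2 * \<pi>$2 * v$2" "p' = h$1 * \<pi>$1 * v'$1 + h$2 * \<pi>$2 * v'$2"
    "n = h$1 * v$1 * v'$1 + h$2 * v$2 * v'$2"
    by (simp_all add: p_def p'_def n_def mdot_def sum_2)
  have V: "V$1 = \<pi>$1 + p * v$1 - c * h$2 * v$2" "V$2 = \<pi>$2 + p * v$2 + c * h$1 * v$1"
    by (simp_all add: V_def c rot_levi p_def)
  have W: "W$1 = 2 * p * v'$1 + p' * v$1 - c * h$2 * v'$2" "W$2 = 2 * p * v'$2 + p' * v$2 + c * h$1 * v'$1"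
    by (simp_all add: W_def c rot_levi p_def p'_def)
  have n_sym: "mdot h v' v = n" by (simp add: n_def mdot_commute)
  have S: "family_sym h v v' $ 1 = Q * h$1 * v'$1 - n * h$1 * v$1" "family_sym h v v' $ 2 = Q * h$2 * v'$2 - n * h$2 * v$2"
    by (simp_all add: family_sym_def lower_def n_sym flip: Q_def)
  note N = levi_mat_nth
  have kc: "k 0 0 v v' $ 1 = - 3 * \<kappa> * n * z * v'$2 + m v * Q * z * family_sym h v v' $ 1"
    "k 0 0 v v' $ 2 = 3 * \<kappa> * n * z * v'$1 + m v * Q * z * family_sym h v v' $ 2"
    by (simp_all add: k[OF \<open>v \<in> U\<close>] family_k_def N z n_def flip: Q_def)
  note ids = family_k_identity[OF Q p V W S kc]
  have dV: "mdot h v V = Q * p" "mdot h V v' + mdot h v W = Q * p' + 3 * p * n" "mdot h W v + mdot h v' V = Q * p' + 3 * p * n"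
    using ids(1,2) by (simp_all add: mdot_def sum_2 algebra_simps)
  have z7: "Q powr (-7/2) * (Q * p) = z * p" using z(2) by (simp add: mult.assoc[symmetric] mult.commute)
  define K where "K = (- 3 * \<kappa> * ((mdot h V v' + mdot h v W) * (1 + mdot h v v) powr (-5/2)
        - 5 * mdot h v v' * (1 + mdot h v v) powr (-7/2) * mdot h v V)) *\<^sub>R (levi_mat *v v')
     + (- 3 * \<kappa> * mdot h v v' * (1 + mdot h v v) powr (-5/2)) *\<^sub>R (levi_mat *v W)
     + (m' V * (1 + mdot h v v) powr (-3/2) - 3 * m v * (1 + mdot h v v) powr (-5/2) * mdot h v V) *\<^sub>R family_sym h v v'
     + (m v * (1 + mdot h v v) powr (-3/2)) *\<^sub>R ((2 * mdot h v V) *\<^sub>R lower h v' + (1 + mdot h v v) *\<^sub>R lower h W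
     - (mdot h W v + mdot h v' V) *\<^sub>R lower h v - mdot h v' v *\<^sub>R lower h V)"
  have K: "K = (- 3 * \<kappa> * ((Q * p' + 3 * p * n) * z - 5 * n * z * p)) *\<^sub>R (levi_mat *v v')
     + (- 3 * \<kappa> * n * z) *\<^sub>R (levi_mat *v W)
     + (m' V * Q * z - 3 * m v * z * Q * p) *\<^sub>R family_sym h v v'
     + (m v * Q * z) *\<^sub>R ((2 * Q * p) *\<^sub>R lower h v' + Q *\<^sub>R lower h W
     - (Q * p' + 3 * p * n) *\<^sub>R lower h v - n *\<^sub>R lower h V)"
    unfolding K_def Q_def[symmetric] z dV n_def[symmetric] n_sym
    using z7 by (simp add: mult.assoc)
  have K1: "K $ 1 = m' V * Q * z * family_sym h v v' $ 1 + (- h$1 * \<pi>$1 * (v$1 * k 0 0 v v' $ 1 + v$2 * k 0 0 v v' $ 2)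
      - h$1 * c * k 0 0 v v' $ 2 + p * k 0 0 v v' $ 1 - 3 * p' * \<kappa> * Q * z * v'$2)"
    unfolding ids(3)[symmetric] by (simp add: K N lower_def algebra_simps)
  have K2: "K $ 2 = m' V * Q * z * family_sym h v v' $ 2 + (- h$2 * \<pi>$2 * (v$1 * k 0 0 v v' $ 1 + v$2 * k 0 0 v v' $ 2)
      + h$2 * c * k 0 0 v v' $ 1 + p * k 0 0 v v' $ 2 + 3 * p' * \<kappa> * Q * z * v'$1)"
    unfolding ids(4)[symmetric] by (simp add: K N lower_def algebra_simps)
  have eps: "eps_form A k (t, x, v, v') (dt, dx, dv, dv') = A 0 0 v *v dv' + dt *\<^sub>R k 0 0 v v'"
    using assms(2,3) unfolding independent_of_position_def by (metis eps_form.simps)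
  have Am: "A 0 0 v = (\<kappa> * Q * z) *\<^sub>R levi_mat" by (simp add: A[OF \<open>v \<in> U\<close>] family_A_def z flip: Q_def)
  have Aw: "(A 0 0 v *v w) $ 1 = \<kappa> * Q * z * w $ 2" "(A 0 0 v *v w) $ 2 = - \<kappa> * Q * z * w $ 1" for w
    by (simp_all add: Am scaleR_matrix_vector_assoc[symmetric] N)
  have lie: "lie_derivative (generator 1 h \<pi> \<Omega>) (eps_form A k) (t, x, v, v') (dt, dx, dv, dv') =
    (- 3 * \<kappa> * z * Q * p) *\<^sub>R (levi_mat *v dv') + dt *\<^sub>R K
    + A 0 0 v *v ((2 * mdot h \<pi> dv) *\<^sub>R v' + (2 * p) *\<^sub>R dv' + mdot h \<pi> dv' *\<^sub>R v
        + p' *\<^sub>R dv + rot h \<Omega> dv')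
    - mdot h \<pi> dx *\<^sub>R k 0 0 v v'"
    unfolding lie_derivative_eps_form[OF assms(1-3) A' k'] K_def V_def[symmetric] W_def[symmetric] prod.case dV
    by (simp add: z p_def p'_def scaleR_matrix_vector_assoc mult.assoc flip: Q_def)
  have lev: "levi_mat $ 1 $ 1 = 0" "levi_mat $ 1 $ 2 = 1" "levi_mat $ 2 $ 1 = -1" "levi_mat $ 2 $ 2 = 0"
    by (simp_all add: levi_mat_def levi_def)
  have Aij: "A 0 0 v $ 1 $ 1 = 0" "A 0 0 v $ 1 $ 2 = \<kappa> * Q * z" "A 0 0 v $ 2 $ 1 = - (\<kappa> * Q * z)"
    "A 0 0 v $ 2 $ 2 = 0"
    by (simp_all add: Am lev)
  have V_eq: "\<pi> + mdot h \<pi> v *\<^sub>R v + rot h \<Omega> v = V" by (simp add: V_def)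
  show ?thesis
    unfolding lie eps V_eq Q_def[symmetric] z vec_eq_iff forall_2
  proof
    show "((- 3 * \<kappa> * z * Q * p) *\<^sub>R (levi_mat *v dv') + dt *\<^sub>R K
      + A 0 0 v *v ((2 * mdot h \<pi> dv) *\<^sub>R v' + (2 * p) *\<^sub>R dv' + mdot h \<pi> dv' *\<^sub>R v + p' *\<^sub>R dv + rot h \<Omega> dv')
      - mdot h \<pi> dx *\<^sub>R k 0 0 v v') $ 1 =
      (\<Phi> *v (A 0 0 v *v dv' + dt *\<^sub>R k 0 0 v v') + \<Xi> *v (dx - dt *\<^sub>R v) + \<Psi> *v (dv - dt *\<^sub>R v')
      + (dt * m' V * (Q * z)) *\<^sub>R family_sym h v v') $ 1"
      unfolding \<Phi>_def \<Xi>_def \<Psi>_def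
      by (simp add: N Aw K1 matrix_vector_mult_def[of "vec_lambda _"] sum_2 c rot_levi lev Aij mdot_def p del: mult_minus_left) algebra
    show "((- 3 * \<kappa> * z * Q * p) *\<^sub>R (levi_mat *v dv') + dt *\<^sub>R K
      + A 0 0 v *v ((2 * mdot h \<pi> dv) *\<^sub>R v' + (2 * p) *\<^sub>R dv' + mdot h \<pi> dv' *\<^sub>R v + p' *\<^sub>R dv + rot h \<Omega> dv')
      - mdot h \<pi> dx *\<^sub>R k 0 0 v v') $ 2 =
      (\<Phi> *v (A 0 0 v *v dv' + dt *\<^sub>R k 0 0 v v') + \<Xi> *v (dx - dt *\<^sub>R v) + \<Psi> *v (dv - dt *\<^sub>R v')
      + (dt * m' V * (Q * z)) *\<^sub>R family_sym h v v') $ 2"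
      unfolding \<Phi>_def \<Xi>_def \<Psi>_def
      by (simp add: N Aw K2 matrix_vector_mult_def[of "vec_lambda _"] sum_2 c rot_levi lev Aij mdot_def p del: mult_minus_left) algebra
  qed
qed

section \<open>Coefficients as functions of the velocity\<close>

definition partial_v :: "2 \<Rightarrow> (real \<Rightarrow> real^2 \<Rightarrow> real^2 \<Rightarrow> real) \<Rightarrow> real \<Rightarrow> real^2 \<Rightarrow> real^2 \<Rightarrow> real" where
  "partial_v i f t x v = deriv (\<lambda>h. f t x (v + h *\<^sub>R axis i 1)) 0"

lemma pd_coeff:
  "pd (Deriv 1 i) (\<lambda>(t, u). f t (u 0) (u 1)) = (\<lambda>(t, u). partial_v i f t (u 0) (u 1))"
  by (simp add: fun_eq_iff pd_def partial_v_def)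

lemma smooth_coeff_partial_v: "smooth_coeff U f \<Longrightarrow> smooth_coeff U (partial_v i f)"
  unfolding smooth_coeff_def pd_coeff[symmetric] by (rule smooth_jet_pd)

definition coeff_jet :: "real \<Rightarrow> real^2 \<Rightarrow> real^2 \<Rightarrow> jet" where
  "coeff_jet t x w = (t, \<lambda>s. if s = 1 then w else x)"

lemma smooth_coeff_DERIV:
  assumes "smooth_coeff U f" "w \<in> U"
  shows "((\<lambda>h. f t x (w + h *\<^sub>R axis i 1)) has_field_derivative partial_v i f t x w) (at 0)"
proof -
  have "coeff_jet t x w \<in> jet_domain U"
    using assms(2) by (simp add: coeff_jet_def jet_domain_def)
  from smooth_jet_DERIV[OF assms(1)[unfolded smooth_coeff_def] this, of "Deriv 1 i"]
  show ?thesis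
    unfolding pd_coeff by (simp add: coeff_jet_def)
qed

lemma smooth_coeff_continuous:
  assumes "smooth_coeff U f"
  shows "continuous_on U (f t x)"
proof -
  have "continuous_on U (\<lambda>w :: real^2. if s = 1 then w else x)" for s :: nat
    by (cases "s = 1") (auto intro: continuous_intros)
  then have "continuous_on U (coeff_jet t x)"
    unfolding coeff_jet_def[abs_def]
    by (intro continuous_on_Pair continuous_on_const continuous_on_coordinatewise_then_product)
  moreover have "coeff_jet t x ` U \<subseteq> jet_domain U"
    by (auto simp: coeff_jet_def jet_domain_def)
  ultimately have "continuous_on U (\<lambda>w. (\<lambda>(t, u). f t (u 0) (u 1)) (coeff_jet t x w))"
    using continuous_on_compose2[OF smooth_jet_continuous[OF assms[unfolded smooth_coeff_def]]] by blast
  then show ?thesis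
    by (simp add: coeff_jet_def)
qed

lemma smooth_coeff_has_derivative:
  assumes "open U" "smooth_coeff U f" "v \<in> U"
  shows "(f t x has_derivative (\<lambda>w. \<Sum>i\<in>UNIV. w $ i * partial_v i f t x v)) (at v)"
  by (rule continuously_differentiable_vec2[OF assms(1,3)])
    (auto intro!: smooth_coeff_DERIV smooth_coeff_continuous smooth_coeff_partial_v assms(2))

section \<open>The isotropy condition\<close>

lemma levi_mat_solve:
  assumes "a \<noteq> 0"
  obtains d where "(a *\<^sub>R levi_mat) *v d + k = 0" "a * d $ 1 = k $ 2" "a * d $ 2 = - k $ 1"
proof
  define d :: "real^2" where "d = (k $ 2 / a) *\<^sub>R axis 1 1 + (- k $ 1 / a) *\<^sub>R axis 2 1"
  show d: "a * d $ 1 = k $ 2" "a * d $ 2 = - k $ 1"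
    using assms by (simp_all add: d_def axis_def)
  then show "(a *\<^sub>R levi_mat) *v d + k = 0"
    by (simp add: vec_eq_iff forall_2 sum_2 matrix_vector_mult_def levi_mat_def levi_def)
qed

text \<open>On such vectors the terms with \<open>\<Phi>\<close>, \<open>\<Xi>\<close> and \<open>\<Psi>\<close> all vanish, so a condition without unknown matrices remains.\<close>

lemma preserves_equation_on_solutions:
  assumes "preserves_equation U A k X" "v \<in> U" "eps_form A k (t, x, v, v') (dt, dt *\<^sub>R v, dt *\<^sub>R v', dv') = 0"
  shows "lie_derivative X (eps_form A k) (t, x, v, v') (dt, dt *\<^sub>R v, dt *\<^sub>R v', dv') = 0"
proof -
  obtain \<Phi> \<Xi> \<Psi> :: "real^2 \<Rightarrow> real^2 \<Rightarrow> real^2^2" where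
    "\<forall>t x v v' dt dx dv dv'. v \<in> U \<longrightarrow>
       lie_derivative X (eps_form A k) (t, x, v, v') (dt, dx, dv, dv') =
         \<Phi> v v' *v eps_form A k (t, x, v, v') (dt, dx, dv, dv')
         + \<Xi> v v' *v (dx - dt *\<^sub>R v) + \<Psi> v v' *v (dv - dt *\<^sub>R v')"
    using assms(1) unfolding preserves_equation_def by (elim exE)
  from this[rule_format, OF assms(2), of t x v' dt "dt *\<^sub>R v" "dt *\<^sub>R v'" dv'] assms(3)
  show ?thesis by (simp del: eps_form.simps)
qed

text \<open>The isotropy condition in components, with \<open>v' = (y1, y2)\<close>, \<open>p = h(\<pi>, v')\<close> and \<open>(w1, w2)\<close> the acceleration
  part of the generator.  Its terms of degree 0, 2 and 1 in \<open>v'\<close> determine \<open>c\<close>, the differential \<open>(a1, a2)\<close>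
  of \<open>a\<close>, and the ratio of the entries of the symmetric matrix \<open>b\<close>.\<close>

lemma stabilizer_system:
  fixes h1 h2 v1 v2 a a1 a2 b11 b12 b22 c1 c2 q :: real
  assumes h: "h1 * h1 = 1" "h2 * h2 = 1" and q: "q = 1 + h1 * v1 * v1 + h2 * v2 * v2" "q \<noteq> 0"
    and eq: "\<And>y1 y2 Y p w1 w2 k1 k2. Y = y1 * a1 + y2 * a2 \<Longrightarrow> p = h1 * h2 * (v1 * y2 - v2 * y1) \<Longrightarrow>
      w1 = p * v1 + h2 * y2 \<Longrightarrow> w2 = p * v2 - h1 * y1 \<Longrightarrow>
      k1 = Y * y2 + b11 * y1 + b12 * y2 + c1 \<Longrightarrow> k2 = - Y * y1 + b12 * y1 + b22 * y2 + c2 \<Longrightarrow>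
      (w1 * a1 + w2 * a2) * y2 + Y * w2 + b11 * w1 + b12 * w2 + 3 * a * p * y2
        - h1 * h2 * (v1 * k1 + v2 * k2) * v2 - h1 * k2 = 0 \<and>
      - (w1 * a1 + w2 * a2) * y1 - Y * w1 + b12 * w1 + b22 * w2 - 3 * a * p * y1
        + h1 * h2 * (v1 * k1 + v2 * k2) * v1 + h2 * k1 = 0"
  shows "c1 = 0" "c2 = 0" "q * a1 = - 3 * a * h1 * v1" "q * a2 = - 3 * a * h2 * v2"
    "b11 * (- h1 * h2 * v1 * v2) = b12 * (q * h1 - v1 * v1)"
    "b22 * (- h1 * h2 * v1 * v2) = b12 * (q * h2 - v2 * v2)"
    "b11 * (q * h2 - v2 * v2) = b22 * (q * h1 - v1 * v1)"
proof -
  note e0 = eq[where ?y1.0 = 0 and ?y2.0 = 0, OF refl refl refl refl refl refl, simplified]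
  have s: "(v1 * c1 + v2 * c2) * q = 0"
    using e0 h q(1) by algebra
  then have s: "v1 * c1 + v2 * c2 = 0" using q(2) by simp
  show c: "c1 = 0" "c2 = 0"
    using e0 h s by algebra+
  note e1 = eq[where ?y1.0 = 1 and ?y2.0 = 0, OF refl refl refl refl refl refl, unfolded c, simplified]
  note e1' = eq[where ?y1.0 = "-1" and ?y2.0 = 0, OF refl refl refl refl refl refl, unfolded c, simplified]
  note e2 = eq[where ?y1.0 = 0 and ?y2.0 = 1, OF refl refl refl refl refl refl, unfolded c, simplified]
  note e2' = eq[where ?y1.0 = 0 and ?y2.0 = "-1", OF refl refl refl refl refl refl, unfolded c, simplified]
  have f1: "(h1 * h2 * v1 * v1 + h2) * a1 + h1 * h2 * v1 * v2 * a2 = - 3 * a * h1 * h2 * v1"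
    using e2 e2' by algebra
  have f2: "h1 * h2 * v1 * v2 * a1 + (h1 * h2 * v2 * v2 + h1) * a2 = - 3 * a * h1 * h2 * v2"
    using e1 e1' by algebra
  show "q * a1 = - 3 * a * h1 * v1" "q * a2 = - 3 * a * h2 * v2"
    using f1 f2 h q(1) by algebra+
  show "b11 * (- h1 * h2 * v1 * v2) = b12 * (q * h1 - v1 * v1)"
    "b22 * (- h1 * h2 * v1 * v2) = b12 * (q * h2 - v2 * v2)"
    "b11 * (q * h2 - v2 * v2) = b22 * (q * h1 - v1 * v1)"
    using e1 e1' e2 e2' h q(1) by algebra+
qed

text \<open>With \<open>\<pi> = \<Omega> v\<close> and rotation \<open>- \<Omega>\<close> the velocity part of the generator is zero at \<open>v\<close>, because
  \<open>h(\<Omega> v, v) = 0\<close>.  So no derivative with respect to \<open>v\<close> occurs: the condition is algebraic in the coefficients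
  of \<open>k\<close>.\<close>

lemma stabilizer_equation:
  assumes "open U" "v \<in> U" and inv: "group_invariant 1 h U A k"
    and A: "\<And>z. z \<in> U \<Longrightarrow> A 0 0 z = a z *\<^sub>R levi_mat"
    and a: "(a has_derivative a') (at v)" "a v \<noteq> 0"
    and k': "((\<lambda>(v, v'). k 0 0 v v') has_derivative k') (at (v, y))"
    and d: "(a v *\<^sub>R levi_mat) *v d + k 0 0 v y = 0"
  defines "\<pi> \<equiv> rot h levi_mat v"
  shows "k' (0, mdot h \<pi> y *\<^sub>R v - rot h levi_mat y)
    + (a v *\<^sub>R levi_mat) *v ((3 * mdot h \<pi> y) *\<^sub>R y + mdot h \<pi> d *\<^sub>R v - rot h levi_mat d) = 0"
proof -
  have indep: "independent_of_position U A k" using inv by (simp add: group_invariant_iff)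
  have A': "(A 0 0 has_derivative (\<lambda>w. a' w *\<^sub>R levi_mat)) (at v)"
    by (rule has_derivative_transform_within_open[OF _ assms(1,2), of "\<lambda>z. a z *\<^sub>R levi_mat"])
      (auto intro!: derivative_eq_intros a simp: A)
  have skew: "transpose (- levi_mat) = - (- levi_mat)"
    by (simp add: vec2_simps levi_mat_def)
  have rot_minus: "rot h (- levi_mat) w = - rot h levi_mat w" for w
    by (simp add: vec2_simps levi_mat_def)
  have \<pi>v: "mdot h \<pi> v = 0" by (simp add: \<pi>_def vec2_simps levi_mat_def)
  have "preserves_equation U A k (generator 1 h \<pi> (- levi_mat))"
    using inv skew by (simp add: group_invariant_iff)
  from preserves_equation_on_solutions[OF this \<open>v \<in> U\<close>, of 0 0 y 1 d]
  have "lie_derivative (generator 1 h \<pi> (- levi_mat)) (eps_form A k) (0, 0, v, y) (1, v, y, d) = 0"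
    using d A[OF \<open>v \<in> U\<close>] by simp
  moreover have "a' 0 = 0" using has_derivative_bounded_linear[OF a(1)]
    by (simp add: linear_simps)
  ultimately show ?thesis
    unfolding lie_derivative_eps_form[OF assms(1,2) indep A' k']
    using scaleR_left_distrib[of "2 * mdot h \<pi> y" "mdot h \<pi> y" y]
    by (simp add: rot_minus \<pi>v A[OF \<open>v \<in> U\<close>] \<pi>_def[symmetric] algebra_simps)
qed

text \<open>At an isotropy generator only the derivative of \<open>k\<close> in the direction of \<open>v'\<close> enters, and there \<open>k\<close> is a
  quadratic polynomial.\<close>

lemma invariant_coefficients:
  fixes A :: "real \<Rightarrow> real^2 \<Rightarrow> real^2 \<Rightarrow> real^2^2" and a a1 a2 b11 b12 b22 c1 c2 :: "real^2 \<Rightarrow> real"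
  assumes "open U" "v \<in> U" and inv: "group_invariant 1 h U A k"
    and h: "\<forall>i. h $ i \<in> {1, -1}" and q: "1 + mdot h v v > 0"
    and A: "\<And>z. z \<in> U \<Longrightarrow> A 0 0 z = a z *\<^sub>R levi_mat" and a: "a v \<noteq> 0"
    and k: "\<And>z y. z \<in> U \<Longrightarrow> k 0 0 z y =
      ((y $ 1 * a1 z + y $ 2 * a2 z) * y $ 2 + b11 z * y $ 1 + b12 z * y $ 2 + c1 z) *\<^sub>R axis 1 1
      + (- (y $ 1 * a1 z + y $ 2 * a2 z) * y $ 1 + b12 z * y $ 1 + b22 z * y $ 2 + c2 z) *\<^sub>R axis 2 1"
    and diff: "\<And>f. f \<in> {a, a1, a2, b11, b12, b22, c1, c2} \<Longrightarrow> f differentiable (at v)"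
  shows "c1 v = 0" "c2 v = 0" "(1 + mdot h v v) * a1 v = - 3 * a v * h $ 1 * v $ 1"
    "(1 + mdot h v v) * a2 v = - 3 * a v * h $ 2 * v $ 2"
    "b11 v * (- h $ 1 * h $ 2 * v $ 1 * v $ 2) = b12 v * ((1 + mdot h v v) * h $ 1 - v $ 1 * v $ 1)"
    "b22 v * (- h $ 1 * h $ 2 * v $ 1 * v $ 2) = b12 v * ((1 + mdot h v v) * h $ 2 - v $ 2 * v $ 2)"
    "b11 v * ((1 + mdot h v v) * h $ 2 - v $ 2 * v $ 2) = b22 v * ((1 + mdot h v v) * h $ 1 - v $ 1 * v $ 1)"
proof -
  let ?K = "\<lambda>z y. ((y $ 1 * a1 z + y $ 2 * a2 z) * y $ 2 + b11 z * y $ 1 + b12 z * y $ 2 + c1 z) *\<^sub>R axis 1 1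
      + (- (y $ 1 * a1 z + y $ 2 * a2 z) * y $ 1 + b12 z * y $ 1 + b22 z * y $ 2 + c2 z) *\<^sub>R (axis 2 1 :: real^2)"
  obtain a' where a': "(a has_derivative a') (at v)"
    using diff[of a] by (auto simp: differentiable_def)
  have "\<exists>f'. (f has_derivative f') (at v)" if "f \<in> {a1, a2, b11, b12, b22, c1, c2}" for f
    using diff[of f] that by (auto simp: differentiable_def)
  then obtain a1' a2' b11' b12' b22' c1' c2' where
    "(a1 has_derivative a1') (at v)" "(a2 has_derivative a2') (at v)" "(b11 has_derivative b11') (at v)"
    "(b12 has_derivative b12') (at v)" "(b22 has_derivative b22') (at v)" "(c1 has_derivative c1') (at v)"
    "(c2 has_derivative c2') (at v)"
    by (metis insert_iff)
  then have fders: "(a1 has_derivative a1') (at v)" "(a2 has_derivative a2') (at v)" "(b11 has_derivative b11') (at v)"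
    "(b12 has_derivative b12') (at v)" "(b22 has_derivative b22') (at v)" "(c1 has_derivative c1') (at v)"
    "(c2 has_derivative c2') (at v)"
    by blast+
  have fst_comp: "((\<lambda>x. f (fst x)) has_derivative (\<lambda>w. f' (fst w))) (at (v, y))"
    if "(f has_derivative f') (at v)" for f f' :: "real^2 \<Rightarrow> real" and y :: "real^2"
    by (rule has_derivative_compose[where f = fst and g = f]) (use that in \<open>auto intro!: derivative_intros\<close>)
  have at_zero: "f' 0 = 0" if "(f has_derivative f') (at v)" for f f' :: "real^2 \<Rightarrow> real"
    using has_derivative_bounded_linear[OF that] by (simp add: linear_simps)
  have D: "((\<lambda>x. a1 (fst x)) has_derivative (\<lambda>w. a1' (fst w))) (at (v, y))"
    "((\<lambda>x. a2 (fst x)) has_derivative (\<lambda>w. a2' (fst w))) (at (v, y))"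
    "((\<lambda>x. b11 (fst x)) has_derivative (\<lambda>w. b11' (fst w))) (at (v, y))"
    "((\<lambda>x. b12 (fst x)) has_derivative (\<lambda>w. b12' (fst w))) (at (v, y))"
    "((\<lambda>x. b22 (fst x)) has_derivative (\<lambda>w. b22' (fst w))) (at (v, y))"
    "((\<lambda>x. c1 (fst x)) has_derivative (\<lambda>w. c1' (fst w))) (at (v, y))"
    "((\<lambda>x. c2 (fst x)) has_derivative (\<lambda>w. c2' (fst w))) (at (v, y))"
    and zero: "a1' 0 = 0" "a2' 0 = 0" "b11' 0 = 0" "b12' 0 = 0" "b22' 0 = 0" "c1' 0 = 0" "c2' 0 = 0"
    for y :: "real^2"
    by (rule fst_comp fders at_zero[OF fders(1)] at_zero[OF fders(2)] at_zero[OF fders(3)] at_zero[OF fders(4)]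
        at_zero[OF fders(5)] at_zero[OF fders(6)] at_zero[OF fders(7)])+
  have Y: "((\<lambda>x :: (real^2) \<times> (real^2). snd x $ i) has_derivative (\<lambda>w. snd w $ i)) F" for i F
    by (intro bounded_linear.has_derivative[OF bounded_linear_vec_nth] has_derivative_snd has_derivative_ident)
  have k': "((\<lambda>(v, y). k 0 0 v y) has_derivative (\<lambda>(w, w').
      ((w' $ 1 * a1 v + w' $ 2 * a2 v + (y $ 1 * a1' w + y $ 2 * a2' w)) * y $ 2 + (y $ 1 * a1 v + y $ 2 * a2 v) * w' $ 2
        + b11 v * w' $ 1 + b11' w * y $ 1 + b12 v * w' $ 2 + b12' w * y $ 2 + c1' w) *\<^sub>R axis 1 1
      + (- (w' $ 1 * a1 v + w' $ 2 * a2 v + (y $ 1 * a1' w + y $ 2 * a2' w)) * y $ 1 - (y $ 1 * a1 v + y $ 2 * a2 v) * w' $ 1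
        + b12 v * w' $ 1 + b12' w * y $ 1 + b22 v * w' $ 2 + b22' w * y $ 2 + c2' w) *\<^sub>R axis 2 1)) (at (v, y))" for y
  proof (rule has_derivative_transform_within_open[of "\<lambda>(z, y). ?K z y" _ _ _ "U \<times> UNIV"])
    show "((\<lambda>(z, y). ?K z y) has_derivative (\<lambda>(w, w').
      ((w' $ 1 * a1 v + w' $ 2 * a2 v + (y $ 1 * a1' w + y $ 2 * a2' w)) * y $ 2 + (y $ 1 * a1 v + y $ 2 * a2 v) * w' $ 2
        + b11 v * w' $ 1 + b11' w * y $ 1 + b12 v * w' $ 2 + b12' w * y $ 2 + c1' w) *\<^sub>R axis 1 1
      + (- (w' $ 1 * a1 v + w' $ 2 * a2 v + (y $ 1 * a1' w + y $ 2 * a2' w)) * y $ 1 - (y $ 1 * a1 v + y $ 2 * a2 v) * w' $ 1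
        + b12 v * w' $ 1 + b12' w * y $ 1 + b22 v * w' $ 2 + b22' w * y $ 2 + c2' w) *\<^sub>R axis 2 1)) (at (v, y))"
      unfolding case_prod_beta'
      by (rule has_derivative_eq_rhs, (rule derivative_intros D Y)+) (simp add: fun_eq_iff algebra_simps)
  qed (use assms(1,2) k in \<open>auto intro: open_Times\<close>)
  have hh: "h $ 1 * h $ 1 = 1" "h $ 2 * h $ 2 = 1" using h by (auto dest: spec[of _ 1] spec[of _ 2])
  have qq: "1 + mdot h v v = 1 + h $ 1 * v $ 1 * v $ 1 + h $ 2 * v $ 2 * v $ 2"
    by (simp add: mdot_def sum_2)
  have rot: "rot h levi_mat w $ 1 = - (h $ 2 * w $ 2)" "rot h levi_mat w $ 2 = h $ 1 * w $ 1" for w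
    using rot_levi[of h 1 w] by simp_all
  have N: "(b *\<^sub>R levi_mat *v w) $ 1 = b * w $ 2" "(b *\<^sub>R levi_mat *v w) $ 2 = - b * w $ 1" for b w
    by (simp_all add: levi_mat_def levi_def matrix_vector_mult_def sum_2)
  have system: "(w1 * a1 v + w2 * a2 v) * y2 + Y * w2 + b11 v * w1 + b12 v * w2 + 3 * a v * p * y2
        - h $ 1 * h $ 2 * (v $ 1 * k1 + v $ 2 * k2) * v $ 2 - h $ 1 * k2 = 0 \<and>
      - (w1 * a1 v + w2 * a2 v) * y1 - Y * w1 + b12 v * w1 + b22 v * w2 - 3 * a v * p * y1
        + h $ 1 * h $ 2 * (v $ 1 * k1 + v $ 2 * k2) * v $ 1 + h $ 2 * k1 = 0"
    if "Y = y1 * a1 v + y2 * a2 v" "p = h $ 1 * h $ 2 * (v $ 1 * y2 - v $ 2 * y1)"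
      "w1 = p * v $ 1 + h $ 2 * y2" "w2 = p * v $ 2 - h $ 1 * y1"
      "k1 = Y * y2 + b11 v * y1 + b12 v * y2 + c1 v" "k2 = - Y * y1 + b12 v * y1 + b22 v * y2 + c2 v"
    for y1 y2 Y p w1 w2 k1 k2
  proof -
    define y :: "real^2" where "y = y1 *\<^sub>R axis 1 1 + y2 *\<^sub>R axis 2 1"
    have y: "y $ 1 = y1" "y $ 2 = y2" by (simp_all add: y_def axis_def)
    obtain d where d: "(a v *\<^sub>R levi_mat) *v d + k 0 0 v y = 0" "a v * d $ 1 = k 0 0 v y $ 2"
      "a v * d $ 2 = - k 0 0 v y $ 1"
      by (rule levi_mat_solve[OF a])
    have kk: "k 0 0 v y $ 1 = k1" "k 0 0 v y $ 2 = k2"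
      using that by (simp_all add: k[OF \<open>v \<in> U\<close>] y axis_def)
    have dd: "a v * d $ 1 = k2" "a v * d $ 2 = - k1" using d kk by simp_all
    have p: "mdot h (rot h levi_mat v) w = h $ 1 * h $ 2 * (v $ 1 * w $ 2 - v $ 2 * w $ 1)" for w
      by (simp add: mdot_def sum_2 rot algebra_simps)
    define P D where "P = h $ 1 * h $ 2 * (v $ 1 * y2 - v $ 2 * y1)" and "D = h $ 1 * h $ 2 * (v $ 1 * d $ 2 - v $ 2 * d $ 1)"
    note st = stabilizer_equation[OF assms(1-3) A a' a k'[of y] d(1), unfolded prod.case vec_eq_iff forall_2]
    define W1 W2 where "W1 = P * v $ 1 + h $ 2 * y2" and "W2 = P * v $ 2 - h $ 1 * y1"
    have st1: "(W1 * a1 v + W2 * a2 v) * y2 + (y1 * a1 v + y2 * a2 v) * W2 + b11 v * W1 + b12 v * W2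
        + a v * (3 * P * y2 + D * v $ 2 - h $ 1 * d $ 1) = 0"
      using st[THEN conjunct1] by (simp add: zero N rot p y axis_def P_def D_def W1_def W2_def)
    have st2: "- (W1 * a1 v + W2 * a2 v) * y1 - (y1 * a1 v + y2 * a2 v) * W1 + b12 v * W1 + b22 v * W2
        - a v * (3 * P * y1 + D * v $ 1 + h $ 2 * d $ 2) = 0"
      using st[THEN conjunct2] by (simp add: zero N rot p y axis_def P_def D_def W1_def W2_def)
    have PW: "p = P" "w1 = W1" "w2 = W2" using that by (simp_all add: P_def W1_def W2_def)
    have "a v * D = h $ 1 * h $ 2 * (- v $ 1 * k1 - v $ 2 * k2)"
    proof -
      have "a v * D = h $ 1 * h $ 2 * (v $ 1 * (a v * d $ 2) - v $ 2 * (a v * d $ 1))"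
        by (simp add: D_def algebra_simps)
      then show ?thesis by (simp only: dd) (simp add: algebra_simps)
    qed
    then show ?thesis
      unfolding PW that(1) using st1 st2 dd by (intro conjI; algebra)
  qed
  note sys = stabilizer_system[OF hh qq less_imp_neq[OF q, symmetric] system]
  show "c1 v = 0" "c2 v = 0" "(1 + mdot h v v) * a1 v = - 3 * a v * h $ 1 * v $ 1"
    "(1 + mdot h v v) * a2 v = - 3 * a v * h $ 2 * v $ 2"
    "b11 v * (- h $ 1 * h $ 2 * v $ 1 * v $ 2) = b12 v * ((1 + mdot h v v) * h $ 1 - v $ 1 * v $ 1)"
    "b22 v * (- h $ 1 * h $ 2 * v $ 1 * v $ 2) = b12 v * ((1 + mdot h v v) * h $ 2 - v $ 2 * v $ 2)"
    "b11 v * ((1 + mdot h v v) * h $ 2 - v $ 2 * v $ 2) = b22 v * ((1 + mdot h v v) * h $ 1 - v $ 1 * v $ 1)"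
    by (rule sys; assumption)+
qed

section \<open>Invariant variational equations belong to the family\<close>

lemma invertible_levi_scaled:
  assumes "invertible (b *\<^sub>R levi_mat)" shows "b \<noteq> 0"
proof
  assume "b = 0"
  with assms have "invertible (0 :: real^2^2)" by simp
  then obtain C :: "real^2^2" where "0 ** C = mat 1" by (auto simp: invertible_def)
  then have "(0 ** C) $ 1 $ 1 = (mat 1 :: real^2^2) $ 1 $ 1" by simp
  then show False by (simp add: matrix_matrix_mult_def mat_def)
qed

lemma k_term_levi:
  assumes "open U" "z \<in> U" and A: "\<And>w. w \<in> U \<Longrightarrow> A t x w = a w *\<^sub>R levi_mat"
    and a: "\<And>l. ((\<lambda>s. a (z + s *\<^sub>R axis l 1)) has_field_derivative a' l) (at 0)"
  shows "k_term A B c t x z y = (\<Sum>l\<in>UNIV. y $ l * a' l) *\<^sub>R (levi_mat *v y) + B t x z *v y + c t x z"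
proof -
  have "vector_derivative (\<lambda>s. A t x (z + s *\<^sub>R axis l 1)) (at 0) = a' l *\<^sub>R levi_mat" for l
  proof (rule vector_derivative_at)
    have "continuous_on UNIV (\<lambda>s. z + s *\<^sub>R axis l 1)" by (intro continuous_intros)
    then have o: "open ((\<lambda>s. z + s *\<^sub>R axis l 1) -` U)"
      using assms(1) by (simp add: continuous_on_open_vimage)
    have "((\<lambda>s. a (z + s *\<^sub>R axis l 1) *\<^sub>R levi_mat) has_vector_derivative a' l *\<^sub>R levi_mat) (at 0)"
      using a[of l] has_vector_derivative_scaleR[OF a[of l] has_vector_derivative_const[of levi_mat]] by simp
    from has_vector_derivative_transform_within_open[OF this o]
    show "((\<lambda>s. A t x (z + s *\<^sub>R axis l 1)) has_vector_derivative a' l *\<^sub>R levi_mat) (at 0)"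
      using A assms(2) by simp
  qed
  then show ?thesis
    by (simp add: k_term_def sum_2 scaleR_left_distrib scaleR_matrix_vector_assoc matrix_vector_mult_add_rdistrib)
qed

text \<open>The entries of \<open>b\<close> are proportional to those of \<open>s\<close>.  Individual entries of \<open>s\<close> may vanish when the metric is
  indefinite, but its determinant is \<open>\<plusminus> q\<close>.  So the factor is expressed with a cofactor expansion, which
  shows that it depends differentiably on the entries.\<close>

lemma symmetric_multiple:
  fixes h1 h2 v1 v2 q b11 b12 b22 s11 s12 s22 w :: real
  assumes h: "h1 * h1 = 1" "h2 * h2 = 1" and q: "q = 1 + h1 * v1 * v1 + h2 * v2 * v2" and w: "q * w = 1"
    and s: "s11 = q * h1 - v1 * v1" "s12 = - h1 * h2 * v1 * v2" "s22 = q * h2 - v2 * v2"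
    and b: "b11 * s12 = b12 * s11" "b22 * s12 = b12 * s22" "b11 * s22 = b22 * s11"
  shows "s11 * s22 - s12 * s12 = h1 * h2 * q"
    and "b11 = h1 * h2 * w * (b11 * s22 - b12 * s12) * s11"
    and "b12 = h1 * h2 * w * (b11 * s22 - b12 * s12) * s12"
    and "b22 = h1 * h2 * w * (b11 * s22 - b12 * s12) * s22"
proof -
  show det: "s11 * s22 - s12 * s12 = h1 * h2 * q"
    unfolding s using h q by algebra
  show "b11 = h1 * h2 * w * (b11 * s22 - b12 * s12) * s11"
    "b12 = h1 * h2 * w * (b11 * s22 - b12 * s12) * s12"
    "b22 = h1 * h2 * w * (b11 * s22 - b12 * s12) * s22"
    using det h w b by algebra+
qed

lemma family_sym_nth:
  assumes "h $ 1 * h $ 1 = 1" "h $ 2 * h $ 2 = (1 :: real)"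
  shows "family_sym h v y $ 1 = ((1 + mdot h v v) * h $ 1 - v $ 1 * v $ 1) * y $ 1 + (- h $ 1 * h $ 2 * v $ 1 * v $ 2) * y $ 2"
    "family_sym h v y $ 2 = (- h $ 1 * h $ 2 * v $ 1 * v $ 2) * y $ 1 + ((1 + mdot h v v) * h $ 2 - v $ 2 * v $ 2) * y $ 2"
  unfolding family_sym_def lower_def mdot_def sum_2
  using assms by (simp_all, algebra+)

text \<open>The isotropy condition determines \<open>a\<close> and \<open>B\<close> up to the functions \<open>a q\<^bsup>3/2\<^esup>\<close> and \<open>m\<close>.  The first is constant
  by the formula for its derivative, the second by invariance under the generators that do move \<open>v\<close>.\<close>

lemma invariant_implies_family:
  fixes h :: "real^2"
  assumes "open U" "connected U" and h: "\<forall>i. h $ i \<in> {1, -1}" and Q_pos: "\<And>v. v \<in> U \<Longrightarrow> 1 + mdot h v v > 0"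
    and "variational U E" and form: "third_order_form U E A B c"
    and inv: "group_invariant 1 h U A (k_term A B c)"
  obtains \<kappa> \<mu> where "\<kappa> \<noteq> 0"
    "\<And>t x v v' v''. v \<in> U \<Longrightarrow> E t x v v' v'' = \<kappa> *\<^sub>R invariant_expr h \<mu> v v' v''"
proof (cases "U = {}")
  case True
  then show ?thesis using that[of 1 0] by simp
next
  case False
  then obtain v0 where v0: "v0 \<in> U" by blast
  define k where "k = k_term A B c"
  define a where "a z = A 0 0 z $ 1 $ 2" for z
  define a1 where "a1 = partial_v 1 (\<lambda>t x v. A t x v $ 1 $ 2) 0 0"
  define a2 where "a2 = partial_v 2 (\<lambda>t x v. A t x v $ 1 $ 2) 0 0"
  define b11 b12 b22 c1 c2 where "b11 z = B 0 0 z $ 1 $ 1" and "b12 z = B 0 0 z $ 1 $ 2" and "b22 z = B 0 0 z $ 2 $ 2"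
    and "c1 z = c 0 0 z $ 1" and "c2 z = c 0 0 z $ 2" for z
  have indep: "independent_of_position U A k" using inv by (simp add: group_invariant_iff k_def)
  have smooth: "smooth_coeff U (\<lambda>t x v. A t x v $ i $ j)" "smooth_coeff U (\<lambda>t x v. B t x v $ i $ j)"
    "smooth_coeff U (\<lambda>t x v. c t x v $ i)" for i j
    using form by (simp_all add: third_order_form_def)
  have A: "A 0 0 z = a z *\<^sub>R levi_mat" and a_nz: "a z \<noteq> 0" if "z \<in> U" for z
  proof -
    have "transpose (A 0 0 z) = - A 0 0 z" and inv: "invertible (A 0 0 z)"
      using form that by (auto simp: third_order_form_def)
    from skew_eq_levi[OF this(1)] show A: "A 0 0 z = a z *\<^sub>R levi_mat" by (simp add: a_def)
    show "a z \<noteq> 0" using inv unfolding A by (rule invertible_levi_scaled)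
  qed
  have DA: "((\<lambda>s. a (z + s *\<^sub>R axis l 1)) has_field_derivative (if l = 1 then a1 z else a2 z)) (at 0)"
    if "z \<in> U" for z l
    using smooth_coeff_DERIV[OF smooth(1)[of 1 2] that, of 0 0 l] exhaust_2[of l]
    by (auto simp: a_def a1_def a2_def)
  have B_sym: "B 0 0 z $ 2 $ 1 = b12 z" if "z \<in> U" for z
    using variational_symmetric[OF assms(1,5) form indep[unfolded k_def] that, of 2 1] by (simp add: b12_def)
  have k: "k 0 0 z y = ((y $ 1 * a1 z + y $ 2 * a2 z) * y $ 2 + b11 z * y $ 1 + b12 z * y $ 2 + c1 z) *\<^sub>R axis 1 1
      + (- (y $ 1 * a1 z + y $ 2 * a2 z) * y $ 1 + b12 z * y $ 1 + b22 z * y $ 2 + c2 z) *\<^sub>R axis 2 1"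
    if "z \<in> U" for z y
  proof -
    have "k 0 0 z y = (\<Sum>l\<in>UNIV. y $ l * (if l = 1 then a1 z else a2 z)) *\<^sub>R (levi_mat *v y)
        + B 0 0 z *v y + c 0 0 z"
      unfolding k_def by (rule k_term_levi[of U z A 0 0 a, OF assms(1) that A DA[OF that]])
    then show ?thesis
      by (simp add: vec_eq_iff forall_2 sum_2 axis_def matrix_vector_mult_def levi_mat_def levi_def
        B_sym[OF that] b11_def b12_def b22_def c1_def c2_def algebra_simps)
  qed
  have diff: "f differentiable (at z)" if "z \<in> U" "f \<in> {a, a1, a2, b11, b12, b22, c1, c2}" for f z
  proof -
    have "smooth_coeff U F \<Longrightarrow> F 0 0 differentiable (at z)" for F
      using smooth_coeff_has_derivative[OF assms(1) _ that(1)] by (auto simp: differentiable_def)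
    from this[OF smooth(1)[of 1 2]] this[OF smooth_coeff_partial_v[OF smooth(1)[of 1 2]]]
      this[OF smooth(2)[of 1 1]] this[OF smooth(2)[of 1 2]] this[OF smooth(2)[of 2 2]]
      this[OF smooth(3)[of 1]] this[OF smooth(3)[of 2]]
    show ?thesis
      using that(2) by (auto simp: a_def[abs_def] a1_def a2_def b11_def[abs_def] b12_def[abs_def]
          b22_def[abs_def] c1_def[abs_def] c2_def[abs_def])
  qed
  have coeff: "c1 v = 0" "c2 v = 0" "(1 + mdot h v v) * a1 v = - 3 * a v * h $ 1 * v $ 1"
    "(1 + mdot h v v) * a2 v = - 3 * a v * h $ 2 * v $ 2"
    "b11 v * (- h $ 1 * h $ 2 * v $ 1 * v $ 2) = b12 v * ((1 + mdot h v v) * h $ 1 - v $ 1 * v $ 1)"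
    "b22 v * (- h $ 1 * h $ 2 * v $ 1 * v $ 2) = b12 v * ((1 + mdot h v v) * h $ 2 - v $ 2 * v $ 2)"
    "b11 v * ((1 + mdot h v v) * h $ 2 - v $ 2 * v $ 2) = b22 v * ((1 + mdot h v v) * h $ 1 - v $ 1 * v $ 1)"
    if v: "v \<in> U" for v
    by (rule invariant_coefficients[OF assms(1) v inv[folded k_def] h Q_pos[OF v] A a_nz[OF v] k diff[OF v]];
        assumption)+
  let ?Q = "\<lambda>z. 1 + mdot h z z"

  have "a z * ?Q z powr (3/2) = a v0 * ?Q v0 powr (3/2)" if "z \<in> U" for z
  proof (rule has_derivative_zero_unique_connected[OF assms(1,2) _ that v0])
    fix w assume w: "w \<in> U"
    have "(a has_derivative (\<lambda>d. \<Sum>i\<in>UNIV. d $ i * partial_v i (\<lambda>t x v. A t x v $ 1 $ 2) 0 0 w)) (at w)"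
      using smooth_coeff_has_derivative[OF assms(1) smooth(1)[of 1 2] w, of 0 0] by (simp add: a_def[abs_def])
    then have a': "(a has_derivative (\<lambda>d. d $ 1 * a1 w + d $ 2 * a2 w)) (at w)"
      by (simp add: sum_2 a1_def a2_def)
    have Qw: "?Q w powr (3/2) = ?Q w * ?Q w powr (1/2)"
      using Q_pos[OF w] by (simp add: powr_mult_base)
    have "(d $ 1 * a1 w + d $ 2 * a2 w) * ?Q w powr (3/2) + a w * (3 * ?Q w powr (1/2) * mdot h w d) = 0" for d
    proof -
      have "?Q w * (d $ 1 * a1 w + d $ 2 * a2 w) = d $ 1 * (?Q w * a1 w) + d $ 2 * (?Q w * a2 w)"
        by (simp add: algebra_simps)
      also have "\<dots> = - 3 * a w * mdot h w d"
        by (simp only: coeff(3,4)[OF w]) (simp add: mdot_def sum_2 algebra_simps)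
      finally have "?Q w * (d $ 1 * a1 w + d $ 2 * a2 w) = - 3 * a w * mdot h w d" .
      then show ?thesis unfolding Qw by algebra
    qed
    then show "((\<lambda>z. a z * ?Q z powr (3/2)) has_derivative (\<lambda>d. 0)) (at w)"
      using has_derivative_mult[OF a' q_powr_has_derivative[OF Q_pos[OF w], of "3/2"]]
      by (simp add: algebra_simps)
  qed
  then obtain \<kappa> where \<kappa>: "\<And>z. z \<in> U \<Longrightarrow> a z * ?Q z powr (3/2) = \<kappa>" by blast
  have a_eq: "a z = \<kappa> * ?Q z powr (-3/2)" if "z \<in> U" for z
    using \<kappa>[OF that] Q_pos[OF that] by (simp add: powr_minus field_simps)
  have \<kappa>_nz: "\<kappa> \<noteq> 0" using a_eq[OF v0] a_nz[OF v0] by auto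
  have A_fam: "A 0 0 z = family_A \<kappa> h z" if "z \<in> U" for z
    using A[OF that] a_eq[OF that] by (simp add: family_A_def)

  (* the coefficient of the Hessian, up to the power of q that is kept apart in m_eq *)
  define m where "m z = h $ 1 * h $ 2 * ?Q z powr (1/2) *
    (b11 z * (?Q z * h $ 2 - z $ 2 * z $ 2) - b12 z * (- h $ 1 * h $ 2 * z $ 1 * z $ 2))" for z
  have hh: "h $ 1 * h $ 1 = 1" "h $ 2 * h $ 2 = 1" using h by (auto dest: spec[of _ 1] spec[of _ 2])
  have m_eq: "b11 z = m z * ?Q z powr (-3/2) * (?Q z * h $ 1 - z $ 1 * z $ 1)"
    "b12 z = m z * ?Q z powr (-3/2) * (- h $ 1 * h $ 2 * z $ 1 * z $ 2)"
    "b22 z = m z * ?Q z powr (-3/2) * (?Q z * h $ 2 - z $ 2 * z $ 2)" if "z \<in> U" for z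
  proof -
    have w: "?Q z * (?Q z powr (1/2) * ?Q z powr (-3/2)) = 1"
      using Q_pos[OF that] by (simp add: powr_add[symmetric] powr_mult_base)
    have q: "?Q z = 1 + h $ 1 * z $ 1 * z $ 1 + h $ 2 * z $ 2 * z $ 2" by (simp add: mdot_def sum_2)
    show "b11 z = m z * ?Q z powr (-3/2) * (?Q z * h $ 1 - z $ 1 * z $ 1)"
      "b12 z = m z * ?Q z powr (-3/2) * (- h $ 1 * h $ 2 * z $ 1 * z $ 2)"
      "b22 z = m z * ?Q z powr (-3/2) * (?Q z * h $ 2 - z $ 2 * z $ 2)"
      by (subst symmetric_multiple[OF hh q w refl refl refl coeff(5-7)[OF that]],
        simp add: m_def)+
  qed
  have k_fam: "k 0 0 z y = family_k \<kappa> (m z) h z y" if "z \<in> U" for z y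
  proof -
    define p where "p = ?Q z powr (-5/2)"
    have p: "?Q z powr (-3/2) = ?Q z * p" unfolding p_def by (rule powr_half_steps[OF Q_pos[OF that]])
    have "?Q z * a1 z = ?Q z * (- 3 * \<kappa> * p * h $ 1 * z $ 1)" "?Q z * a2 z = ?Q z * (- 3 * \<kappa> * p * h $ 2 * z $ 2)"
      using coeff(3,4)[OF that] unfolding a_eq[OF that] p by simp_all
    then have a12: "a1 z = - 3 * \<kappa> * p * h $ 1 * z $ 1" "a2 z = - 3 * \<kappa> * p * h $ 2 * z $ 2"
      using less_imp_neq[OF Q_pos[OF that], symmetric] mult_left_cancel by blast+
    note N = levi_mat_nth
    have n: "mdot h z y = h $ 1 * z $ 1 * y $ 1 + h $ 2 * z $ 2 * y $ 2" by (simp add: mdot_def sum_2)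
    show ?thesis
      unfolding vec_eq_iff forall_2 k[OF that] family_k_def p_def[symmetric]
      by (simp add: family_sym_nth[OF hh] m_eq[OF that] a12 N n axis_def
          coeff(1,2)[OF that] algebra_simps)
  qed
  have m_diff: "m differentiable (at z)" if "z \<in> U" for z
  proof -
    have 1: "(\<lambda>z. ?Q z powr (1/2)) differentiable (at z)"
      using q_powr_has_derivative[OF Q_pos[OF that]] by (auto simp: differentiable_def)
    have 2: "?Q differentiable (at z)"
      unfolding differentiable_def
      by (rule exI, (rule derivative_intros mdot_has_derivative)+)
    have 3: "(\<lambda>z :: real^2. z $ i) differentiable (at z)" for i
      by (rule bounded_linear_imp_differentiable[OF bounded_linear_vec_nth])
    have 4: "b11 differentiable (at z)" "b12 differentiable (at z)"
      using diff[OF that] by auto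
    show ?thesis
      unfolding m_def[abs_def]
      by (intro derivative_intros 1 2 3 4)
  qed
  have m_const: "m z = m v0" if "z \<in> U" for z
  proof (rule has_derivative_zero_unique_connected[OF assms(1,2) _ that v0])
    fix v assume v: "v \<in> U"
    obtain m' where m': "(m has_derivative m') (at v)"
      using m_diff[OF v] by (auto simp: differentiable_def)
    have zero: "(m' (\<pi> + mdot h \<pi> v *\<^sub>R v)) *\<^sub>R family_sym h v y = 0" for \<pi> y
    proof -
      (* the tangent vector (1, v, y, d) satisfies the equation and the contact conditions *)
      obtain d where d: "(a v *\<^sub>R levi_mat) *v d + k 0 0 v y = 0"
        by (rule levi_mat_solve[OF a_nz[OF v]])
      have skew: "transpose (0 :: real^2^2) = - 0" by (simp add: vec2_simps)
      have pres: "preserves_equation U A k (generator 1 h \<pi> 0)"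
        using inv skew by (simp add: group_invariant_iff k_def)
      have eps: "eps_form A k (0, 0, v, y) (1, 1 *\<^sub>R v, 1 *\<^sub>R y, d) = 0"
        using d A[OF v] by simp
      have rot0: "rot h 0 v = 0" by (simp add: vec2_simps)
      have "lie_derivative (generator 1 h \<pi> 0) (eps_form A k) (0, 0, v, y) (1, 1 *\<^sub>R v, 1 *\<^sub>R y, d) = 0"
        by (rule preserves_equation_on_solutions[OF pres v eps])
      then have "(m' (\<pi> + mdot h \<pi> v *\<^sub>R v) * ?Q v powr (-3/2)) *\<^sub>R family_sym h v y = 0"
        using lie_derivative_family[OF assms(1) v indep Q_pos[OF v] A_fam k_fam m' skew,
            of \<pi> 0 0 y 1 "1 *\<^sub>R v" "1 *\<^sub>R y" d, unfolded eps]
        by (simp add: rot0)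
      then show ?thesis using Q_pos[OF v] by simp
    qed
    have "m' w = 0" for w
    proof -
      (* inverts the map from \<pi> to \<pi> + h(\<pi>, v) v *)
      define \<pi> where "\<pi> = w - (mdot h w v / ?Q v) *\<^sub>R v"
      have "mdot h (w - s *\<^sub>R v) v = mdot h w v - s * mdot h v v" for s
        by (simp add: mdot_def sum_2 algebra_simps)
      then have "mdot h \<pi> v = mdot h w v - (mdot h w v / ?Q v) * mdot h v v"
        by (simp add: \<pi>_def)
      also have "\<dots> = mdot h w v / ?Q v"
        using Q_pos[OF v] by (simp add: field_simps)
      finally have "mdot h \<pi> v = mdot h w v / ?Q v" .
      then have "\<pi> + mdot h \<pi> v *\<^sub>R v = w" by (simp add: \<pi>_def)
      then have w: "m' w *\<^sub>R family_sym h v y = 0" for y using zero[of \<pi> y] by simp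
      show ?thesis
      proof (rule ccontr)
        assume "m' w \<noteq> 0"
        then have "family_sym h v y = 0" for y using w[of y] by simp
        from this[of "axis 1 1"] this[of "axis 2 1"]
        have z: "?Q v * h $ 1 - v $ 1 * v $ 1 = 0" "- h $ 1 * h $ 2 * v $ 1 * v $ 2 = 0" "?Q v * h $ 2 - v $ 2 * v $ 2 = 0"
          unfolding vec_eq_iff forall_2 family_sym_nth[OF hh] by (simp_all add: axis_def)
        have q: "?Q v = 1 + h $ 1 * v $ 1 * v $ 1 + h $ 2 * v $ 2 * v $ 2" by (simp add: mdot_def sum_2)
        have "?Q v * inverse (?Q v) = 1" using Q_pos[OF v] by simp
        from symmetric_multiple(1)[OF hh q this refl refl refl, of 0 0 0]
        have "h $ 1 * h $ 2 * ?Q v = 0" unfolding z by simp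
        then show False using hh Q_pos[OF v] by auto
      qed
    qed
    then have "m' = (\<lambda>d. 0)" by auto
    then show "(m has_derivative (\<lambda>d. 0)) (at v)" using m' by simp
  qed
  show ?thesis
  proof (rule that[OF \<kappa>_nz, of "m v0 / \<kappa>"])
    fix t x v v' v'' assume v: "v \<in> U"
    have "E t x v v' v'' = A t x v *v v'' + k t x v v'"
      using form v by (simp add: third_order_form_def k_def)
    also have "\<dots> = A 0 0 v *v v'' + k 0 0 v v'"
      using indep v unfolding independent_of_position_def by metis
    also have "\<dots> = \<kappa> *\<^sub>R invariant_expr h (m v0 / \<kappa>) v v' v''"
      using invariant_expr_family[OF Q_pos[OF v], of \<kappa> "m v0 / \<kappa>"] \<kappa>_nz
      by (simp add: A_fam[OF v] k_fam[OF v] m_const[OF v])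
    finally show "E t x v v' v'' = \<kappa> *\<^sub>R invariant_expr h (m v0 / \<kappa>) v v' v''" .
  qed
qed

section \<open>Lagrangians linear in the acceleration\<close>

lemma open_jet_domain: "open U \<Longrightarrow> open (jet_domain U)"
proof -
  assume "open U"
  have "jet_domain U = (\<lambda>p. snd p 1) -` U" by (auto simp: jet_domain_def)
  then show ?thesis
    using continuous_on_open_vimage[OF open_UNIV, of "\<lambda>p :: jet. snd p 1"] \<open>open U\<close>
    by (simp add: continuous_on_jet_coord)
qed

definition velocity_fun :: "(real^2 \<Rightarrow> real) \<Rightarrow> jet \<Rightarrow> real" where
  "velocity_fun f p = f (snd p 1)"

lemma finite_order_smooth_velocity:
  "smooth_jet W (velocity_fun f) \<Longrightarrow> finite_order_smooth W (velocity_fun f)"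
  unfolding finite_order_smooth_def
  by (intro conjI exI[of _ 1]) (auto simp: order_le_def velocity_fun_def)

lemma finite_order_smooth_coord: "open W \<Longrightarrow> finite_order_smooth W (\<lambda>p. snd p s $ i)"
  unfolding finite_order_smooth_def
  by (intro conjI exI[of _ s]) (auto simp: order_le_def intro: smooth_jet_coord)

lemma pd_coord: "pd c (\<lambda>p. snd p s $ i) p = (if c = Deriv s i then 1 else 0)"
  by (rule pd_eqI) (auto simp: snd_shift intro!: derivative_eq_intros)

lemma pd_velocity:
  assumes "(f has_derivative f') (at (snd p 1))"
  shows "pd c (velocity_fun f) p = (case c of Time \<Rightarrow> 0 | Deriv s i \<Rightarrow> if s = 1 then f' (axis i 1) else 0)"
proof (rule pd_eqI)
  interpret f': bounded_linear f' using assms by (rule has_derivative_bounded_linear)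
  have line: "((\<lambda>h. f (snd p 1 + h *\<^sub>R axis i 1)) has_field_derivative f' (axis i 1)) (at 0)" for i
  proof -
    have "((\<lambda>h. snd p 1 + h *\<^sub>R axis i 1) has_derivative (\<lambda>h. h *\<^sub>R axis i 1)) (at 0)"
      by (auto intro!: derivative_eq_intros)
    from has_derivative_compose[OF this, of f f'] assms
    show ?thesis by (simp add: has_field_derivative_def f'.scaleR mult.commute[of _ "f' (axis i 1)"])
  qed
  show "((\<lambda>h. velocity_fun f (shift c h p)) has_field_derivative
      (case c of Time \<Rightarrow> 0 | Deriv s i \<Rightarrow> if s = 1 then f' (axis i 1) else 0)) (at 0)"
  proof (cases c)
    case Time
    have "velocity_fun f (shift c h p) = velocity_fun f p" for h
      by (cases p) (simp add: Time velocity_fun_def)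
    then show ?thesis by (simp add: Time)
  next
    case (Deriv s i)
    have "velocity_fun f (shift c h p) = (if s = 1 then f (snd p 1 + h *\<^sub>R axis i 1) else f (snd p 1))" for h
      by (cases p) (simp add: Deriv velocity_fun_def)
    then show ?thesis using line[of i] by (simp add: Deriv)
  qed
qed

lemma vec2_axis_decomp: "(w :: real^2) = w $ 1 *\<^sub>R axis 1 1 + w $ 2 *\<^sub>R axis 2 1"
  by (simp add: vec_eq_iff forall_2 axis_def)

lemma total_deriv_velocity:
  assumes f: "(f has_derivative f') (at (snd p 1))"
  shows "total_deriv (velocity_fun f) p = f' (snd p 2)"
proof -
  interpret f': bounded_linear f' using assms by (rule has_derivative_bounded_linear)
  have "order_le 1 UNIV (velocity_fun f)" by (simp add: order_le_def velocity_fun_def)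
  from total_deriv_finite[OF open_UNIV this UNIV_I, of p]
  have "total_deriv (velocity_fun f) p = snd p 2 $ 1 * f' (axis 1 1) + snd p 2 $ 2 * f' (axis 2 1)"
    by (simp add: pd_velocity[OF f] sum_2 numeral_2_eq_2)
  also have "\<dots> = f' (snd p 2)"
    using arg_cong[OF vec2_axis_decomp[of "snd p 2"], of f'] by (simp add: f'.add f'.scaleR)
  finally show ?thesis .
qed

lemma total_deriv_coord: "total_deriv (\<lambda>p. snd p s $ i) p = snd p (Suc s) $ i"
proof -
  have "order_le s UNIV (\<lambda>p. snd p s $ i)" by (simp add: order_le_def)
  from total_deriv_finite[OF open_UNIV this UNIV_I, of p]
  have "total_deriv (\<lambda>p. snd p s $ i) p =
      (\<Sum>r\<le>s. \<Sum>j\<in>UNIV. if r = s \<and> j = i then snd p (Suc s) $ i else 0)"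
    by (simp add: pd_coord if_distrib cong: if_cong)
  also have "\<dots> = (\<Sum>r\<le>s. if r = s then snd p (Suc s) $ i else 0)"
    by (intro sum.cong refl) auto
  finally show ?thesis by simp
qed

text \<open>In \<open>- D (\<partial>L/\<partial>v\<^sup>i) + D\<^sup>2 (\<partial>L/\<partial>v'\<^sup>i)\<close> the derivatives of \<open>f\<close> combine under one \<open>D\<close> to the
  curl \<open>- b\<close> of \<open>f\<close>, so one order is lost; \<open>(g1, g2)\<close> is the gradient of \<open>G\<close>.\<close>

lemma euler_expr_linear_lagrangian:
  fixes f1 f2 G :: "real^2 \<Rightarrow> real"
  assumes W: "open W"
    and smooth: "smooth_jet W (velocity_fun f1)" "smooth_jet W (velocity_fun f2)" "smooth_jet W (velocity_fun G)"
      "smooth_jet W (velocity_fun b)" "smooth_jet W (velocity_fun g1)" "smooth_jet W (velocity_fun g2)"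
    and D: "\<And>p. p \<in> W \<Longrightarrow> (f1 has_derivative f1' (snd p 1)) (at (snd p 1))"
      "\<And>p. p \<in> W \<Longrightarrow> (f2 has_derivative f2' (snd p 1)) (at (snd p 1))"
      "\<And>p. p \<in> W \<Longrightarrow> (G has_derivative (\<lambda>w. g1 (snd p 1) * w $ 1 + g2 (snd p 1) * w $ 2)) (at (snd p 1))"
      "\<And>p. p \<in> W \<Longrightarrow> (b has_derivative b' (snd p 1)) (at (snd p 1))"
      "\<And>p. p \<in> W \<Longrightarrow> (g1 has_derivative g1' (snd p 1)) (at (snd p 1))"
      "\<And>p. p \<in> W \<Longrightarrow> (g2 has_derivative g2' (snd p 1)) (at (snd p 1))"
    and curl: "\<And>p. p \<in> W \<Longrightarrow> f1' (snd p 1) (axis 2 1) - f2' (snd p 1) (axis 1 1) = b (snd p 1)"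
  defines "L \<equiv> \<lambda>p. (snd p 2 $ 1 * velocity_fun f1 p + snd p 2 $ 2 * velocity_fun f2 p) + velocity_fun G p"
  shows "order_le 2 W L" "smooth_jet W L"
    "p \<in> W \<Longrightarrow> euler_expr L p $ 1 = b' (snd p 1) (snd p 2) * snd p 2 $ 2 + b (snd p 1) * snd p 3 $ 2 - g1' (snd p 1) (snd p 2)"
    "p \<in> W \<Longrightarrow> euler_expr L p $ 2 = - b' (snd p 1) (snd p 2) * snd p 2 $ 1 - b (snd p 1) * snd p 3 $ 1 - g2' (snd p 1) (snd p 2)"
proof -
  show ord: "order_le 2 W L"
    by (simp add: order_le_def L_def velocity_fun_def)
  show "smooth_jet W L"
    unfolding L_def by (intro smooth_jet_intros smooth W)
  note fos = smooth[THEN finite_order_smooth_velocity]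
  note fosc = finite_order_smooth_coord[OF W]
  note fos_intros = fos fosc finite_order_smooth_add[OF W] finite_order_smooth_mult[OF W]
  have pdL: "pd c L q = (pd c (\<lambda>p. snd p 2 $ 1) q * velocity_fun f1 q + snd q 2 $ 1 * pd c (velocity_fun f1) q
      + (pd c (\<lambda>p. snd p 2 $ 2) q * velocity_fun f2 q + snd q 2 $ 2 * pd c (velocity_fun f2) q))
      + pd c (velocity_fun G) q" if "q \<in> W" for c q
    unfolding L_def
    by (simp add: pd_add[OF _ _ that] pd_mult[OF _ _ that] fos_intros)
  have P0: "pd (Deriv 0 i) L q = 0" if "q \<in> W" for i q
    by (simp add: pdL[OF that] pd_coord pd_velocity[OF D(1)[OF that]] pd_velocity[OF D(2)[OF that]]
        pd_velocity[OF D(3)[OF that]])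
  have P2: "pd (Deriv 2 1) L q = velocity_fun f1 q" "pd (Deriv 2 2) L q = velocity_fun f2 q" if "q \<in> W" for q
    by (simp_all add: pdL[OF that] pd_coord pd_velocity[OF D(1)[OF that]] pd_velocity[OF D(2)[OF that]]
        pd_velocity[OF D(3)[OF that]])
  have lin: "h w = w $ 1 * h (axis 1 1) + w $ 2 * h (axis 2 1)" if "(k has_derivative h) F" for h k :: "real^2 \<Rightarrow> real" and F w
  proof -
    interpret h: bounded_linear h using that by (rule has_derivative_bounded_linear)
    show ?thesis
      using arg_cong[OF vec2_axis_decomp[of w], of h] by (simp add: h.add h.scaleR)
  qed
  have P1: "pd (Deriv 1 1) L q = (- 1 * (velocity_fun b q * snd q 2 $ 2) + velocity_fun g1 q) + total_deriv (velocity_fun f1) q"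
    "pd (Deriv 1 2) L q = (velocity_fun b q * snd q 2 $ 1 + velocity_fun g2 q) + total_deriv (velocity_fun f2) q" if "q \<in> W" for q
    using curl[OF that] lin[OF D(1)[OF that], of "snd q 2"] lin[OF D(2)[OF that], of "snd q 2"]
    by (simp_all add: pdL[OF that] pd_coord pd_velocity[OF D(1)[OF that]] pd_velocity[OF D(2)[OF that]]
        pd_velocity[OF D(3)[OF that]] total_deriv_velocity[OF D(1)[OF that]] total_deriv_velocity[OF D(2)[OF that]]
        velocity_fun_def axis_def algebra_simps)
  have E: "euler_expr L p $ i = - total_deriv M p"
    if p: "p \<in> W" and M: "finite_order_smooth W M" and f: "finite_order_smooth W f"
      and P1: "\<And>q. q \<in> W \<Longrightarrow> pd (Deriv 1 i) L q = M q + total_deriv f q"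
      and P2: "\<And>q. q \<in> W \<Longrightarrow> pd (Deriv 2 i) L q = f q" for i M f
  proof -
    have "{..2::nat} = {0, 1, 2}" by auto
    then have "euler_expr L p $ i = pd (Deriv 0 i) L p - total_deriv (pd (Deriv 1 i) L) p
        + total_deriv (total_deriv (pd (Deriv 2 i) L)) p"
      using euler_expr_finite[OF W ord p, of 2 i] by (simp add: numeral_2_eq_2)
    also have "total_deriv (pd (Deriv 1 i) L) p = total_deriv (\<lambda>q. M q + total_deriv f q) p"
      by (rule total_deriv_cong[OF W P1 p])
    also have "\<dots> = total_deriv M p + total_deriv (total_deriv f) p"
      by (rule total_deriv_add[OF W M finite_order_smooth_total_deriv[OF W f] p])
    also have "total_deriv (total_deriv (pd (Deriv 2 i) L)) p = total_deriv (total_deriv f) p"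
      by (rule total_deriv_cong[OF W total_deriv_cong[OF W P2] p])
    finally show ?thesis by (simp add: P0[OF p])
  qed
  have Db: "total_deriv (\<lambda>q. velocity_fun b q * snd q 2 $ i) p = b' (snd p 1) (snd p 2) * snd p 2 $ i + b (snd p 1) * snd p 3 $ i"
    if p: "p \<in> W" for i
    using total_deriv_mult[OF W fos(4) fosc p, of 2 i] total_deriv_velocity[OF D(4)[OF p]]
    by (simp add: total_deriv_coord velocity_fun_def eval_nat_numeral)
  show "euler_expr L p $ 1 = b' (snd p 1) (snd p 2) * snd p 2 $ 2 + b (snd p 1) * snd p 3 $ 2 - g1' (snd p 1) (snd p 2)"
    if p: "p \<in> W"
  proof -
    have "euler_expr L p $ 1 = - total_deriv (\<lambda>q. - 1 * (velocity_fun b q * snd q 2 $ 2) + velocity_fun g1 q) p"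
      by (rule E[OF p _ fos(1) P1(1) P2(1)]) (intro fos_intros finite_order_smooth_const)+
    also have "\<dots> = - (total_deriv (\<lambda>q. - 1 * (velocity_fun b q * snd q 2 $ 2)) p + total_deriv (velocity_fun g1) p)"
      by (subst total_deriv_add[OF W _ fos(5) p]) (intro fos_intros finite_order_smooth_const refl)+
    also have "total_deriv (\<lambda>q. - 1 * (velocity_fun b q * snd q 2 $ 2)) p = - total_deriv (\<lambda>q. velocity_fun b q * snd q 2 $ 2) p"
      by (subst total_deriv_mult[OF W _ _ p]) (intro fos_intros finite_order_smooth_const | simp add: total_deriv_const)+
    finally show ?thesis
      by (simp add: Db[OF p] total_deriv_velocity[OF D(5)[OF p]])
  qed
  show "euler_expr L p $ 2 = - b' (snd p 1) (snd p 2) * snd p 2 $ 1 - b (snd p 1) * snd p 3 $ 1 - g2' (snd p 1) (snd p 2)"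
    if p: "p \<in> W"
  proof -
    have "euler_expr L p $ 2 = - total_deriv (\<lambda>q. velocity_fun b q * snd q 2 $ 1 + velocity_fun g2 q) p"
      by (rule E[OF p _ fos(2) P1(2) P2(2)]) (intro fos_intros)+
    also have "\<dots> = - (total_deriv (\<lambda>q. velocity_fun b q * snd q 2 $ 1) p + total_deriv (velocity_fun g2) p)"
      by (subst total_deriv_add[OF W _ fos(6) p]) (intro fos_intros refl)+
    finally show ?thesis
      by (simp add: Db[OF p] total_deriv_velocity[OF D(6)[OF p]])
  qed
qed

section \<open>The family is variational and invariant\<close>

lemma smooth_jet_q:
  assumes "open W"
  shows "smooth_jet W (\<lambda>p. 1 + mdot h (snd p 1) (snd p 1))"
  unfolding mdot_def sum_2 by (intro smooth_jet_intros assms)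

lemma smooth_jet_q_powr:
  assumes "open U" and q: "\<And>v. v \<in> U \<Longrightarrow> 0 < 1 + mdot h v v"
  shows "smooth_jet (jet_domain U) (\<lambda>p. (1 + mdot h (snd p 1) (snd p 1)) powr a)"
  by (intro smooth_jet_powr smooth_jet_q open_jet_domain assms(1))
    (auto simp: jet_domain_def intro: q)

text \<open>The potential is \<open>G = - m \<surd>q\<close>, whose Hessian yields the term \<open>family_sym\<close>.\<close>

lemma family_euler_expr:
  fixes f1 f2 :: "real^2 \<Rightarrow> real"
  assumes U: "open U" and q: "\<And>v. v \<in> U \<Longrightarrow> 0 < 1 + mdot h v v"
    and smooth: "smooth_jet (jet_domain U) (velocity_fun f1)" "smooth_jet (jet_domain U) (velocity_fun f2)"
    and D: "\<And>v. v \<in> U \<Longrightarrow> (f1 has_derivative f1' v) (at v)" "\<And>v. v \<in> U \<Longrightarrow> (f2 has_derivative f2' v) (at v)"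
    and curl: "\<And>v. v \<in> U \<Longrightarrow> f1' v (axis 2 1) - f2' v (axis 1 1) = \<kappa> * (1 + mdot h v v) powr (-3/2)"
  obtains L where "order_le 2 (jet_domain U) L" "smooth_jet (jet_domain U) L"
    "\<And>p. p \<in> jet_domain U \<Longrightarrow> euler_expr L p =
      family_A \<kappa> h (snd p 1) *v snd p 3 + family_k \<kappa> m h (snd p 1) (snd p 2)"
proof -
  let ?Q = "\<lambda>v. 1 + mdot h v v"
  define G where "G v = - m * ?Q v powr (1/2)" for v
  define b where "b v = \<kappa> * ?Q v powr (-3/2)" for v
  define g where "g i v = - m * h $ i * v $ i * ?Q v powr (-1/2)" for i :: 2 and v
  define b' where "b' v w = - 3 * \<kappa> * ?Q v powr (-5/2) * mdot h v w" for v w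
  define g' where "g' i v w = - m * h $ i * (w $ i * ?Q v powr (-1/2) - v $ i * ?Q v powr (-3/2) * mdot h v w)" for i :: 2 and v w
  define L where "L p = (snd p 2 $ 1 * velocity_fun f1 p + snd p 2 $ 2 * velocity_fun f2 p) + velocity_fun G p" for p
  note W = open_jet_domain[OF U]
  have dom: "snd p 1 \<in> U" if "p \<in> jet_domain U" for p using that by (auto simp: jet_domain_def)
  note sq = smooth_jet_q_powr[OF U q]
  have s: "smooth_jet (jet_domain U) (velocity_fun G)" "smooth_jet (jet_domain U) (velocity_fun b)"
    "smooth_jet (jet_domain U) (velocity_fun (g i))" for i
    unfolding velocity_fun_def[abs_def] G_def b_def g_def
    by (intro sq smooth_jet_mult smooth_jet_const smooth_jet_coord W | assumption)+
  have DG: "(G has_derivative (\<lambda>w. g 1 v * w $ 1 + g 2 v * w $ 2)) (at v)" if "v \<in> U" for v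
    unfolding G_def[abs_def]
    by (rule has_derivative_eq_rhs, (rule derivative_intros q_powr_has_derivative[OF q[OF that]])+)
      (simp add: fun_eq_iff g_def mdot_def sum_2 algebra_simps)
  have Db: "(b has_derivative b' v) (at v)" if "v \<in> U" for v
    unfolding b_def[abs_def]
    by (rule has_derivative_eq_rhs, (rule derivative_intros q_powr_has_derivative[OF q[OF that]])+)
      (simp add: fun_eq_iff b'_def)
  have Dg: "(g i has_derivative g' i v) (at v)" if "v \<in> U" for v i
    unfolding g_def[abs_def]
    by (rule has_derivative_eq_rhs, (rule derivative_intros q_powr_has_derivative[OF q[OF that]]
          bounded_linear.has_derivative[OF bounded_linear_vec_nth])+)
      (simp add: fun_eq_iff g'_def algebra_simps)
  have euler: "order_le 2 (jet_domain U) L" "smooth_jet (jet_domain U) L"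
    "p \<in> jet_domain U \<Longrightarrow> euler_expr L p $ 1 =
      b' (snd p 1) (snd p 2) * snd p 2 $ 2 + b (snd p 1) * snd p 3 $ 2 - g' 1 (snd p 1) (snd p 2)"
    "p \<in> jet_domain U \<Longrightarrow> euler_expr L p $ 2 =
      - b' (snd p 1) (snd p 2) * snd p 2 $ 1 - b (snd p 1) * snd p 3 $ 1 - g' 2 (snd p 1) (snd p 2)" for p
    unfolding L_def[abs_def]
    by (rule euler_expr_linear_lagrangian[OF W smooth s(1,2) s(3)[of 1] s(3)[of 2] D(1)[OF dom] D(2)[OF dom]
          DG[OF dom] Db[OF dom] Dg[OF dom] Dg[OF dom] curl[OF dom, folded b_def]]; assumption)+
  show ?thesis
  proof
    fix p assume p: "p \<in> jet_domain U"
    define v where "v = snd p 1"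
    have v: "v \<in> U" using dom[OF p] by (simp add: v_def)
    have q12: "?Q v powr (-1/2) = ?Q v * ?Q v powr (-3/2)"
      using q[OF v] by (simp add: powr_mult_base)
    note N = levi_mat_nth
    show "euler_expr L p = family_A \<kappa> h (snd p 1) *v snd p 3 + family_k \<kappa> m h (snd p 1) (snd p 2)"
      unfolding vec_eq_iff forall_2 euler(3,4)[OF p] v_def[symmetric] b_def b'_def g'_def family_A_def family_k_def
        family_sym_def lower_def q12
      by (simp add: N scaleR_matrix_vector_assoc[symmetric] mdot_commute[of h "snd p 2"] algebra_simps)
  qed (fact euler(1,2))+
qed

text \<open>It remains to find functions with curl proportional to \<open>q\<^bsup>-3/2\<^esup>\<close>.  The integral of
  \<open>q\<^bsup>-3/2\<^esup>\<close> over \<open>v\<^sup>2\<close> is \<open>v\<^sup>2 / ((1 + h\<^sub>1 v\<^sup>1 v\<^sup>1) \<surd>q)\<close>, and similarly with exchanged indices.  The two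
  denominators \<open>1 + h\<^sub>l v\<^sup>l v\<^sup>l\<close> have sum \<open>1 + q > 1\<close>, so near each point at least one of the two primitives is
  smooth.\<close>

lemma family_variational:
  fixes h :: "real^2"
  assumes U: "open U" and q: "\<And>v. v \<in> U \<Longrightarrow> 0 < 1 + mdot h v v"
    and E: "\<And>t x v v' v''. v \<in> U \<Longrightarrow> E t x v v' v'' = family_A \<kappa> h v *v v'' + family_k \<kappa> m h v v'"
  shows "variational U E"
  unfolding variational_def
proof
  fix p assume p: "p \<in> jet_domain U"
  let ?Q = "\<lambda>v. 1 + mdot h v v"
  (* on V l the primitive with denominator 1 + h l (v l)^2 is defined *)
  define V where "V l = {v \<in> U. 1 + h $ l * v $ l * v $ l \<noteq> 0}" for l :: 2
  have V_open: "open (V l)" for l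
  proof -
    have "continuous_on UNIV (\<lambda>v :: real^2. 1 + h $ l * v $ l * v $ l)" by (intro continuous_intros)
    then have "open ((\<lambda>v :: real^2. 1 + h $ l * v $ l * v $ l) -` (- {0}))"
      by (intro open_vimage open_Compl) auto
    moreover have "V l = U \<inter> (\<lambda>v. 1 + h $ l * v $ l * v $ l) -` (- {0})" by (auto simp: V_def)
    ultimately show ?thesis using U by (auto intro: open_Int)
  qed
  have V_sub: "V l \<subseteq> U" for l by (auto simp: V_def)
  then have V_q: "0 < ?Q v" if "v \<in> V l" for l v using that q by blast
  define f where "f l l' v = \<kappa> * (v $ l' * (inverse (1 + h $ l * v $ l * v $ l) * ?Q v powr (-1/2)))" for l l' :: 2 and v
  define f' where "f' l l' v w = \<kappa> * (w $ l' * (inverse (1 + h $ l * v $ l * v $ l) * ?Q v powr (-1/2))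
    + v $ l' * (inverse (1 + h $ l * v $ l * v $ l) * (- (?Q v powr (-3/2)) * mdot h v w)
      - 2 * h $ l * v $ l * w $ l * inverse (1 + h $ l * v $ l * v $ l) ^ 2 * ?Q v powr (-1/2)))"
    for l l' :: 2 and v w
  have smooth: "smooth_jet (jet_domain (V l)) (velocity_fun (f l l'))" for l l'
    unfolding velocity_fun_def[abs_def] f_def
    by (intro smooth_jet_mult smooth_jet_const smooth_jet_coord smooth_jet_inverse smooth_jet_add
        smooth_jet_q_powr open_jet_domain V_open V_q | assumption)+
      (auto simp: jet_domain_def V_def)
  have D: "(f l l' has_derivative f' l l' v) (at v)" if "v \<in> V l" for l l' v
  proof -
    have nz: "1 + h $ l * v $ l * v $ l \<noteq> 0" using that by (simp add: V_def)
    show ?thesis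
      unfolding f_def[abs_def]
      by (rule has_derivative_eq_rhs, (rule derivative_intros q_powr_has_derivative[OF V_q[OF that]]
          bounded_linear.has_derivative[OF bounded_linear_vec_nth] nz)+)
        (simp add: fun_eq_iff f'_def power2_eq_square algebra_simps)
  qed
  have f'_axis: "f' l l' v (axis l' 1) = \<kappa> * ?Q v powr (-3/2)" if "v \<in> V l" "{l, l'} = {1, 2}" for l l' v
  proof -
    have nz: "1 + h $ l * v $ l * v $ l \<noteq> 0" using that by (simp add: V_def)
    have ne: "l \<noteq> l'" using that(2) by auto
    have "?Q v = 1 + h $ l * v $ l * v $ l + h $ l' * v $ l' * v $ l'"
      using that(2) by (auto simp: mdot_def sum_2 doubleton_eq_iff)
    then have Q: "?Q v - h $ l' * v $ l' * v $ l' = 1 + h $ l * v $ l * v $ l" by simp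
    have q12: "?Q v powr (-1/2) = ?Q v * ?Q v powr (-3/2)"
      using V_q[OF that(1)] by (simp add: powr_mult_base)
    have m: "mdot h v (axis l' 1) = h $ l' * v $ l'"
      using exhaust_2[of l'] by (auto simp: mdot_def sum_2 axis_def)
    have "f' l l' v (axis l' 1) = \<kappa> * (inverse (1 + h $ l * v $ l * v $ l) * (?Q v - h $ l' * v $ l' * v $ l') * ?Q v powr (-3/2))"
      unfolding f'_def q12 m using ne by (simp add: axis_def algebra_simps)
    also have "\<dots> = \<kappa> * ?Q v powr (-3/2)"
      unfolding Q using nz by simp
    finally show ?thesis .
  qed
  define v where "v = snd p 1"
  have v: "v \<in> U" using p by (auto simp: v_def jet_domain_def)
  have "\<exists>l. v \<in> V l"
  proof (rule ccontr)
    assume "\<nexists>l. v \<in> V l"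
    then have "1 + h $ 1 * v $ 1 * v $ 1 = 0" "1 + h $ 2 * v $ 2 * v $ 2 = 0"
      using v by (auto simp: V_def)
    then show False using q[OF v] by (simp add: mdot_def sum_2)
  qed
  then obtain l where l: "v \<in> V l" by blast
  obtain L where L: "order_le 2 (jet_domain (V l)) L" "smooth_jet (jet_domain (V l)) L"
    "\<And>p. p \<in> jet_domain (V l) \<Longrightarrow> euler_expr L p = family_A \<kappa> h (snd p 1) *v snd p 3 + family_k \<kappa> m h (snd p 1) (snd p 2)"
  proof (cases "l = 1")
    case True
    have zero: "smooth_jet (jet_domain (V 1)) (velocity_fun (\<lambda>_. 0))"
      by (simp add: velocity_fun_def[abs_def] smooth_jet_const)
    have curl: "f' 1 2 v (axis 2 1) - (\<lambda>_ _. 0) v (axis 1 1) = \<kappa> * ?Q v powr (-3/2)" if "v \<in> V 1" for v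
      using f'_axis[OF that, of 2] by simp
    show ?thesis
      by (rule family_euler_expr[of "V 1" h "f 1 2" "\<lambda>_. 0" "f' 1 2" "\<lambda>_ _. 0" \<kappa> m,
            OF V_open V_q smooth zero D has_derivative_const curl])
        (assumption | rule that[unfolded True])+
  next
    case False
    then have l2: "l = 2" using exhaust_2[of l] by auto
    have zero: "smooth_jet (jet_domain (V 2)) (velocity_fun (\<lambda>_. 0))"
      by (simp add: velocity_fun_def[abs_def] smooth_jet_const)
    have minus: "smooth_jet (jet_domain (V 2)) (velocity_fun (\<lambda>v. - f 2 1 v))"
      using smooth_jet_diff[OF open_jet_domain[OF V_open] smooth_jet_const[of _ 0] smooth[of 2 1]]
      by (simp add: velocity_fun_def[abs_def])
    have curl: "(\<lambda>_ _. 0) v (axis 2 1) - (\<lambda>v w. - f' 2 1 v w) v (axis 1 1) = \<kappa> * ?Q v powr (-3/2)" if "v \<in> V 2" for v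
      using f'_axis[OF that, of 1] by (simp add: insert_commute)
    show ?thesis
      by (rule family_euler_expr[of "V 2" h "\<lambda>_. 0" "\<lambda>v. - f 2 1 v" "\<lambda>_ _. 0" "\<lambda>v w. - f' 2 1 v w" \<kappa> m,
            OF V_open V_q zero minus has_derivative_const has_derivative_minus[OF D] curl])
        (assumption | rule that[unfolded l2])+
  qed
  have "p \<in> jet_domain (V l)" using l by (cases p) (simp add: jet_domain_def v_def)
  moreover have "jet_domain (V l) \<subseteq> jet_domain U" using V_sub by (auto simp: jet_domain_def)
  moreover have "\<forall>(t, u)\<in>jet_domain (V l). E t (u 0) (u 1) (u 2) (u 3) = euler_expr L (t, u)"
  proof clarify
    fix t and u :: "nat \<Rightarrow> real^2" assume tu: "(t, u) \<in> jet_domain (V l)"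
    then have "u 1 \<in> U" using V_sub by (auto simp: jet_domain_def)
    then show "E t (u 0) (u 1) (u 2) (u 3) = euler_expr L (t, u)"
      using E L(3)[OF tu] by simp
  qed
  ultimately show "\<exists>W L r. open W \<and> p \<in> W \<and> W \<subseteq> jet_domain U \<and> order_le r W L \<and> smooth_jet W L \<and>
      (\<forall>(t, u)\<in>W. E t (u 0) (u 1) (u 2) (u 3) = euler_expr L (t, u))"
    using L(1,2) open_jet_domain[OF V_open] by blast
qed

text \<open>\<open>m\<close> times the Hessian of \<open>\<surd>q\<close>.\<close>

definition family_B :: "real \<Rightarrow> real^2 \<Rightarrow> real^2 \<Rightarrow> real^2^2" where
  "family_B m h v = (\<chi> i j. m * (1 + mdot h v v) powr (-3/2) *
     ((1 + mdot h v v) * (if i = j then h $ i else 0) - h $ i * v $ i * h $ j * v $ j))"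

lemma family_B_mult: "family_B m h v *v y = (m * (1 + mdot h v v) powr (-3/2)) *\<^sub>R family_sym h v y"
  by (simp add: family_B_def family_sym_def vec_eq_iff forall_2 matrix_vector_mult_def sum_2 lower_def
      mdot_def algebra_simps)

lemma family_k_term:
  assumes "open U" and q: "\<And>v. v \<in> U \<Longrightarrow> 0 < 1 + mdot h v v" and v: "v \<in> U"
  shows "k_term (\<lambda>t x. family_A \<kappa> h) (\<lambda>t x. family_B m h) (\<lambda>t x v. 0) t x v y = family_k \<kappa> m h v y"
proof -
  let ?a = "\<lambda>v. \<kappa> * (1 + mdot h v v) powr (-3/2)"
  let ?a' = "\<lambda>l. - 3 * \<kappa> * (1 + mdot h v v) powr (-5/2) * (h $ l * v $ l)"
  have a': "((\<lambda>s. ?a (v + s *\<^sub>R axis l 1)) has_field_derivative ?a' l) (at 0)" for l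
  proof -
    have m: "mdot h v (s *\<^sub>R axis l 1) = s * (h $ l * v $ l)" for s
      using exhaust_2[of l] by (auto simp: mdot_def sum_2 axis_def)
    have line: "((\<lambda>s. v + s *\<^sub>R axis l 1) has_derivative (\<lambda>s. s *\<^sub>R axis l 1)) (at 0)"
      by (auto intro!: derivative_eq_intros)
    have "(?a has_derivative (\<lambda>w. - 3 * \<kappa> * (1 + mdot h v v) powr (-5/2) * mdot h v w)) (at v)"
      by (rule has_derivative_eq_rhs, (rule derivative_intros q_powr_has_derivative[OF q[OF v]])+)
        (simp add: fun_eq_iff)
    then have "(?a has_derivative (\<lambda>w. - 3 * \<kappa> * (1 + mdot h v v) powr (-5/2) * mdot h v w)) (at (v + 0 *\<^sub>R axis l 1))"
      by simp
    from has_derivative_compose[OF line this]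
    show ?thesis
      by (rule has_derivative_imp_has_field_derivative) (simp add: m)
  qed
  have "k_term (\<lambda>t x. family_A \<kappa> h) (\<lambda>t x. family_B m h) (\<lambda>t x v. 0) t x v y
    = (\<Sum>l\<in>UNIV. y $ l * ?a' l) *\<^sub>R (levi_mat *v y) + family_B m h v *v y + 0"
    by (rule k_term_levi[of U v "\<lambda>t x. family_A \<kappa> h" t x ?a, OF assms(1) v _ a']) (simp add: family_A_def)
  also have "(\<Sum>l\<in>UNIV. y $ l * ?a' l) = - 3 * \<kappa> * mdot h v y * (1 + mdot h v v) powr (-5/2)"
    by (simp add: sum_2 mdot_def algebra_simps)
  finally show ?thesis
    by (simp add: family_B_mult family_k_def)
qed

lemma family_group_invariant:
  assumes U: "open U" and q: "\<And>v. v \<in> U \<Longrightarrow> 0 < 1 + mdot h v v"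
    and k: "\<And>t x v y. v \<in> U \<Longrightarrow> k t x v y = family_k \<kappa> m h v y"
  shows "group_invariant 1 h U (\<lambda>t x. family_A \<kappa> h) k"
  unfolding group_invariant_iff
proof (intro conjI allI impI)
  let ?A = "\<lambda>(t :: real) (x :: real^2). family_A \<kappa> h"
  show indep: "independent_of_position U ?A k"
    by (simp add: independent_of_position_def k)
  fix \<pi> \<Omega> assume \<Omega>: "transpose \<Omega> = - (\<Omega> :: real^2^2)"
  show "preserves_equation U ?A k (generator 1 h \<pi> \<Omega>)"
    unfolding preserves_equation_def
    by (intro exI allI impI, subst lie_derivative_family[OF U _ indep q _ k has_derivative_const \<Omega>])
      (assumption | rule refl | simp)+
qed

lemma family_third_order_form:
  assumes U: "open U" and q: "\<And>v. v \<in> U \<Longrightarrow> 0 < 1 + mdot h v v" and "\<kappa> \<noteq> 0"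
    and E: "\<And>t x v v' v''. v \<in> U \<Longrightarrow> E t x v v' v'' = family_A \<kappa> h v *v v'' + family_k \<kappa> m h v v'"
  shows "third_order_form U E (\<lambda>t x. family_A \<kappa> h) (\<lambda>t x. family_B m h) (\<lambda>t x v. 0)"
  unfolding third_order_form_def
proof (intro conjI allI ballI)
  note sq = smooth_jet_q_powr[OF U q]
  note W = open_jet_domain[OF U]
  show "smooth_coeff U (\<lambda>t x v. family_A \<kappa> h v $ i $ j)" for i j
    unfolding smooth_coeff_def case_prod_beta' family_A_def vector_scaleR_component real_scaleR_def
    by (intro smooth_jet_mult smooth_jet_const sq W | assumption)+
  show "smooth_coeff U (\<lambda>t x v. family_B m h v $ i $ j)" for i j
    unfolding smooth_coeff_def case_prod_beta' family_B_def vec_lambda_beta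
    by (intro smooth_jet_mult smooth_jet_diff smooth_jet_const smooth_jet_coord smooth_jet_q sq W | assumption)+
  show "smooth_coeff U (\<lambda>t x v. 0 $ i)" for i
    unfolding smooth_coeff_def case_prod_beta' by (rule smooth_jet_const)
  fix t :: real and x v :: "real^2" assume v: "v \<in> U"
  show "transpose (family_A \<kappa> h v) = - family_A \<kappa> h v"
    by (simp add: family_A_def levi_mat_def levi_def vec_eq_iff forall_2 transpose_def)
  define a where "a = \<kappa> * (1 + mdot h v v) powr (-3/2)"
  have a: "a \<noteq> 0" using q[OF v] \<open>\<kappa> \<noteq> 0\<close> by (simp add: a_def)
  have "(a *\<^sub>R levi_mat) ** (- inverse a *\<^sub>R levi_mat) = mat 1" "(- inverse a *\<^sub>R levi_mat) ** (a *\<^sub>R levi_mat) = mat 1"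
    using a by (simp_all add: vec_eq_iff forall_2 matrix_matrix_mult_def sum_2 levi_mat_def levi_def mat_def)
  then show "invertible (family_A \<kappa> h v)"
    unfolding invertible_def family_A_def a_def[symmetric] by blast
  show "E t x v v' v'' = family_A \<kappa> h v *v v'' + k_term (\<lambda>t x. family_A \<kappa> h) (\<lambda>t x. family_B m h) (\<lambda>t x v. 0) t x v v'"
    for v' v''
    using E[OF v] family_k_term[OF U q v] by simp
qed

section \<open>The classification\<close>

theorem proposition3:
  fixes \<eta> :: real and g :: "real^2" and U :: "(real^2) set"
    and E :: "real \<Rightarrow> real^2 \<Rightarrow> real^2 \<Rightarrow> real^2 \<Rightarrow> real^2 \<Rightarrow> real^2"
  assumes "\<eta> \<in> {1, -1}" and "\<forall>i. g $ i \<in> {1, -1}"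
    and "open U" and "connected U" and "U \<subseteq> {v. 1 + mdot (\<eta> *\<^sub>R g) v v > 0}"
  shows "invariant_euler_poisson \<eta> g U E \<longleftrightarrow>
    (\<exists>\<kappa> \<mu>. \<kappa> \<noteq> 0 \<and>
      (\<forall>t x. \<forall>v\<in>U. \<forall>v' v''. E t x v v' v'' = \<kappa> *\<^sub>R invariant_expr (\<eta> *\<^sub>R g) \<mu> v v' v''))"
proof -
  define h where "h = \<eta> *\<^sub>R g"
  have h: "\<forall>i. h $ i \<in> {1, -1}" using assms(1,2) by (auto simp: h_def)
  have q: "0 < 1 + mdot h v v" if "v \<in> U" for v using assms(5) that by (auto simp: h_def)
  have "(\<exists>\<kappa> \<mu>. \<kappa> \<noteq> 0 \<and> (\<forall>t x. \<forall>v\<in>U. \<forall>v' v''. E t x v v' v'' = \<kappa> *\<^sub>R invariant_expr h \<mu> v v' v''))"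
    if inv: "invariant_euler_poisson \<eta> g U E"
  proof -
    obtain A B c where E: "variational U E" "third_order_form U E A B c" "group_invariant 1 h U A (k_term A B c)"
      using inv unfolding invariant_euler_poisson_def group_invariant_normalize[OF assms(1)] h_def by blast
    show ?thesis
      by (rule invariant_implies_family[OF assms(3,4) h q E]) blast+
  qed
  moreover have "invariant_euler_poisson \<eta> g U E"
    if "\<kappa> \<noteq> 0" and "\<forall>t x. \<forall>v\<in>U. \<forall>v' v''. E t x v v' v'' = \<kappa> *\<^sub>R invariant_expr h \<mu> v v' v''" for \<kappa> \<mu>
  proof -
    have E: "E t x v v' v'' = family_A \<kappa> h v *v v'' + family_k \<kappa> (\<kappa> * \<mu>) h v v'" if "v \<in> U" for t x v v' v''
      using \<open>\<forall>t x. \<forall>v\<in>U. \<forall>v' v''. _ = _\<close> that invariant_expr_family[OF q[OF that]] by simp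
    show ?thesis
      unfolding invariant_euler_poisson_def group_invariant_normalize[OF assms(1)] h_def[symmetric]
    proof (intro conjI exI)
      show "variational U E"
        by (rule family_variational[of U h E \<kappa> "\<kappa> * \<mu>"]) (rule assms(3) | erule q | erule E)+
      show "third_order_form U E (\<lambda>t x. family_A \<kappa> h) (\<lambda>t x. family_B (\<kappa> * \<mu>) h) (\<lambda>t x v. 0)"
        by (rule family_third_order_form) (rule assms(3) \<open>\<kappa> \<noteq> 0\<close> | erule q | erule E)+
      show "group_invariant 1 h U (\<lambda>t x. family_A \<kappa> h)
          (k_term (\<lambda>t x. family_A \<kappa> h) (\<lambda>t x. family_B (\<kappa> * \<mu>) h) (\<lambda>t x v. 0))"
        by (rule family_group_invariant[OF assms(3) _ family_k_term[OF assms(3)]]) (erule q | assumption)+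
    qed
  qed
  ultimately show ?thesis unfolding h_def by blast
qed

end
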